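(* Let $n,r\ge1$ be integers, and let $\boldsymbol\mu=(\mu_1,\dots,\mu_r)$ where each $\mu_i=(a_i,0,0,\dots,0,0,-b_i)\in\mathbb Z^n$ for $a_i,b_i\in\mathbb Z_{\ge0}$. If $n\ge 2r$, then $\mathrm{LRC}^{0}_{\boldsymbol\mu}$ is equal to the number of hollow contingency tables with margins $(a_1,\dots,a_r)$ and $(b_1,\dots,b_r)$.
   Context: For a weakly decreasing $\mu\in\mathbb Z^n$, $F_n^{\mu}$ denotes the irreducible rational representation of $\mathrm{GL}_n=\mathrm{GL}(n,\mathbb C)$ with highest weight $\mu$ (with respect to the upper triangular Borel subgroup and diagonal torus). For a vector $\boldsymbol\mu=(\mu_1,\dots,\mu_r)$ of weakly decreasing $n$-tuples of integers, $\mathrm{LRC}^{0}_{\boldsymbol\mu}:=\dim\mathrm{Hom}_{\mathrm{GL}_n}(F_n^{0},F_n^{\mu_1}\otimes\cdots\otimes F_n^{\mu_r})$, where $F_n^0$ is the trivial representation; i.e. $\mathrm{LRC}^0_{\boldsymbol\mu}=\dim(F_n^{\mu_1}\otimes\cdots\otimes F_n^{\mu_r})^{\mathrm{GL}_n}$. A contingency table with margins $(a_1,\dots,a_r)$ and $(b_1,\dots,b_r)$ is an $r\times r$ matrix of nonnegative integers whose $i$-th row sum is $a_i$ and whose $j$-th column sum is $b_j$ for all $i,j$. It is hollow if all its diagonal entries are $0$. *)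

theory Defs
  imports "Jordan_Normal_Form.VS_Connect" "Jordan_Normal_Form.Determinant"
begin

section \<open>Rational representations of the general linear group\<close>

definition GL :: "nat \<Rightarrow> complex mat monoid" where
  "GL n = units_of (ring_mat TYPE(complex) n ())"

lemma carrier_GL: "carrier (GL n) = {A \<in> carrier_mat n n. det A \<noteq> 0}"
proof -
  have "Units (ring_mat TYPE(complex) n ()) \<subseteq> carrier_mat n n"
    by (auto simp: Units_def ring_mat_def)
  then show ?thesis
    unfolding GL_def units_of_def
    using unit_imp_det_non_zero[of _ n "()"] det_non_zero_imp_unit[of _ n "()"] by auto
qed

text \<open>The coordinate ring of the affine variety \<open>GL n\<close>: all polynomials in the matrix entries
  and the inverse of the determinant.\<close>

inductive_set regular_functions :: "nat \<Rightarrow> (complex mat \<Rightarrow> complex) set" for n :: nat where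
  const: "(\<lambda>_. c) \<in> regular_functions n"
| entry: "i < n \<Longrightarrow> j < n \<Longrightarrow> (\<lambda>g. g $$ (i, j)) \<in> regular_functions n"
| inverse_det: "(\<lambda>g. inverse (det g)) \<in> regular_functions n"
| add: "f \<in> regular_functions n \<Longrightarrow> h \<in> regular_functions n \<Longrightarrow>
    (\<lambda>g. f g + h g) \<in> regular_functions n"
| mult: "f \<in> regular_functions n \<Longrightarrow> h \<in> regular_functions n \<Longrightarrow>
    (\<lambda>g. f g * h g) \<in> regular_functions n"

text \<open>A finite-dimensional representation is given in coordinates: \<open>g\<close> acts on the space
  \<open>carrier_vec (deg R)\<close> of column vectors by the matrix \<open>act R g\<close>.
  Values of \<open>act R\<close> outside \<open>GL n\<close> play no role.\<close>

record mat_rep =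
  deg :: nat
  act :: "complex mat \<Rightarrow> complex mat"

definition rational_rep :: "nat \<Rightarrow> mat_rep \<Rightarrow> bool" where
  "rational_rep n R \<longleftrightarrow>
     act R \<in> hom (GL n) (GL (deg R)) \<and>
     (\<forall>i<deg R. \<forall>j<deg R. \<exists>f\<in>regular_functions n.
        \<forall>g\<in>carrier (GL n). act R g $$ (i, j) = f g)"

definition invariant_subspace :: "nat \<Rightarrow> mat_rep \<Rightarrow> complex vec set \<Rightarrow> bool" where
  "invariant_subspace n R W \<longleftrightarrow>
     subspace class_ring W (module_vec TYPE(complex) (deg R)) \<and>
     (\<forall>g\<in>carrier (GL n). \<forall>w\<in>W. act R g *\<^sub>v w \<in> W)"

definition irreducible_rep :: "nat \<Rightarrow> mat_rep \<Rightarrow> bool" where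
  "irreducible_rep n R \<longleftrightarrow>
     deg R > 0 \<and>
     (\<forall>W. invariant_subspace n R W \<longrightarrow> W = {0\<^sub>v (deg R)} \<or> W = carrier_vec (deg R))"

text \<open>A highest weight vector is a nonzero weight vector for the diagonal torus which is fixed by
  the upper unitriangular matrices, the unipotent radical of the upper triangular Borel
  subgroup.\<close>

definition highest_weight_vector :: "nat \<Rightarrow> mat_rep \<Rightarrow> int list \<Rightarrow> complex vec \<Rightarrow> bool" where
  "highest_weight_vector n R \<mu> v \<longleftrightarrow>
     v \<in> carrier_vec (deg R) \<and> v \<noteq> 0\<^sub>v (deg R) \<and>
     (\<forall>t\<in>carrier (GL n). diagonal_mat t \<longrightarrow>
        act R t *\<^sub>v v = (\<Prod>i<n. t $$ (i, i) powi (\<mu> ! i)) \<cdot>\<^sub>v v) \<and>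
     (\<forall>u\<in>carrier (GL n). upper_triangular u \<and> (\<forall>i<n. u $$ (i, i) = 1) \<longrightarrow>
        act R u *\<^sub>v v = v)"

definition is_irrep_with_highest_weight :: "nat \<Rightarrow> int list \<Rightarrow> mat_rep \<Rightarrow> bool" where
  "is_irrep_with_highest_weight n \<mu> R \<longleftrightarrow>
     rational_rep n R \<and> irreducible_rep n R \<and> (\<exists>v. highest_weight_vector n R \<mu> v)"

text \<open>For a weakly decreasing \<open>\<mu>\<close> of length \<open>n\<close> such a representation exists and is unique
  up to isomorphism; \<open>F n \<mu>\<close> is a chosen representative of the isomorphism class.\<close>

definition F :: "nat \<Rightarrow> int list \<Rightarrow> mat_rep" where
  "F n \<mu> = (SOME R. is_irrep_with_highest_weight n \<mu> R)"


section \<open>Tensor products and intertwiners\<close>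

definition kronecker :: "complex mat \<Rightarrow> complex mat \<Rightarrow> complex mat" where
  "kronecker A B = mat (dim_row A * dim_row B) (dim_col A * dim_col B)
     (\<lambda>(i, j). A $$ (i div dim_row B, j div dim_col B) * B $$ (i mod dim_row B, j mod dim_col B))"

definition tensor_rep :: "mat_rep \<Rightarrow> mat_rep \<Rightarrow> mat_rep" where
  "tensor_rep R S = \<lparr>deg = deg R * deg S, act = (\<lambda>g. kronecker (act R g) (act S g))\<rparr>"

definition trivial_rep :: mat_rep where
  "trivial_rep = \<lparr>deg = 1, act = (\<lambda>_. 1\<^sub>m 1)\<rparr>"

definition tensor_reps :: "mat_rep list \<Rightarrow> mat_rep" where
  "tensor_reps Rs = foldr tensor_rep Rs trivial_rep"

definition intertwiners :: "nat \<Rightarrow> mat_rep \<Rightarrow> mat_rep \<Rightarrow> complex mat set" where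
  "intertwiners n R S =
     {T \<in> carrier_mat (deg S) (deg R). \<forall>g\<in>carrier (GL n). T * act R g = act S g * T}"

definition dim_Hom :: "nat \<Rightarrow> mat_rep \<Rightarrow> mat_rep \<Rightarrow> nat" where
  "dim_Hom n R S = vectorspace.dim class_ring
     (module_mat TYPE(complex) (deg S) (deg R) \<lparr>carrier := intertwiners n R S\<rparr>)"

definition LRC :: "nat \<Rightarrow> int list \<Rightarrow> int list list \<Rightarrow> nat" where
  "LRC n \<nu> \<mu>s = dim_Hom n (F n \<nu>) (tensor_reps (map (F n) \<mu>s))"


section \<open>Contingency tables\<close>

definition contingency_tables :: "nat list \<Rightarrow> nat list \<Rightarrow> nat mat set" where
  "contingency_tables a b =
     {M \<in> carrier_mat (length a) (length b).
        (\<forall>i<length a. (\<Sum>j<length b. M $$ (i, j)) = a ! i) \<and>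
        (\<forall>j<length b. (\<Sum>i<length a. M $$ (i, j)) = b ! j)}"

definition hollow :: "nat mat \<Rightarrow> bool" where
  "hollow M \<longleftrightarrow> (\<forall>i<dim_row M. M $$ (i, i) = 0)"

end

theory Submission
  imports Defs "HOL-Library.Multiset" "HOL-Combinatorics.Permutations"
begin

text \<open>For \<open>g\<close> in \<open>GL n\<close> let \<open>p(g)\<close> be the first row of \<open>g\<close> and \<open>q(g)\<close> the last column of its inverse.
These two vectors satisfy \<open>p(g) \<bullet> q(g) = 0\<close> when \<open>n \<ge> 2\<close>, because their product is an off-diagonal entry
of \<open>g * g\<^sup>-\<^sup>1\<close>. The whole argument takes place in the ring of functions of \<open>p\<close> and \<open>q\<close>.

An irreducible representation with highest weight \<open>(a, 0, \<dots>, 0, -b)\<close> is understood through one matrix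
coefficient. If \<open>v\<close> is a highest weight vector, some linear functional \<open>f\<close> takes the value \<open>1\<close> on the
orbit of \<open>v\<close> under the lower unitriangular matrices; since lower unitriangular times
diagonal times upper unitriangular matrices are dense, \<open>f (g v) = p\<^sub>0(g)\<^sup>a * q\<^sub>n\<^sub>-\<^sub>1(g)\<^sup>b\<close> for all \<open>g\<close>
(\<open>highest_weight_functional\<close>). Thus the representation embeds into functions on the group by
\<open>x \<mapsto> (g \<mapsto> f (g x))\<close>, and it is determined by its weight. The image consists of all polynomials in \<open>p\<close>
and \<open>q\<close> of bidegree \<open>(a, b)\<close>: it contains no others because it is spanned by translates of the function
above, and it contains all of them because it is stable under the derivations
\<open>p\<^sub>i \<partial>/\<partial>p\<^sub>j - q\<^sub>j \<partial>/\<partial>q\<^sub>i\<close> (\<open>irrep_has_coefficient_model\<close>). Conversely the function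
\<open>\<phi> = p\<^sub>0\<^sup>a * q\<^sub>n\<^sub>-\<^sub>1\<^sup>b\<close> alone yields a representation: \<open>(x, y) \<mapsto> \<phi> (x * y)\<close> has finite rank, and a maximal
invertible matrix of its values carries the action (\<open>irrep_exists\<close>).

Vectors of the tensor product therefore become functions of \<open>r\<close> group elements, of bidegree
\<open>(a\<^sub>i, b\<^sub>i)\<close> in \<open>(p\<^sub>i, q\<^sub>i)\<close>, and invariant vectors become functions that are invariant under
simultaneous right translation. Typical invariants are the pairings \<open>z\<^sub>i\<^sub>j = p\<^sub>i \<bullet> q\<^sub>j\<close>, and they suffice: for
generic arguments one may translate so that \<open>p\<^sub>i\<close> becomes the \<open>i\<close>-th unit vector and then
contract the remaining coordinates to zero, after which only the \<open>z\<^sub>i\<^sub>j\<close> are left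
(\<open>invariant_in_pairing_span\<close>). As \<open>z\<^sub>i\<^sub>i = 0\<close>, only monomials whose exponent matrix is hollow survive, and
comparing degrees under the torus acting on one argument leaves exactly those with the
right margins (\<open>invariant_expansion\<close>). Each such monomial does come from the tensor product
(\<open>pairing_product_in_span\<close>), and the monomials are linearly independent because for \<open>n \<ge> 2 * r\<close> the
off-diagonal pairings can be prescribed arbitrarily (\<open>exists_prescribed_pairings\<close>). So the hollow contingency
tables index a basis of the invariants (\<open>dim_invariants\<close>).\<close>

section \<open>Separating subspaces by functionals\<close>

lemma subspaceI:
  assumes "W \<subseteq> carrier_vec d" "0\<^sub>v d \<in> W"
    and "\<And>v w. v \<in> W \<Longrightarrow> w \<in> W \<Longrightarrow> v + w \<in> W"
    and "\<And>c w. w \<in> W \<Longrightarrow> c \<cdot>\<^sub>v w \<in> W"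
  shows "subspace class_ring W (module_vec TYPE(complex) d)"
proof -
  interpret vec_space "TYPE(complex)" d .
  show ?thesis
    using assms
    by (unfold_locales) (auto simp: module_vec_simps submodule_def class_ring_simps intro!: submodule.intro vec_module)
qed

lemma subspaceD:
  assumes "subspace class_ring W (module_vec TYPE(complex) d)"
  shows "W \<subseteq> carrier_vec d" "0\<^sub>v d \<in> W"
    and "\<And>v w. v \<in> W \<Longrightarrow> w \<in> W \<Longrightarrow> v + w \<in> W"
    and "\<And>c w. w \<in> W \<Longrightarrow> c \<cdot>\<^sub>v w \<in> W"
  using assms unfolding subspace_def submodule_def
  by (auto simp: module_vec_simps class_ring_simps)

text \<open>Gaussian elimination on the last coordinate: if some element of \<open>W\<close> does not vanish there, it is used to
clear that coordinate in \<open>x\<close> and in \<open>W\<close>, and the functional found in dimension \<open>d\<close> is extended so that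
it kills the pivot.\<close>

lemma separating_functional_fun:
  fixes W :: "(nat \<Rightarrow> complex) set"
  assumes "\<And>w k. w \<in> W \<Longrightarrow> k \<ge> d \<Longrightarrow> w k = 0"
    and "(\<lambda>_. 0) \<in> W"
    and "\<And>v w c. v \<in> W \<Longrightarrow> w \<in> W \<Longrightarrow> (\<lambda>k. v k + c * w k) \<in> W"
    and "x \<notin> W" "\<And>k. k \<ge> d \<Longrightarrow> x k = 0"
  shows "\<exists>l. (\<forall>w\<in>W. (\<Sum>k<d. l k * w k) = 0) \<and> (\<Sum>k<d. l k * x k) \<noteq> 0"
  using assms
proof (induction d arbitrary: W x)
  case 0
  then have "x = (\<lambda>_. 0)" by auto
  with 0 show ?case by simp
next
  case (Suc d)
  show ?case
  proof (cases "\<exists>w\<in>W. w d \<noteq> 0")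
    case True
    then obtain u where u: "u \<in> W" "u d \<noteq> 0" by blast
    define w where "w = (\<lambda>k. 0 + (1 / u d) * u k)"
    have w: "w \<in> W" "w d = 1"
      using Suc.prems(3)[OF Suc.prems(2) u(1), of "1 / u d"] u by (auto simp: w_def)
    define x' where "x' = (\<lambda>k. x k - x d * w k)"
    define W' where "W' = {v \<in> W. v d = 0}"
    have W'0: "(\<lambda>_. 0) \<in> W'" using Suc.prems(2) by (simp add: W'_def)
    have W'1: "(\<lambda>k. u k + c * v k) \<in> W'" if "u \<in> W'" "v \<in> W'" for u v c
      using Suc.prems(3)[of u v c] that by (simp add: W'_def)
    have "x' \<notin> W'"
    proof
      assume "x' \<in> W'"
      then have "(\<lambda>k. x' k + x d * w k) \<in> W" using Suc.prems(3) w by (auto simp: W'_def)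
      then show False using Suc.prems(4) by (simp add: x'_def)
    qed
    moreover have "v k = 0" if "v \<in> W'" "k \<ge> d" for v k
      using that Suc.prems(1)[of v k] by (cases "k = d") (auto simp: W'_def)
    moreover have "x' k = 0" if "k \<ge> d" for k
    proof (cases "k = d")
      case False
      then have "Suc d \<le> k" using that by simp
      then show ?thesis by (simp add: x'_def Suc.prems(5) Suc.prems(1)[OF w(1)])
    qed (simp add: x'_def w(2))
    ultimately obtain l where l: "\<forall>v\<in>W'. (\<Sum>k<d. l k * v k) = 0" "(\<Sum>k<d. l k * x' k) \<noteq> 0"
      using Suc.IH[of W' x'] W'0 W'1 by blast
    define s where "s = (\<Sum>k<d. l k * w k)"
    define l' where "l' = l(d := - s)"
    have l'_eq: "(\<Sum>k<Suc d. l' k * y k) = (\<Sum>k<d. l k * (y k - y d * w k))" for y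
      by (simp add: l'_def s_def algebra_simps sum_subtractf sum_distrib_left)
    have "(\<Sum>k<Suc d. l' k * v k) = 0" if "v \<in> W" for v
    proof -
      have "(\<lambda>k. v k + (- v d) * w k) \<in> W'"
        using Suc.prems(3)[OF that w(1), of "- v d"] w(2) by (simp add: W'_def)
      then show ?thesis using l(1) unfolding l'_eq by fastforce
    qed
    moreover have "(\<Sum>k<Suc d. l' k * x k) \<noteq> 0"
      using l(2) unfolding l'_eq x'_def .
    ultimately show ?thesis by blast
  next
    case False
    show ?thesis
    proof (cases "x d = 0")
      case True
      have "v k = 0" if "v \<in> W" "k \<ge> d" for v k
        using that False Suc.prems(1)[of v k] by (cases "k = d") auto
      moreover have "x k = 0" if "k \<ge> d" for k
        using that Suc.prems(5)[of k] True by (cases "k = d") auto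
      ultimately obtain l where "\<forall>w\<in>W. (\<Sum>k<d. l k * w k) = 0" "(\<Sum>k<d. l k * x k) \<noteq> 0"
        using Suc.IH[of W x] Suc.prems(2-4) by blast
      then show ?thesis using True False by (intro exI[of _ l]) auto
    next
      case nz: False
      show ?thesis
        using False nz
        by (intro exI[of _ "\<lambda>k. if k = d then 1 else 0"]) simp
    qed
  qed
qed

lemma separating_functional:
  assumes W: "subspace class_ring W (module_vec TYPE(complex) d)"
    and x: "x \<in> carrier_vec d" "x \<notin> W"
  shows "\<exists>l\<in>carrier_vec d. (\<forall>w\<in>W. l \<bullet> w = 0) \<and> l \<bullet> x \<noteq> 0"
proof -
  define ext where "ext = (\<lambda>w k. if k < d then w $ k else (0::complex))"
  note WD = subspaceD[OF W]
  have inj: "w = vec d (ext w)" if "w \<in> carrier_vec d" for w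
    using that by (intro eq_vecI) (auto simp: ext_def)
  have ext0: "ext w k = 0" if "k \<ge> d" for w k
    using that by (simp add: ext_def)
  have "ext x \<notin> ext ` W"
  proof
    assume "ext x \<in> ext ` W"
    then obtain w where "w \<in> W" "ext x = ext w" by blast
    then have "x = w" using inj[OF x(1)] inj[of w] WD(1) by auto
    with \<open>w \<in> W\<close> x show False by simp
  qed
  moreover have "(\<lambda>k. u k + c * w k) \<in> ext ` W" if uw: "u \<in> ext ` W" "w \<in> ext ` W" for u w c
  proof -
    obtain u' w' where *: "u' \<in> W" "w' \<in> W" "u = ext u'" "w = ext w'" using uw by blast
    have "(\<lambda>k. u k + c * w k) = ext (u' + c \<cdot>\<^sub>v w')"
      using * WD(1) by (auto simp: ext_def fun_eq_iff)
    then show ?thesis using * WD by blast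
  qed
  moreover have "(\<lambda>_. 0) \<in> ext ` W"
    by (rule image_eqI[OF _ WD(2)]) (auto simp: ext_def)
  moreover have "w k = 0" if "w \<in> ext ` W" "k \<ge> d" for w k
    using that ext0 by blast
  ultimately obtain l where l: "\<forall>w\<in>ext ` W. (\<Sum>k<d. l k * w k) = 0" "(\<Sum>k<d. l k * ext x k) \<noteq> 0"
    using separating_functional_fun[of "ext ` W" d "ext x"] ext0 by blast
  have "vec d l \<bullet> w = (\<Sum>k<d. l k * ext w k)" if "w \<in> carrier_vec d" for w
    using that by (auto simp: scalar_prod_def ext_def lessThan_atLeast0 intro!: sum.cong)
  then show ?thesis using l x WD(1) by (intro bexI[of _ "vec d l"]) auto
qed

section \<open>The general linear group\<close>

lemma GL_iff: "g \<in> carrier (GL n) \<longleftrightarrow> g \<in> carrier_mat n n \<and> det g \<noteq> 0"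
  by (simp add: carrier_GL)

lemma mult_GL [simp]: "g \<otimes>\<^bsub>GL n\<^esub> h = g * h"
  by (simp add: GL_def units_of_def ring_mat_def)

text \<open>An explicit inverse, so that its entries are visibly polynomials in the entries and the inverse
determinant.\<close>

definition gl_inv :: "complex mat \<Rightarrow> complex mat" where
  "gl_inv g = inverse (det g) \<cdot>\<^sub>m adj_mat g"

lemma GL_carrier: "g \<in> carrier (GL n) \<Longrightarrow> g \<in> carrier_mat n n"
  by (simp add: carrier_GL)

lemma gl_inv:
  assumes "g \<in> carrier (GL n)"
  shows gl_inv_GL: "gl_inv g \<in> carrier (GL n)"
    and gl_inv_right: "g * gl_inv g = 1\<^sub>m n"
    and gl_inv_left: "gl_inv g * g = 1\<^sub>m n"
proof -
  have g: "g \<in> carrier_mat n n" "det g \<noteq> 0" using assms by (auto simp: GL_iff)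
  note adj = adj_mat[OF g(1)]
  show r: "g * gl_inv g = 1\<^sub>m n"
    unfolding gl_inv_def mult_smult_distrib[OF g(1) adj(1)] adj(2)
    using g(2) by (intro eq_matI) auto
  show "gl_inv g * g = 1\<^sub>m n"
    unfolding gl_inv_def mult_smult_assoc_mat[OF adj(1) g(1)] adj(3)
    using g(2) by (intro eq_matI) auto
  have c: "gl_inv g \<in> carrier_mat n n" using adj(1) by (simp add: gl_inv_def)
  have "det g * det (gl_inv g) = 1" using det_mult[OF g(1) c] r by simp
  then show "gl_inv g \<in> carrier (GL n)" using c by (auto simp: GL_iff)
qed

lemma GL_mult [intro]: "g \<in> carrier (GL n) \<Longrightarrow> h \<in> carrier (GL n) \<Longrightarrow> g * h \<in> carrier (GL n)"
  by (auto simp: GL_iff det_mult)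

lemma GL_one [intro, simp]: "1\<^sub>m n \<in> carrier (GL n)"
  by (simp add: GL_iff)

lemma GL_of_inverse:
  assumes "g \<in> carrier_mat n n" "h \<in> carrier_mat n n" "g * h = 1\<^sub>m n"
  shows "g \<in> carrier (GL n)" "gl_inv g = h"
proof -
  have "det g * det h = 1" using det_mult[OF assms(1,2)] assms(3) by simp
  then show g: "g \<in> carrier (GL n)" using assms by (auto simp: GL_iff)
  have "gl_inv g = gl_inv g * (g * h)"
    using assms(3) GL_carrier[OF gl_inv_GL[OF g]] by simp
  also have "\<dots> = gl_inv g * g * h"
    using assoc_mult_mat[OF GL_carrier[OF gl_inv_GL[OF g]] assms(1,2)] by simp
  also have "\<dots> = h" using assms gl_inv_left[OF g] by simp
  finally show "gl_inv g = h" .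
qed

lemma gl_inv_mult:
  assumes g: "g \<in> carrier (GL n)" and h: "h \<in> carrier (GL n)"
  shows "gl_inv (g * h) = gl_inv h * gl_inv g"
proof (rule GL_of_inverse(2))
  note [simp] = GL_carrier[OF g] GL_carrier[OF h] GL_carrier[OF gl_inv_GL[OF g]] GL_carrier[OF gl_inv_GL[OF h]]
  have "g * h * (gl_inv h * gl_inv g) = g * (h * gl_inv h) * gl_inv g"
    by (simp add: assoc_mult_mat[of _ n n _ n _ n] mult_carrier_mat[of _ n n _ n])
  then show "g * h * (gl_inv h * gl_inv g) = 1\<^sub>m n"
    by (simp add: gl_inv_right[OF g] gl_inv_right[OF h] right_mult_one_mat[OF GL_carrier[OF g]])
qed (use assms gl_inv_GL[OF g] gl_inv_GL[OF h] in \<open>auto simp: GL_iff\<close>)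

lemma gl_inv_one [simp]: "gl_inv (1\<^sub>m n) = 1\<^sub>m n"
  by (rule GL_of_inverse(2)) auto

lemma gl_inv_gl_inv: "g \<in> carrier (GL n) \<Longrightarrow> gl_inv (gl_inv g) = g"
  by (rule GL_of_inverse(2)) (auto simp: gl_inv_left dest: GL_carrier gl_inv_GL)

lemma mat_mult_entry:
  assumes "A \<in> carrier_mat m k" "B \<in> carrier_mat k l" "i < m" "j < l"
  shows "(A * B) $$ (i, j) = (\<Sum>t<k. A $$ (i, t) * B $$ (t, j))"
  using assms by (auto simp: scalar_prod_def lessThan_atLeast0 intro!: sum.cong)

section \<open>Regular functions\<close>

text \<open>Only values on the group matter, whereas \<open>regular_functions\<close> consists of functions on all matrices.\<close>

definition regular_on_GL :: "nat \<Rightarrow> (complex mat \<Rightarrow> complex) \<Rightarrow> bool" where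
  "regular_on_GL n h \<longleftrightarrow> (\<exists>f\<in>regular_functions n. \<forall>g\<in>carrier (GL n). h g = f g)"

named_theorems regular_intros

lemma regular_const [regular_intros]: "regular_on_GL n (\<lambda>_. c)"
  unfolding regular_on_GL_def by (intro bexI[OF _ regular_functions.const[of c]]) simp

lemma regular_entry [regular_intros]: "i < n \<Longrightarrow> j < n \<Longrightarrow> regular_on_GL n (\<lambda>g. g $$ (i, j))"
  unfolding regular_on_GL_def by (metis (mono_tags, lifting) regular_functions.entry)

lemma regular_inverse_det [regular_intros]: "regular_on_GL n (\<lambda>g. inverse (det g))"
  unfolding regular_on_GL_def by (intro bexI[OF _ regular_functions.inverse_det]) simp

lemma regular_add [regular_intros]:
  "regular_on_GL n f \<Longrightarrow> regular_on_GL n h \<Longrightarrow> regular_on_GL n (\<lambda>g. f g + h g)"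
  unfolding regular_on_GL_def using regular_functions.add by (metis (no_types, lifting))

lemma regular_mult [regular_intros]:
  "regular_on_GL n f \<Longrightarrow> regular_on_GL n h \<Longrightarrow> regular_on_GL n (\<lambda>g. f g * h g)"
  unfolding regular_on_GL_def using regular_functions.mult by (metis (no_types, lifting))

lemma regular_cong:
  "regular_on_GL n h \<Longrightarrow> (\<And>g. g \<in> carrier (GL n) \<Longrightarrow> f g = h g) \<Longrightarrow> regular_on_GL n f"
  unfolding regular_on_GL_def by simp

lemma regular_sum [regular_intros]:
  "(\<And>i. i \<in> I \<Longrightarrow> regular_on_GL n (f i)) \<Longrightarrow> regular_on_GL n (\<lambda>g. \<Sum>i\<in>I. f i g)"
  by (induction I rule: infinite_finite_induct) (auto intro: regular_intros)

lemma regular_prod [regular_intros]: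
  "(\<And>i. i \<in> I \<Longrightarrow> regular_on_GL n (f i)) \<Longrightarrow> regular_on_GL n (\<lambda>g. \<Prod>i\<in>I. f i g)"
  by (induction I rule: infinite_finite_induct) (auto intro: regular_intros)

lemma regular_power [regular_intros]:
  "regular_on_GL n f \<Longrightarrow> regular_on_GL n (\<lambda>g. f g ^ k)"
  by (induction k) (auto intro: regular_intros)

lemma regular_det:
  assumes "\<And>i j. i < m \<Longrightarrow> j < m \<Longrightarrow> regular_on_GL n (\<lambda>g. M g $$ (i, j))"
    and M: "\<And>g. g \<in> carrier (GL n) \<Longrightarrow> M g \<in> carrier_mat m m"
  shows "regular_on_GL n (\<lambda>g. det (M g))"
proof -
  have "regular_on_GL n (\<lambda>g. \<Sum>p\<in>{p. p permutes {0..<m}}. signof p * (\<Prod>i = 0..<m. M g $$ (i, p i)))"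
    by (intro regular_intros assms(1)) (auto simp: permutes_in_image)
  then show ?thesis
    by (rule regular_cong) (auto simp: det_def'[OF M])
qed

lemma regular_gl_inv [regular_intros]:
  assumes "i < n" "j < n"
  shows "regular_on_GL n (\<lambda>g. gl_inv g $$ (i, j))"
proof -
  have "regular_on_GL n (\<lambda>g. det (mat_delete g j i))"
  proof (rule regular_det[where m = "n - 1"])
    fix i' j' assume ij: "i' < n - 1" "j' < n - 1"
    have "regular_on_GL n (\<lambda>g. g $$ (if i' < j then i' else Suc i', if j' < i then j' else Suc j'))"
      using ij by (intro regular_intros) auto
    then show "regular_on_GL n (\<lambda>g. mat_delete g j i $$ (i', j'))"
      by (rule regular_cong) (use ij in \<open>auto simp: mat_delete_def GL_iff\<close>)
  qed (auto simp: GL_iff mat_delete_carrier)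
  then have "regular_on_GL n (\<lambda>g. inverse (det g) * ((-1)^(j+i) * det (mat_delete g j i)))"
    by (intro regular_intros)
  then show ?thesis
    by (rule regular_cong)
      (use assms in \<open>auto simp: gl_inv_def adj_mat_def cofactor_def GL_iff\<close>)
qed

lemma regular_translate:
  assumes "regular_on_GL n f" and x: "x \<in> carrier (GL n)" and y: "y \<in> carrier (GL n)"
  shows "regular_on_GL n (\<lambda>g. f (x * g * y))"
proof -
  obtain f' where f': "f' \<in> regular_functions n" "\<And>g. g \<in> carrier (GL n) \<Longrightarrow> f g = f' g"
    using assms(1) by (auto simp: regular_on_GL_def)
  have xy: "x \<in> carrier_mat n n" "y \<in> carrier_mat n n" using x y by (auto simp: GL_iff)
  have "regular_on_GL n (\<lambda>g. f' (x * g * y))"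
    using f'(1)
  proof induction
    case (entry i j)
    have "regular_on_GL n (\<lambda>g. \<Sum>k<n. (\<Sum>l<n. x $$ (i, l) * g $$ (l, k)) * y $$ (k, j))"
      using entry by (intro regular_intros) auto
    then show ?case
      by (rule regular_cong) (use entry xy in
        \<open>auto simp: mat_mult_entry[of _ n n _ n] GL_iff simp del: index_mult_mat\<close>)
  next
    case inverse_det
    have "regular_on_GL n (\<lambda>g. inverse (det x) * inverse (det g) * inverse (det y))"
      by (intro regular_intros)
    then show ?case
      by (rule regular_cong) (use xy in \<open>auto simp: det_mult[of _ n] GL_iff\<close>)
  qed (auto intro: regular_intros)
  then show ?thesis
    by (rule regular_cong) (use f'(2) x y in blast)+
qed

lemma regular_tendsto:
  assumes "regular_on_GL n f" and g: "g \<in> carrier (GL n)"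
    and G: "\<forall>\<^sub>F x in fl. G x \<in> carrier (GL n)"
    and lim: "\<And>i j. i < n \<Longrightarrow> j < n \<Longrightarrow> ((\<lambda>x. G x $$ (i, j)) \<longlongrightarrow> g $$ (i, j)) fl"
  shows "((\<lambda>x. f (G x)) \<longlongrightarrow> f g) fl"
proof -
  obtain f' where f': "f' \<in> regular_functions n" "\<And>g. g \<in> carrier (GL n) \<Longrightarrow> f g = f' g"
    using assms(1) by (auto simp: regular_on_GL_def)
  have "((\<lambda>x. f' (G x)) \<longlongrightarrow> f' g) fl"
    using f'(1)
  proof induction
    case inverse_det
    have "((\<lambda>x. \<Sum>p\<in>{p. p permutes {0..<n}}. signof p * (\<Prod>i = 0..<n. G x $$ (i, p i))) \<longlongrightarrow>
       (\<Sum>p\<in>{p. p permutes {0..<n}}. signof p * (\<Prod>i = 0..<n. g $$ (i, p i)))) fl"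
      by (intro tendsto_sum tendsto_mult tendsto_const tendsto_prod lim) (auto simp: permutes_in_image)
    moreover have "\<forall>\<^sub>F x in fl. (\<Sum>p\<in>{p. p permutes {0..<n}}. signof p * (\<Prod>i = 0..<n. G x $$ (i, p i)))
        = det (G x)"
      using G by eventually_elim (auto simp: GL_iff det_def')
    ultimately have "((\<lambda>x. det (G x)) \<longlongrightarrow> det g) fl"
      using g by (auto simp: GL_iff det_def' intro: Lim_transform_eventually)
    then show ?case using g by (auto simp: GL_iff intro: tendsto_inverse)
  qed (auto intro: lim tendsto_add tendsto_mult)
  moreover have "\<forall>\<^sub>F x in fl. f' (G x) = f (G x)"
    using G by eventually_elim (simp add: f'(2))
  ultimately show ?thesis using f'(2)[OF g] by (auto intro: Lim_transform_eventually)
qed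

section \<open>Density of the big cell\<close>

definition lower_unitriangular :: "nat \<Rightarrow> complex mat \<Rightarrow> bool" where
  "lower_unitriangular n l \<longleftrightarrow> l \<in> carrier (GL n) \<and> (\<forall>i<n. l $$ (i, i) = 1) \<and>
     (\<forall>i<n. \<forall>j<n. i < j \<longrightarrow> l $$ (i, j) = 0)"

definition upper_unitriangular :: "nat \<Rightarrow> complex mat \<Rightarrow> bool" where
  "upper_unitriangular n u \<longleftrightarrow> u \<in> carrier (GL n) \<and> upper_triangular u \<and> (\<forall>i<n. u $$ (i, i) = 1)"

definition torus :: "nat \<Rightarrow> complex mat \<Rightarrow> bool" where
  "torus n t \<longleftrightarrow> t \<in> carrier (GL n) \<and> diagonal_mat t"

definition leading_submatrix :: "nat \<Rightarrow> 'a mat \<Rightarrow> 'a mat" where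
  "leading_submatrix k A = mat k k (\<lambda>(i, j). A $$ (i, j))"

lemma det_eval_poly:
  fixes M :: "complex poly mat"
  shows "det (map_mat (\<lambda>p. poly p z) M) = poly (det M) z"
proof -
  interpret comm_ring_hom "\<lambda>p. poly p z" by unfold_locales auto
  show ?thesis by (rule hom_det)
qed

lemma eventually_poly_nonzero:
  fixes p :: "complex poly"
  assumes "p \<noteq> 0"
  shows "\<forall>\<^sub>F z in at a. poly p z \<noteq> 0"
proof -
  have "finite {z. poly p z = 0}" using assms by (rule poly_roots_finite)
  then have "finite ({z. poly p z = 0} - {a})" by simp
  then have "closed ({z. poly p z = 0} - {a})" by (rule finite_imp_closed)
  then have "open (- ({z. poly p z = 0} - {a}))" by (rule open_Compl)
  moreover have "a \<in> - ({z. poly p z = 0} - {a})" by simp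
  ultimately have "\<forall>\<^sub>F z in at a. z \<in> - ({z. poly p z = 0} - {a})"
    by (rule eventually_at_in_open')
  moreover have "\<forall>\<^sub>F z in at a. z \<noteq> a" by (simp add: eventually_at_filter)
  ultimately show ?thesis by eventually_elim auto
qed

text \<open>Bordering: the factorization of the leading block extends by solving two triangular systems for
the new column and row; the new pivot is then determined, and it is nonzero because the determinant
is.\<close>

lemma LDU_decomposition:
  fixes A :: "complex mat"
  assumes "A \<in> carrier_mat n n" "\<And>k. k \<le> n \<Longrightarrow> det (leading_submatrix k A) \<noteq> 0"
  shows "\<exists>l t u. lower_unitriangular n l \<and> torus n t \<and> upper_unitriangular n u \<and> A = l * t * u"
  using assms
proof (induction n arbitrary: A)
  case 0
  have "lower_unitriangular 0 (1\<^sub>m 0)" "torus 0 (1\<^sub>m 0)" "upper_unitriangular 0 (1\<^sub>m 0)"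
    by (auto simp: lower_unitriangular_def torus_def diagonal_mat_def upper_unitriangular_def)
  moreover have "A = 1\<^sub>m 0 * 1\<^sub>m 0 * 1\<^sub>m 0" using 0 by (intro eq_matI) auto
  ultimately show ?case by blast
next
  case (Suc n)
  define A1 where "A1 = leading_submatrix n A"
  define b where "b = mat n 1 (\<lambda>(i, j). A $$ (i, n))"
  define c where "c = mat 1 n (\<lambda>(i, j). A $$ (n, j))"
  define e where "e = mat 1 1 (\<lambda>(i, j). A $$ (n, n))"
  have A1: "A1 \<in> carrier_mat n n" by (simp add: A1_def leading_submatrix_def)
  have bce: "b \<in> carrier_mat n 1" "c \<in> carrier_mat 1 n" "e \<in> carrier_mat 1 1"
    by (auto simp: b_def c_def e_def)
  have A_block: "A = four_block_mat A1 b c e"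
    using Suc.prems(1)
    by (intro eq_matI) (auto simp: A1_def leading_submatrix_def b_def c_def e_def less_Suc_eq_le)
  have "leading_submatrix k A1 = leading_submatrix k A" if "k \<le> n" for k
    using that by (auto simp: A1_def leading_submatrix_def)
  then have "det (leading_submatrix k A1) \<noteq> 0" if "k \<le> n" for k
    using Suc.prems(2)[of k] that by simp
  from Suc.IH[OF A1 this] obtain l t u where
    ltu: "lower_unitriangular n l" "torus n t" "upper_unitriangular n u" "A1 = l * t * u"
    by blast
  have G: "l \<in> carrier (GL n)" "t \<in> carrier (GL n)" "u \<in> carrier (GL n)"
    using ltu by (auto simp: lower_unitriangular_def torus_def upper_unitriangular_def)
  note C = GL_carrier[OF G(1)] GL_carrier[OF G(2)] GL_carrier[OF G(3)]
  have lt: "l * t \<in> carrier (GL n)" and tu: "t * u \<in> carrier (GL n)" using G by auto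
  define x where "x = gl_inv (l * t) * b"
  define y where "y = c * gl_inv (t * u)"
  note Ci = GL_carrier[OF lt] GL_carrier[OF tu] GL_carrier[OF gl_inv_GL[OF lt]] GL_carrier[OF gl_inv_GL[OF tu]]
  have x: "x \<in> carrier_mat n 1" and y: "y \<in> carrier_mat 1 n"
    unfolding x_def y_def using Ci bce by auto
  have lx: "l * t * x = b"
    unfolding x_def using assoc_mult_mat[OF Ci(1) Ci(3) bce(1)] gl_inv_right[OF lt] bce by simp
  have yu: "y * (t * u) = c"
    unfolding y_def using assoc_mult_mat[OF bce(2) Ci(4) Ci(2)] gl_inv_left[OF tu] bce by simp
  define s where "s = e - y * t * x"
  have yt: "y * t \<in> carrier_mat 1 n" using y C by auto
  have s: "s \<in> carrier_mat 1 1" unfolding s_def by (intro minus_carrier_mat mult_carrier_mat[OF yt x])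
  define L where "L = four_block_mat l (0\<^sub>m n 1) y (1\<^sub>m 1)"
  define T where "T = four_block_mat t (0\<^sub>m n 1) (0\<^sub>m 1 n) s"
  define U where "U = four_block_mat u x (0\<^sub>m 1 n) (1\<^sub>m 1)"
  have car: "L \<in> carrier_mat (Suc n) (Suc n)" "T \<in> carrier_mat (Suc n) (Suc n)"
    "U \<in> carrier_mat (Suc n) (Suc n)"
    unfolding L_def T_def U_def
    using four_block_carrier_mat[OF C(1), of "1\<^sub>m 1" 1 1] four_block_carrier_mat[OF C(2) s]
      four_block_carrier_mat[OF C(3), of "1\<^sub>m 1" 1 1] by simp_all
  have "L * T = four_block_mat (l * t) (0\<^sub>m n 1) (y * t) s"
    unfolding L_def T_def
    by (subst mult_four_block_mat[of _ n n _ 1 _ 1 _ _ n _ 1])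
      (use C s y yt lt in \<open>auto simp: GL_iff\<close>)
  then have "L * T * U = four_block_mat (l * t * u) (l * t * x) (y * t * u) (y * t * x + s)"
    unfolding U_def
    by (simp, subst mult_four_block_mat[of _ n n _ 1 _ 1 _ _ n _ 1])
      (use C s y yt lt x in \<open>auto simp: GL_iff\<close>)
  also have "y * t * x + s = e"
    unfolding s_def using yt x bce by (intro eq_matI) auto
  also have "y * t * u = c" using yu C y by (simp add: assoc_mult_mat[of _ 1 n _ n _ n])
  finally have A_LTU: "A = L * T * U" using A_block ltu(4) lx by simp
  have "leading_submatrix (Suc n) A = A"
    using Suc.prems(1) by (auto simp: leading_submatrix_def)
  with Suc.prems(2)[of "Suc n"] have "det A \<noteq> 0" by simp
  moreover have "det A = det L * det T * det U"
    unfolding A_LTU using car by (simp add: det_mult[of _ "Suc n"])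
  ultimately have det: "det L \<noteq> 0" "det T \<noteq> 0" "det U \<noteq> 0" by auto
  have "lower_unitriangular (Suc n) L"
    unfolding lower_unitriangular_def GL_iff
  proof (intro conjI allI impI det car)
    show "L $$ (i, i) = 1" if "i < Suc n" for i
      using that ltu(1) C by (auto simp: L_def lower_unitriangular_def)
    show "L $$ (i, j) = 0" if "i < Suc n" "j < Suc n" "i < j" for i j
      using that ltu(1) C by (auto simp: L_def lower_unitriangular_def less_Suc_eq)
  qed
  moreover have "torus (Suc n) T"
    using ltu(2) det(2) car C s
    by (auto simp: torus_def GL_iff T_def diagonal_mat_def)
  moreover have "upper_unitriangular (Suc n) U"
    using ltu(3) det(3) car C
    by (auto simp: upper_unitriangular_def GL_iff U_def upper_triangular_def)
  ultimately show ?case using A_LTU by blast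
qed

text \<open>On the line from the identity to \<open>g\<close> every leading minor is a polynomial in the parameter that is \<open>1\<close> at
the identity, so all other points near \<open>g\<close> on this line lie in the big cell; continuity carries the equality to \<open>g\<close>.\<close>

lemma regular_eq_if_eq_on_big_cell:
  assumes reg: "regular_on_GL n f" "regular_on_GL n h"
    and eq: "\<And>l t u. lower_unitriangular n l \<Longrightarrow> torus n t \<Longrightarrow> upper_unitriangular n u \<Longrightarrow>
      f (l * t * u) = h (l * t * u)"
    and g: "g \<in> carrier (GL n)"
  shows "f g = h g"
proof -
  define P where "P = mat n n (\<lambda>(i, j). if i = j then [:1, g $$ (i, j) - 1:] else [:0, g $$ (i, j):])"
  define G where "G = (\<lambda>z. map_mat (\<lambda>p. poly p z) P)"
  have G_car: "G z \<in> carrier_mat n n" for z by (simp add: G_def P_def)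
  have G_entry: "G z $$ (i, j) = (1 - z) * (if i = j then 1 else 0) + z * g $$ (i, j)"
    if "i < n" "j < n" for z i j
    using that by (simp add: G_def P_def algebra_simps)
  have lead: "leading_submatrix k (G z) = map_mat (\<lambda>p. poly p z) (leading_submatrix k P)"
    if "k \<le> n" for k z
    using that by (intro eq_matI) (auto simp: leading_submatrix_def G_def P_def)
  have "\<forall>\<^sub>F z in at 1. det (leading_submatrix k (G z)) \<noteq> 0" if "k \<le> n" for k
  proof -
    have "leading_submatrix k (G 0) = 1\<^sub>m k"
      using that by (intro eq_matI) (auto simp: leading_submatrix_def G_entry)
    then have "poly (det (leading_submatrix k P)) 0 = 1"
      using lead[OF that, of 0] by (simp flip: det_eval_poly)
    then have "det (leading_submatrix k P) \<noteq> 0" by auto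
    then show ?thesis using eventually_poly_nonzero by (simp add: lead[OF that] det_eval_poly)
  qed
  then have ev: "\<forall>\<^sub>F z in at 1. \<forall>k\<in>{..n}. det (leading_submatrix k (G z)) \<noteq> 0"
    by (intro eventually_ball_finite) auto
  have lim: "((\<lambda>z. G z $$ (i, j)) \<longlongrightarrow> g $$ (i, j)) (at 1)" if "i < n" "j < n" for i j
    unfolding G_entry[OF that] by (rule tendsto_eq_intros refl)+ simp
  have GL: "\<forall>\<^sub>F z in at 1. G z \<in> carrier (GL n)"
    using ev
  proof eventually_elim
    case (elim z)
    have "leading_submatrix n (G z) = G z" using G_car[of z] by (auto simp: leading_submatrix_def)
    then show ?case using bspec[OF elim, of n] G_car by (simp add: GL_iff)
  qed
  have "\<forall>\<^sub>F z in at 1. f (G z) = h (G z)"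
    using ev by eventually_elim (use LDU_decomposition[OF G_car] eq in \<open>metis atMost_iff\<close>)
  moreover have "((\<lambda>z. f (G z)) \<longlongrightarrow> f g) (at 1)"
    by (rule regular_tendsto[OF reg(1) g GL lim])
  ultimately have "((\<lambda>z. h (G z)) \<longlongrightarrow> f g) (at 1)"
    by (rule Lim_transform_eventually[rotated])
  moreover have "((\<lambda>z. h (G z)) \<longlongrightarrow> h g) (at 1)"
    by (rule regular_tendsto[OF reg(2) g GL lim])
  ultimately show ?thesis by (intro tendsto_unique) auto
qed

section \<open>The highest weight function\<close>

lemma mult_unit_row:
  fixes A :: "complex mat"
  assumes "A \<in> carrier_mat n n" "B \<in> carrier_mat n m" "i < n" "j < m"
    and "\<And>k. k < n \<Longrightarrow> A $$ (i, k) = (if k = i then 1 else 0)"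
  shows "(A * B) $$ (i, j) = B $$ (i, j)"
proof -
  have "(A * B) $$ (i, j) = (\<Sum>k<n. if k = i then B $$ (k, j) else 0)"
    unfolding mat_mult_entry[OF assms(1-4)] by (intro sum.cong) (auto simp: assms(5))
  then show ?thesis using assms(3) by simp
qed

lemma mult_unit_col:
  fixes B :: "complex mat"
  assumes "A \<in> carrier_mat m n" "B \<in> carrier_mat n n" "i < m" "j < n"
    and "\<And>k. k < n \<Longrightarrow> B $$ (k, j) = (if k = j then 1 else 0)"
  shows "(A * B) $$ (i, j) = A $$ (i, j)"
proof -
  have "(A * B) $$ (i, j) = (\<Sum>k<n. if k = j then A $$ (i, k) else 0)"
    unfolding mat_mult_entry[OF assms(1-4)] by (intro sum.cong) (auto simp: assms(5))
  then show ?thesis using assms(4) by simp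
qed

lemma gl_inv_unit_row:
  assumes g: "g \<in> carrier (GL n)" and i: "i < n" "j < n"
    and "\<And>k. k < n \<Longrightarrow> g $$ (i, k) = (if k = i then 1 else 0)"
  shows "gl_inv g $$ (i, j) = (if j = i then 1 else 0)"
  using mult_unit_row[OF GL_carrier[OF g] GL_carrier[OF gl_inv_GL[OF g]] i assms(4)] i
  by (auto simp: gl_inv_right[OF g] split: if_splits)

lemma gl_inv_unit_col:
  assumes g: "g \<in> carrier (GL n)" and i: "i < n" "j < n"
    and "\<And>k. k < n \<Longrightarrow> g $$ (k, j) = (if k = j then 1 else 0)"
  shows "gl_inv g $$ (i, j) = (if i = j then 1 else 0)"
  using mult_unit_col[OF GL_carrier[OF gl_inv_GL[OF g]] GL_carrier[OF g] i assms(4)] i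
  by (simp add: gl_inv_left[OF g])

text \<open>The matrix coefficient of weight \<open>(a, 0, \<dots>, 0, -b)\<close>, that is \<open>p\<^sub>0\<^sup>a * q\<^sub>n\<^sub>-\<^sub>1\<^sup>b\<close>.\<close>

definition highest_weight_function :: "nat \<Rightarrow> nat \<Rightarrow> nat \<Rightarrow> complex mat \<Rightarrow> complex" where
  "highest_weight_function n a b g = (g $$ (0, 0)) ^ a * (gl_inv g $$ (n - 1, n - 1)) ^ b"

lemma regular_highest_weight_function [regular_intros]:
  "n \<ge> 1 \<Longrightarrow> regular_on_GL n (highest_weight_function n a b)"
  unfolding highest_weight_function_def by (intro regular_intros) auto

lemma highest_weight_function_one: "n \<ge> 1 \<Longrightarrow> highest_weight_function n a b (1\<^sub>m n) = 1"
  by (simp add: highest_weight_function_def)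

lemma highest_weight_function_lower:
  assumes "n \<ge> 1" and l: "lower_unitriangular n l"
  shows "highest_weight_function n a b l = 1"
proof -
  have "gl_inv l $$ (n - 1, n - 1) = (if n - 1 = n - 1 then 1 else 0)"
    using l assms(1) by (intro gl_inv_unit_col[of _ n]) (auto simp: lower_unitriangular_def)
  then show ?thesis using assms by (simp add: highest_weight_function_def lower_unitriangular_def)
qed

lemma highest_weight_function_upper:
  assumes n: "n \<ge> 1" and h: "h \<in> carrier (GL n)" and u: "upper_unitriangular n u"
  shows "highest_weight_function n a b (h * u) = highest_weight_function n a b h"
proof -
  have uG: "u \<in> carrier (GL n)" and uc: "u \<in> carrier_mat n n"
    using u by (auto simp: upper_unitriangular_def GL_iff)
  have "(h * u) $$ (0, 0) = h $$ (0, 0)"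
    using u uc h n
    by (intro mult_unit_col[of _ n n]) (auto simp: upper_unitriangular_def GL_iff upper_triangular_def)
  moreover have row: "u $$ (n - 1, k) = (if k = n - 1 then 1 else 0)" if "k < n" for k
    using u uc that by (auto simp: upper_unitriangular_def upper_triangular_def)
  have "gl_inv u $$ (n - 1, k) = (if k = n - 1 then 1 else 0)" if "k < n" for k
    using n that by (intro gl_inv_unit_row[OF uG _ _ row]) auto
  then have "(gl_inv u * gl_inv h) $$ (n - 1, n - 1) = gl_inv h $$ (n - 1, n - 1)"
    using n GL_carrier[OF gl_inv_GL[OF h]] GL_carrier[OF gl_inv_GL[OF uG]]
    by (intro mult_unit_row[of _ n _ n]) auto
  ultimately show ?thesis
    by (simp add: highest_weight_function_def gl_inv_mult[OF h uG])
qed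

lemma diagonal_torus:
  assumes "\<And>k. k < n \<Longrightarrow> d k \<noteq> (0 :: complex)"
  shows "torus n (mat n n (\<lambda>(k, l). if k = l then d k else 0))"
proof -
  let ?D = "mat n n (\<lambda>(k, l). if k = l then d k else 0)"
  have "det ?D = prod_list (diag_mat ?D)"
    by (rule det_upper_triangular[of _ n]) auto
  moreover have "0 \<notin> set (diag_mat ?D)" using assms by (auto simp: diag_mat_def)
  ultimately have "det ?D \<noteq> 0" by (simp add: prod_list_zero_iff)
  then show ?thesis by (auto simp: torus_def GL_iff diagonal_mat_def)
qed

lemma torus_entry:
  assumes "torus n t" "i < n" "j < n" "i \<noteq> j"
  shows "t $$ (i, j) = 0"
  using assms by (auto simp: torus_def diagonal_mat_def GL_iff)

lemma torus_carrier: "torus n t \<Longrightarrow> t \<in> carrier_mat n n"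
  by (simp add: torus_def GL_iff)

lemma mult_torus:
  assumes "A \<in> carrier_mat m n" "torus n t" "i < m" "j < n"
  shows "(A * t) $$ (i, j) = A $$ (i, j) * t $$ (j, j)"
proof -
  have "(A * t) $$ (i, j) = (\<Sum>k<n. if k = j then A $$ (i, k) * t $$ (k, k) else 0)"
    unfolding mat_mult_entry[OF assms(1) torus_carrier[OF assms(2)] assms(3,4)]
    using torus_entry[OF assms(2)] assms(4) by (intro sum.cong) auto
  then show ?thesis using assms by simp
qed

lemma torus_mult:
  assumes "A \<in> carrier_mat n m" "torus n t" "i < n" "j < m"
  shows "(t * A) $$ (i, j) = t $$ (i, i) * A $$ (i, j)"
proof -
  have "(t * A) $$ (i, j) = (\<Sum>k<n. if k = i then t $$ (k, k) * A $$ (k, j) else 0)"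
    unfolding mat_mult_entry[OF torus_carrier[OF assms(2)] assms(1) assms(3,4)]
    using torus_entry[OF assms(2)] assms(3) by (intro sum.cong) auto
  then show ?thesis using assms by simp
qed

lemma torus_diag_nonzero:
  assumes t: "torus n t" and i: "i < n"
  shows "t $$ (i, i) \<noteq> 0" "gl_inv t $$ (i, i) = inverse (t $$ (i, i))"
proof -
  have G: "t \<in> carrier (GL n)" using t by (simp add: torus_def)
  have "gl_inv t $$ (i, i) * t $$ (i, i) = 1"
    using mult_torus[OF GL_carrier[OF gl_inv_GL[OF G]] t i i] i by (simp add: gl_inv_left[OF G])
  then show "t $$ (i, i) \<noteq> 0" "gl_inv t $$ (i, i) = inverse (t $$ (i, i))"
    by (auto simp: mult.commute dest: inverse_unique[symmetric])
qed

lemma torus_gl_inv: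
  assumes t: "torus n t"
  shows "torus n (gl_inv t)"
proof -
  have G: "t \<in> carrier (GL n)" using t by (simp add: torus_def)
  have "gl_inv t $$ (i, j) = 0" if ij: "i < n" "j < n" "i \<noteq> j" for i j
    using mult_torus[OF GL_carrier[OF gl_inv_GL[OF G]] t ij(1,2)] ij torus_diag_nonzero(1)[OF t ij(2)]
    by (simp add: gl_inv_left[OF G])
  then show ?thesis
    using gl_inv_GL[OF G] by (auto simp: torus_def diagonal_mat_def GL_iff)
qed

text \<open>The character of the diagonal torus with weight \<open>(a, 0, \<dots>, 0, -b)\<close>.\<close>

definition torus_weight :: "nat \<Rightarrow> nat \<Rightarrow> nat \<Rightarrow> complex mat \<Rightarrow> complex" where
  "torus_weight n a b t = (t $$ (0, 0)) ^ a * inverse (t $$ (n - 1, n - 1)) ^ b"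

lemma torus_weight_nonzero: "n \<ge> 1 \<Longrightarrow> torus n t \<Longrightarrow> torus_weight n a b t \<noteq> 0"
  using torus_diag_nonzero(1)[of n t 0] torus_diag_nonzero(1)[of n t "n - 1"]
  by (simp add: torus_weight_def)

lemma highest_weight_function_torus:
  assumes n: "n \<ge> 1" and h: "h \<in> carrier (GL n)" and t: "torus n t"
  shows "highest_weight_function n a b (h * t) = torus_weight n a b t * highest_weight_function n a b h"
proof -
  have tG: "t \<in> carrier (GL n)" using t by (simp add: torus_def)
  have "(h * t) $$ (0, 0) = h $$ (0, 0) * t $$ (0, 0)"
    using n by (intro mult_torus[OF GL_carrier[OF h] t]) auto
  moreover have "(gl_inv t * gl_inv h) $$ (n - 1, n - 1) = inverse (t $$ (n - 1, n - 1)) * gl_inv h $$ (n - 1, n - 1)"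
    using n torus_mult[OF GL_carrier[OF gl_inv_GL[OF h]] torus_gl_inv[OF t], of "n - 1" "n - 1"]
    by (simp add: torus_diag_nonzero(2)[OF t])
  ultimately show ?thesis
    by (simp add: highest_weight_function_def torus_weight_def gl_inv_mult[OF h tG] power_mult_distrib)
qed

definition hook_weight :: "nat \<Rightarrow> nat \<Rightarrow> nat \<Rightarrow> int list" where
  "hook_weight n a b = int a # replicate (n - 2) 0 @ [- int b]"

lemma prod_hook_weight:
  assumes "n \<ge> 2"
  shows "(\<Prod>i<n. t $$ (i, i) powi (hook_weight n a b ! i)) = torus_weight n a b t"
proof -
  have nth: "hook_weight n a b ! i = (if i = 0 then int a else if i = n - 1 then - int b else 0)"
    if "i < n" for i
    using that assms by (auto simp: hook_weight_def nth_Cons' nth_append)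
  have "(\<Prod>i<n. t $$ (i, i) powi (hook_weight n a b ! i)) =
      (\<Prod>i\<in>{0, n - 1}. t $$ (i, i) powi (hook_weight n a b ! i))"
    using assms by (intro prod.mono_neutral_right) (auto simp: nth)
  also have "\<dots> = t $$ (0, 0) powi int a * t $$ (n - 1, n - 1) powi (- int b)"
    using assms by (simp add: nth)
  also have "\<dots> = torus_weight n a b t"
    by (simp add: torus_weight_def power_int_minus power_inverse)
  finally show ?thesis .
qed

text \<open>As \<open>e\<close> tends to \<open>0\<close>, conjugation by this element of the torus contracts lower unitriangular matrices
to the identity.\<close>

definition one_param :: "nat \<Rightarrow> complex \<Rightarrow> complex mat" where
  "one_param n e = mat n n (\<lambda>(i, j). if i = j then e ^ i else 0)"

lemma torus_one_param: "e \<noteq> 0 \<Longrightarrow> torus n (one_param n e)"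
  unfolding one_param_def by (intro diagonal_torus) simp

section \<open>The matrix coefficient of a highest weight vector\<close>

text \<open>The identity acts as an invertible idempotent, hence trivially.\<close>

lemma rational_repD:
  assumes "rational_rep n R"
  shows rep_GL: "g \<in> carrier (GL n) \<Longrightarrow> act R g \<in> carrier (GL (deg R))"
    and rep_mult: "g \<in> carrier (GL n) \<Longrightarrow> h \<in> carrier (GL n) \<Longrightarrow> act R (g * h) = act R g * act R h"
    and rep_one: "act R (1\<^sub>m n) = 1\<^sub>m (deg R)"
    and rep_regular: "i < deg R \<Longrightarrow> j < deg R \<Longrightarrow> regular_on_GL n (\<lambda>g. act R g $$ (i, j))"
proof -
  have hom: "act R \<in> hom (GL n) (GL (deg R))" using assms by (simp add: rational_rep_def)
  show G: "act R g \<in> carrier (GL (deg R))" if "g \<in> carrier (GL n)" for g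
    using hom that by (auto simp: hom_def)
  show m: "act R (g * h) = act R g * act R h" if "g \<in> carrier (GL n)" "h \<in> carrier (GL n)" for g h
    using hom that by (auto simp: hom_def)
  let ?A = "act R (1\<^sub>m n)"
  have A: "?A \<in> carrier (GL (deg R))" using G by auto
  have "?A * ?A = ?A" using m[of "1\<^sub>m n" "1\<^sub>m n"] by simp
  then have "gl_inv ?A * (?A * ?A) = 1\<^sub>m (deg R)" by (simp add: gl_inv_left[OF A])
  then show "?A = 1\<^sub>m (deg R)"
    using assoc_mult_mat[OF GL_carrier[OF gl_inv_GL[OF A]] GL_carrier[OF A] GL_carrier[OF A]]
      gl_inv_left[OF A] left_mult_one_mat[OF GL_carrier[OF A]] by simp
  show "regular_on_GL n (\<lambda>g. act R g $$ (i, j))" if "i < deg R" "j < deg R"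
    using assms that unfolding rational_rep_def regular_on_GL_def by blast
qed

lemma scalar_prod_mult_vec:
  fixes A :: "complex mat"
  assumes "f \<in> carrier_vec d" "A \<in> carrier_mat d d" "x \<in> carrier_vec d"
  shows "f \<bullet> (A *\<^sub>v x) = (\<Sum>i<d. \<Sum>j<d. f $ i * A $$ (i, j) * x $ j)"
  using assms by (auto simp: scalar_prod_def lessThan_atLeast0 sum_distrib_left mult.assoc intro!: sum.cong)

lemma regular_coefficient:
  assumes "rational_rep n R" "f \<in> carrier_vec (deg R)" "x \<in> carrier_vec (deg R)"
  shows "regular_on_GL n (\<lambda>g. f \<bullet> (act R g *\<^sub>v x))"
proof -
  have "regular_on_GL n (\<lambda>g. \<Sum>i<deg R. \<Sum>j<deg R. f $ i * act R g $$ (i, j) * x $ j)"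
    by (intro regular_intros rep_regular[OF assms(1)]) auto
  then show ?thesis
    by (rule regular_cong)
      (auto simp: scalar_prod_mult_vec[OF assms(2) GL_carrier[OF rep_GL[OF assms(1)]] assms(3)])
qed

lemma mult_zero_vec: "A \<in> carrier_mat m d \<Longrightarrow> A *\<^sub>v 0\<^sub>v d = (0\<^sub>v m :: complex vec)"
  by (intro eq_vecI) auto

lemma highest_weight_vectorD:
  assumes "n \<ge> 2" "highest_weight_vector n R (hook_weight n a b) v"
  shows "v \<in> carrier_vec (deg R)" "v \<noteq> 0\<^sub>v (deg R)"
    and "torus n t \<Longrightarrow> act R t *\<^sub>v v = torus_weight n a b t \<cdot>\<^sub>v v"
    and "upper_unitriangular n u \<Longrightarrow> act R u *\<^sub>v v = v"
  using assms
  by (auto simp: highest_weight_vector_def torus_def upper_unitriangular_def prod_hook_weight)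

text \<open>For lower unitriangular \<open>l\<close> and nonzero \<open>e\<close> this is the conjugate of \<open>l\<close> by \<open>one_param n e\<close>, written without
inverses so that it extends to \<open>e = 0\<close>.\<close>

definition contracted :: "nat \<Rightarrow> complex mat \<Rightarrow> complex \<Rightarrow> complex mat" where
  "contracted n l e = mat n n (\<lambda>(i, j). if j \<le> i then e ^ (i - j) * l $$ (i, j) else 0)"

lemma lower_contraction:
  assumes l: "lower_unitriangular n l"
  shows "e \<noteq> 0 \<Longrightarrow> contracted n l e \<in> carrier (GL n)"
    and "e \<noteq> 0 \<Longrightarrow> contracted n l e * one_param n e = one_param n e * l"
    and "i < n \<Longrightarrow> j < n \<Longrightarrow> ((\<lambda>e. contracted n l e $$ (i, j)) \<longlongrightarrow> 1\<^sub>m n $$ (i, j)) (at 0)"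
proof -
  define k where "k = contracted n l"
  note k_def = k_def contracted_def
  have lG: "l \<in> carrier (GL n)" using l by (simp add: lower_unitriangular_def)
  have kc: "k e \<in> carrier_mat n n" for e by (simp add: k_def)
  have eq: "k e * one_param n e = one_param n e * l" if "e \<noteq> 0" for e
  proof (rule eq_matI)
    fix i j assume "i < dim_row (one_param n e * l)" "j < dim_col (one_param n e * l)"
    then have ij: "i < n" "j < n" using GL_carrier[OF lG] by (auto simp: one_param_def)
    have "e ^ (i - j) * e ^ j = e ^ i" if "j \<le> i" using that by (simp flip: power_add)
    then show "(k e * one_param n e) $$ (i, j) = (one_param n e * l) $$ (i, j)"
      unfolding mult_torus[OF kc torus_one_param[OF that] ij]
        torus_mult[OF GL_carrier[OF lG] torus_one_param[OF that] ij]
      using ij l by (auto simp: k_def one_param_def lower_unitriangular_def)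
  qed (use kc GL_carrier[OF lG] in \<open>auto simp: one_param_def\<close>)
  then show "contracted n l e * one_param n e = one_param n e * l" if "e \<noteq> 0"
    using that by (simp add: k_def)
  show "contracted n l e \<in> carrier (GL n)" if "e \<noteq> 0"
  proof -
    have o: "one_param n e \<in> carrier (GL n)" using torus_one_param[OF that] by (simp add: torus_def)
    have "det (k e) * det (one_param n e) = det (one_param n e) * det l"
      using arg_cong[OF eq[OF that], of det]
      unfolding det_mult[OF kc GL_carrier[OF o]] det_mult[OF GL_carrier[OF o] GL_carrier[OF lG]] .
    then show ?thesis using o lG kc[of e] by (auto simp: GL_iff k_def)
  qed
  show "((\<lambda>e. contracted n l e $$ (i, j)) \<longlongrightarrow> 1\<^sub>m n $$ (i, j)) (at 0)" if ij: "i < n" "j < n"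
  proof -
    have "((\<lambda>e. if j \<le> i then e ^ (i - j) * l $$ (i, j) else 0) \<longlongrightarrow>
       (if j \<le> i then 0 ^ (i - j) * l $$ (i, j) else 0)) (at (0::complex))"
      by (cases "j \<le> i") (auto intro!: tendsto_intros)
    also have "(if j \<le> i then 0 ^ (i - j) * l $$ (i, j) else 0) = 1\<^sub>m n $$ (i, j)"
      using ij l by (auto simp: lower_unitriangular_def power_0_left)
    finally show ?thesis using ij by (simp add: k_def)
  qed
qed

text \<open>Call a vector \<open>x\<close> negligible if \<open>one_param n e\<close> applied to \<open>x\<close>, divided by its eigenvalue on \<open>v\<close>, tends to \<open>0\<close>.
The negligible vectors form a subspace that contains \<open>l v - v\<close> for each lower unitriangular \<open>l\<close>,
by contraction, but not \<open>v\<close>. A functional that separates \<open>v\<close> from this subspace is constant on the orbit of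
\<open>v\<close> under lower unitriangular matrices, and the weight of \<open>v\<close> determines it on the big cell.\<close>

lemma highest_weight_functional:
  assumes n: "n \<ge> 2" and R: "rational_rep n R"
    and hw: "highest_weight_vector n R (hook_weight n a b) v"
  shows "\<exists>f\<in>carrier_vec (deg R). \<forall>g\<in>carrier (GL n).
     f \<bullet> (act R g *\<^sub>v v) = highest_weight_function n a b g"
proof -
  let ?d = "deg R"
  note v = highest_weight_vectorD[OF n hw]
  note RC = GL_carrier[OF rep_GL[OF R]]
  define \<chi> where "\<chi> = (\<lambda>e. torus_weight n a b (one_param n e))"
  have o: "one_param n e \<in> carrier (GL n)" "\<chi> e \<noteq> 0" if "e \<noteq> 0" for e
    using torus_one_param[OF that, of n] torus_weight_nonzero[OF _ torus_one_param[OF that, of n]] n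
    by (auto simp: torus_def \<chi>_def)
  have ev: "\<forall>\<^sub>F e in at (0::complex). e \<noteq> 0" by (simp add: eventually_at_filter)
  define scaled where "scaled = (\<lambda>e x i. (act R (one_param n e) *\<^sub>v x) $ i / \<chi> e)"
  define D where "D = {x \<in> carrier_vec ?d. \<forall>i<?d. ((\<lambda>e. scaled e x i) \<longlongrightarrow> 0) (at 0)}"
  have scaled_add: "scaled e (x + y) i = scaled e x i + scaled e y i"
    and scaled_smult: "scaled e (c \<cdot>\<^sub>v x) i = c * scaled e x i"
    if "e \<noteq> 0" "i < ?d" "x \<in> carrier_vec ?d" "y \<in> carrier_vec ?d" for e x y i c
    using RC[OF o(1)[OF that(1)]] that
    by (simp_all add: scaled_def mult_add_distrib_mat_vec mult_mat_vec add_divide_distrib)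
  have scaled_v: "scaled e v i = v $ i" if "e \<noteq> 0" "i < ?d" for e i
    using v(1) that o(2) by (simp add: scaled_def v(3)[OF torus_one_param] \<chi>_def)
  have D: "subspace class_ring D (module_vec TYPE(complex) ?d)"
  proof (rule subspaceI)
    have "\<forall>\<^sub>F e in at 0. 0 = scaled e (0\<^sub>v ?d) i" if "i < ?d" for i
      using ev by eventually_elim (use that RC[OF o(1)] in \<open>simp add: scaled_def mult_zero_vec[of _ ?d ?d]\<close>)
    then show "0\<^sub>v ?d \<in> D"
      unfolding D_def by (auto intro: Lim_transform_eventually[OF tendsto_const])
    show "x + y \<in> D" if xy: "x \<in> D" "y \<in> D" for x y
    proof -
      have "((\<lambda>e. scaled e (x + y) i) \<longlongrightarrow> 0) (at 0)" if i: "i < ?d" for i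
      proof (rule Lim_transform_eventually)
        show "((\<lambda>e. scaled e x i + scaled e y i) \<longlongrightarrow> 0) (at 0)"
          using xy i by (auto simp: D_def intro: tendsto_add_zero)
        show "\<forall>\<^sub>F e in at 0. scaled e x i + scaled e y i = scaled e (x + y) i"
          using ev by eventually_elim (use xy i scaled_add in \<open>simp add: D_def\<close>)
      qed
      then show ?thesis using xy by (simp add: D_def)
    qed
    show "c \<cdot>\<^sub>v x \<in> D" if x: "x \<in> D" for c x
    proof -
      have "((\<lambda>e. scaled e (c \<cdot>\<^sub>v x) i) \<longlongrightarrow> 0) (at 0)" if i: "i < ?d" for i
      proof (rule Lim_transform_eventually)
        show "((\<lambda>e. c * scaled e x i) \<longlongrightarrow> 0) (at 0)"
          using x i by (auto simp: D_def intro: tendsto_mult_right_zero)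
        show "\<forall>\<^sub>F e in at 0. c * scaled e x i = scaled e (c \<cdot>\<^sub>v x) i"
          using ev by eventually_elim (use x i in \<open>simp add: D_def scaled_smult[of _ i x x]\<close>)
      qed
      then show ?thesis using x by (simp add: D_def)
    qed
  qed (auto simp: D_def)
  \<comment> \<open>the rescaled contraction fixes the highest weight vector\<close>
  have "v \<notin> D"
  proof
    assume "v \<in> D"
    have "v $ i = 0" if i: "i < ?d" for i
    proof (rule tendsto_unique)
      show "((\<lambda>e. scaled e v i) \<longlongrightarrow> 0) (at 0)" using \<open>v \<in> D\<close> i by (simp add: D_def)
      show "((\<lambda>e. scaled e v i) \<longlongrightarrow> v $ i) (at 0)"
        by (rule Lim_transform_eventually[OF tendsto_const])
          (use ev in \<open>eventually_elim, use scaled_v i in simp\<close>)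
    qed simp
    then show False using v(1,2) by (auto intro: eq_vecI)
  qed
  then obtain f0 where f0: "f0 \<in> carrier_vec ?d" "\<forall>w\<in>D. f0 \<bullet> w = 0" "f0 \<bullet> v \<noteq> 0"
    using separating_functional[OF D v(1)] by blast
  define f where "f = inverse (f0 \<bullet> v) \<cdot>\<^sub>v f0"
  have f: "f \<in> carrier_vec ?d" "f \<bullet> v = 1" "\<And>w. w \<in> D \<Longrightarrow> f \<bullet> w = 0"
    using f0 v(1) by (auto simp: f_def D_def)
  have f_lower: "f \<bullet> (act R l *\<^sub>v v) = 1" if l: "lower_unitriangular n l" for l
  proof -
    have lG: "l \<in> carrier (GL n)" using l by (simp add: lower_unitriangular_def)
    define k where "k = contracted n l"
    note k = lower_contraction[OF l, folded k_def]
    define w where "w = act R l *\<^sub>v v + (-1) \<cdot>\<^sub>v v"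
    have lv: "act R l *\<^sub>v v \<in> carrier_vec ?d" using RC[OF lG] v(1) by simp
    have "((\<lambda>e. scaled e w i) \<longlongrightarrow> 0) (at 0)" if i: "i < ?d" for i
    proof (rule Lim_transform_eventually)
      have "regular_on_GL n (\<lambda>g. unit_vec ?d i \<bullet> (act R g *\<^sub>v v))"
        using v(1) by (intro regular_coefficient R) auto
      then have "((\<lambda>e. unit_vec ?d i \<bullet> (act R (k e) *\<^sub>v v)) \<longlongrightarrow> unit_vec ?d i \<bullet> (act R (1\<^sub>m n) *\<^sub>v v)) (at 0)"
        by (rule regular_tendsto) (use ev k in \<open>auto elim: eventually_mono\<close>)
      then have "((\<lambda>e. unit_vec ?d i \<bullet> (act R (k e) *\<^sub>v v) - v $ i) \<longlongrightarrow> v $ i - v $ i) (at 0)"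
        using v(1) i by (intro tendsto_diff tendsto_const) (simp add: rep_one[OF R])
      then show "((\<lambda>e. unit_vec ?d i \<bullet> (act R (k e) *\<^sub>v v) - v $ i) \<longlongrightarrow> 0) (at 0)" by simp
      show "\<forall>\<^sub>F e in at 0. unit_vec ?d i \<bullet> (act R (k e) *\<^sub>v v) - v $ i = scaled e w i"
        using ev
      proof eventually_elim
        case (elim e)
        note C = RC[OF k(1)[OF elim]] RC[OF o(1)[OF elim]] RC[OF lG]
        have "act R (one_param n e) *\<^sub>v (act R l *\<^sub>v v) = act R (one_param n e * l) *\<^sub>v v"
          using C v(1) by (simp add: rep_mult[OF R o(1)[OF elim] lG])
        also have "\<dots> = act R (k e) *\<^sub>v (act R (one_param n e) *\<^sub>v v)"
          using C v(1) by (simp add: rep_mult[OF R k(1)[OF elim] o(1)[OF elim]] flip: k(2)[OF elim])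
        also have "\<dots> = \<chi> e \<cdot>\<^sub>v (act R (k e) *\<^sub>v v)"
          using C v(1) by (simp add: v(3)[OF torus_one_param[OF elim]] \<chi>_def mult_mat_vec)
        finally have "scaled e (act R l *\<^sub>v v) i = (act R (k e) *\<^sub>v v) $ i"
          using C i o(2)[OF elim] by (simp add: scaled_def)
        moreover have "scaled e w i = scaled e (act R l *\<^sub>v v) i - v $ i"
          unfolding w_def using scaled_add[OF elim i lv, of "(-1) \<cdot>\<^sub>v v"] scaled_smult[OF elim i v(1) v(1)]
            scaled_v[OF elim i] v(1) by simp
        ultimately show ?case using C v(1) i by simp
      qed
    qed
    then have "w \<in> D" using lv v(1) by (simp add: D_def w_def)
    then have "f \<bullet> w = 0" by (rule f(3))
    then show ?thesis using f(1,2) v(1) lv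
      by (simp add: w_def scalar_prod_add_distrib[of _ ?d] scalar_prod_smult_distrib[of _ ?d])
  qed
  have "f \<bullet> (act R g *\<^sub>v v) = highest_weight_function n a b g" if g: "g \<in> carrier (GL n)" for g
  proof (rule regular_eq_if_eq_on_big_cell[OF _ _ _ g])
    show "regular_on_GL n (\<lambda>g. f \<bullet> (act R g *\<^sub>v v))" by (rule regular_coefficient[OF R f(1) v(1)])
    show "regular_on_GL n (highest_weight_function n a b)" using n by (intro regular_intros) auto
    fix l t u assume l: "lower_unitriangular n l" and t: "torus n t" and u: "upper_unitriangular n u"
    have G: "l \<in> carrier (GL n)" "t \<in> carrier (GL n)" "u \<in> carrier (GL n)"
      using l t u by (auto simp: lower_unitriangular_def torus_def upper_unitriangular_def)
    note C = RC[OF G(1)] RC[OF G(2)] RC[OF G(3)]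
    have "act R (l * t * u) *\<^sub>v v = act R l *\<^sub>v (act R t *\<^sub>v (act R u *\<^sub>v v))"
      using C v(1) G by (simp add: rep_mult[OF R] GL_mult assoc_mult_mat_vec[of _ ?d ?d _ ?d]
          mult_carrier_mat[of _ ?d ?d _ ?d])
    also have "\<dots> = torus_weight n a b t \<cdot>\<^sub>v (act R l *\<^sub>v v)"
      using C v(1) by (simp add: v(3)[OF t] v(4)[OF u] mult_mat_vec)
    finally have "f \<bullet> (act R (l * t * u) *\<^sub>v v) = torus_weight n a b t"
      using f_lower[OF l] f(1) C v(1) by (simp add: scalar_prod_smult_distrib[of _ ?d])
    also have "\<dots> = highest_weight_function n a b (l * t * u)"
      using n G l t u
      by (simp add: highest_weight_function_upper GL_mult highest_weight_function_torus highest_weight_function_lower)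
    finally show "f \<bullet> (act R (l * t * u) *\<^sub>v v) = highest_weight_function n a b (l * t * u)" .
  qed
  then show ?thesis using f(1) by blast
qed

text \<open>The vectors on which all translates of \<open>f\<close> vanish form an invariant subspace, which is proper
since \<open>f\<close> is not zero.\<close>

lemma irreducible_coefficients_separate:
  assumes R: "rational_rep n R" "irreducible_rep n R"
    and f: "f \<in> carrier_vec (deg R)" "f \<noteq> 0\<^sub>v (deg R)"
    and x: "x \<in> carrier_vec (deg R)" "\<And>g. g \<in> carrier (GL n) \<Longrightarrow> f \<bullet> (act R g *\<^sub>v x) = 0"
  shows "x = 0\<^sub>v (deg R)"
proof -
  let ?d = "deg R"
  note RC = GL_carrier[OF rep_GL[OF R(1)]]
  define W where "W = {x \<in> carrier_vec ?d. \<forall>g\<in>carrier (GL n). f \<bullet> (act R g *\<^sub>v x) = 0}"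
  have "invariant_subspace n R W"
    unfolding invariant_subspace_def
  proof (intro conjI ballI subspaceI)
    show "act R g *\<^sub>v w \<in> W" if g: "g \<in> carrier (GL n)" and w: "w \<in> W" for g w
    proof -
      have "f \<bullet> (act R h *\<^sub>v (act R g *\<^sub>v w)) = 0" if h: "h \<in> carrier (GL n)" for h
        using w GL_mult[OF h g] RC[OF g] RC[OF h]
        by (simp add: W_def assoc_mult_mat_vec[of _ ?d ?d _ ?d, symmetric] flip: rep_mult[OF R(1) h g])
      then show ?thesis using w RC[OF g] by (auto simp: W_def)
    qed
  qed (use RC f mult_mat_vec_carrier[OF RC] in \<open>auto simp: W_def mult_zero_vec[of _ ?d ?d] mult_add_distrib_mat_vec[of _ ?d ?d] mult_mat_vec[of _ ?d ?d]
      scalar_prod_add_distrib[of _ ?d]\<close>)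
  moreover have "W \<noteq> carrier_vec ?d"
  proof
    assume W: "W = carrier_vec ?d"
    have "f $ i = 0" if "i < ?d" for i
    proof -
      have "unit_vec ?d i \<in> W" using W by simp
      then have "f \<bullet> (act R (1\<^sub>m n) *\<^sub>v unit_vec ?d i) = 0" by (auto simp: W_def)
      then show ?thesis using f that by (simp add: rep_one[OF R(1)])
    qed
    then show False using f by (auto intro: eq_vecI)
  qed
  ultimately have "W = {0\<^sub>v ?d}" using R(2) by (auto simp: irreducible_rep_def)
  then show ?thesis using x by (auto simp: W_def)
qed

text \<open>The same fact with the roles of the vector and the functional exchanged: the orbit of a nonzero vector
spans the representation.\<close>

lemma irreducible_cyclic:
  assumes R: "rational_rep n R" "irreducible_rep n R"
    and v: "v \<in> carrier_vec (deg R)" "v \<noteq> 0\<^sub>v (deg R)"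
    and l: "l \<in> carrier_vec (deg R)" "\<And>g. g \<in> carrier (GL n) \<Longrightarrow> l \<bullet> (act R g *\<^sub>v v) = 0"
  shows "l = 0\<^sub>v (deg R)"
  using irreducible_coefficients_separate[OF R l(1) _ v(1) l(2)] v(2) by blast

section \<open>Existence of the irreducible representation\<close>

definition sample_matrix ::
  "(complex mat \<Rightarrow> complex) \<Rightarrow> (nat \<Rightarrow> complex mat) \<Rightarrow> (nat \<Rightarrow> complex mat) \<Rightarrow> nat \<Rightarrow> complex mat" where
  "sample_matrix \<phi> h k d = mat d d (\<lambda>(i, j). \<phi> (h i * k j))"

lemma sample_matrix_carrier [simp]: "sample_matrix \<phi> h k d \<in> carrier_mat d d"
  by (simp add: sample_matrix_def)

lemma sample_matrix_dim [simp]: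
  "dim_row (sample_matrix \<phi> h k d) = d" "dim_col (sample_matrix \<phi> h k d) = d"
  by (simp_all add: sample_matrix_def)

text \<open>A sum of \<open>N\<close> products in separated variables gives matrices of rank at most \<open>N\<close>.\<close>

lemma sample_matrix_singular:
  assumes rank: "\<And>x y. x \<in> carrier (GL n) \<Longrightarrow> y \<in> carrier (GL n) \<Longrightarrow> \<phi> (x * y) = (\<Sum>m<N. u m x * w m y)"
    and hk: "\<And>i. i < d \<Longrightarrow> h i \<in> carrier (GL n) \<and> k i \<in> carrier (GL n)"
    and d: "d > N"
  shows "det (sample_matrix \<phi> h k d) = 0"
proof -
  define A where "A = mat d d (\<lambda>(i, m). if m < N then u m (h i) else 0)"
  define B where "B = mat d d (\<lambda>(m, j). w m (k j))"
  have AB: "A \<in> carrier_mat d d" "B \<in> carrier_mat d d" by (auto simp: A_def B_def)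
  have "sample_matrix \<phi> h k d = A * B"
  proof (rule eq_matI)
    fix i j assume "i < dim_row (A * B)" "j < dim_col (A * B)"
    then have ij: "i < d" "j < d" using AB by auto
    have "(A * B) $$ (i, j) = (\<Sum>m<d. if m < N then u m (h i) * w m (k j) else 0)"
      unfolding mat_mult_entry[OF AB ij] using ij by (intro sum.cong) (auto simp: A_def B_def)
    also have "\<dots> = (\<Sum>m<N. u m (h i) * w m (k j))"
      using d by (intro sum.mono_neutral_cong_right) auto
    also have "\<dots> = \<phi> (h i * k j)" using rank hk ij by simp
    finally show "sample_matrix \<phi> h k d $$ (i, j) = (A * B) $$ (i, j)"
      using ij by (simp add: sample_matrix_def)
  qed (use AB in auto)
  moreover have "det A = 0"
  proof -
    have "A *\<^sub>v unit_vec d N = 0\<^sub>v d"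
      using d by (intro eq_vecI) (auto simp: A_def)
    moreover have "unit_vec d N \<noteq> (0\<^sub>v d :: complex vec)" using d by (metis index_unit_vec(2) index_zero_vec(1) one_neq_zero)
    ultimately show ?thesis using det_0_iff_vec_prod_zero_field[OF AB(1)] unit_vec_carrier by blast
  qed
  ultimately show ?thesis using det_mult[OF AB] by simp
qed

text \<open>The Schur complement of \<open>A\<close> in a matrix with one more row and column.\<close>

lemma det_bordered:
  fixes A :: "complex mat"
  assumes A: "A \<in> carrier (GL d)" and c: "c \<in> carrier_vec d" and r: "r \<in> carrier_vec d"
  shows "det (four_block_mat A (mat d 1 (\<lambda>(i, _). c $ i)) (mat 1 d (\<lambda>(_, j). r $ j)) (mat 1 1 (\<lambda>_. s)))
    = det A * (s - r \<bullet> (gl_inv A *\<^sub>v c))"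
proof -
  note AC = GL_carrier[OF A] GL_carrier[OF gl_inv_GL[OF A]]
  define C where "C = mat d 1 (\<lambda>(i, _::nat). c $ i)"
  define R where "R = mat 1 d (\<lambda>(_::nat, j). r $ j)"
  have CR: "C \<in> carrier_mat d 1" "R \<in> carrier_mat 1 d" by (auto simp: C_def R_def)
  define Y where "Y = R * gl_inv A"
  have Y: "Y \<in> carrier_mat 1 d" unfolding Y_def using CR AC by simp
  have YA: "Y * A = R" unfolding Y_def using CR AC by (simp add: gl_inv_left[OF A])
  define S where "S = mat 1 1 (\<lambda>_::nat \<times> nat. s - r \<bullet> (gl_inv A *\<^sub>v c))"
  have "Y * C + S = mat 1 1 (\<lambda>_. s)"
  proof (rule eq_matI)
    fix i j assume "i < dim_row (mat 1 1 (\<lambda>_. s))" "j < dim_col (mat 1 1 (\<lambda>_. s))"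
    then have ij: "i = 0" "j = 0" by auto
    have "(Y * C) $$ (0, 0) = r \<bullet> (gl_inv A *\<^sub>v c)"
    proof -
      have "Y * C = R * (gl_inv A * C)" unfolding Y_def using CR AC by simp
      moreover have "row R 0 = r" using r by (intro eq_vecI) (auto simp: R_def)
      moreover have "col (gl_inv A * C) 0 = gl_inv A *\<^sub>v c"
      proof -
        have "col C 0 = c" using c by (intro eq_vecI) (auto simp: C_def)
        then show ?thesis using col_mult2[OF AC(2) CR(1), of 0] by simp
      qed
      ultimately show ?thesis using CR AC by simp
    qed
    then show "(Y * C + S) $$ (i, j) = mat 1 1 (\<lambda>_. s) $$ (i, j)"
      using ij by (simp add: S_def)
  qed (simp_all add: S_def)
  then have "four_block_mat A C R (mat 1 1 (\<lambda>_. s)) =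
      four_block_mat (1\<^sub>m d) (0\<^sub>m d 1) Y (1\<^sub>m 1) * four_block_mat A C (0\<^sub>m 1 d) S"
    by (subst mult_four_block_mat[of _ d d _ 1 _ 1 _ _ d _ 1]) (use AC CR Y YA in \<open>auto simp: S_def\<close>)
  also have "det \<dots> = det (four_block_mat (1\<^sub>m d) (0\<^sub>m d 1) Y (1\<^sub>m 1)) * det (four_block_mat A C (0\<^sub>m 1 d) S)"
    by (rule det_mult[of _ "d + 1"]) (use AC in \<open>auto simp: S_def\<close>)
  also have "det (four_block_mat (1\<^sub>m d) (0\<^sub>m d 1) Y (1\<^sub>m 1)) = 1"
    using Y by (subst det_four_block_mat_upper_right_zero[of _ d _ 1]) auto
  also have "det (four_block_mat A C (0\<^sub>m 1 d) S) = det A * det S"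
    using AC CR by (intro det_four_block_mat_lower_left_zero) (auto simp: S_def)
  also have "det S = s - r \<bullet> (gl_inv A *\<^sub>v c)"
    by (simp add: S_def det_single)
  finally show ?thesis by (simp add: C_def R_def)
qed

text \<open>A function \<open>\<phi>\<close> of finite rank has a largest \<open>d\<close> for which some matrix \<open>\<phi> (h\<^sub>i * k\<^sub>j)\<close> of size \<open>d\<close> is invertible.
The vectors of the representation below stand for the span of the right translates of
\<open>\<phi>\<close>, with the translates by \<open>k\<^sub>0, k\<^sub>1, \<dots>\<close> as a basis and evaluation at \<open>h\<^sub>0, h\<^sub>1, \<dots>\<close> as coordinates up to the
base change \<open>\<Psi>\<close>.\<close>

locale maximal_minor =
  fixes n d :: nat and \<phi> :: "complex mat \<Rightarrow> complex" and h k :: "nat \<Rightarrow> complex mat"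
  assumes h_GL: "i < d \<Longrightarrow> h i \<in> carrier (GL n)"
    and k_GL: "i < d \<Longrightarrow> k i \<in> carrier (GL n)"
    and nonsingular: "det (sample_matrix \<phi> h k d) \<noteq> 0"
    and maximal: "(\<And>i. i < Suc d \<Longrightarrow> h' i \<in> carrier (GL n) \<and> k' i \<in> carrier (GL n)) \<Longrightarrow>
       det (sample_matrix \<phi> h' k' (Suc d)) = 0"
begin

definition row_values :: "complex mat \<Rightarrow> complex vec" where
  "row_values x = vec d (\<lambda>j. \<phi> (x * k j))"

definition col_values :: "complex mat \<Rightarrow> complex vec" where
  "col_values y = vec d (\<lambda>i. \<phi> (h i * y))"

definition \<Psi> :: "complex mat" where
  "\<Psi> = gl_inv (sample_matrix \<phi> h k d)"

definition moved :: "complex mat \<Rightarrow> complex mat" where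
  "moved g = mat d d (\<lambda>(i, j). \<phi> (h i * g * k j))"

definition rep :: mat_rep where
  "rep = \<lparr>deg = d, act = (\<lambda>g. \<Psi> * moved g)\<rparr>"

definition cyclic_vector :: "complex vec" where
  "cyclic_vector = \<Psi> *\<^sub>v col_values (1\<^sub>m n)"

lemma values_carrier [simp]:
  "row_values x \<in> carrier_vec d" "col_values x \<in> carrier_vec d" "moved x \<in> carrier_mat d d"
  by (auto simp: row_values_def col_values_def moved_def)

lemma moved_dim [simp]: "dim_row (moved x) = d" "dim_col (moved x) = d"
  by (simp_all add: moved_def)

lemma sample_GL: "sample_matrix \<phi> h k d \<in> carrier (GL d)"
  using nonsingular by (simp add: GL_iff)

lemma \<Psi>_carrier [simp]: "\<Psi> \<in> carrier_mat d d"
  unfolding \<Psi>_def by (rule GL_carrier[OF gl_inv_GL[OF sample_GL]])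

text \<open>By maximality the bordered matrix with the extra row \<open>x\<close> and the extra column \<open>y\<close> is singular, so
its Schur complement is zero. This identity makes the action multiplicative.\<close>

lemma factorization:
  assumes x: "x \<in> carrier (GL n)" and y: "y \<in> carrier (GL n)"
  shows "row_values x \<bullet> (\<Psi> *\<^sub>v col_values y) = \<phi> (x * y)"
proof -
  define h' where "h' = h(d := x)"
  define k' where "k' = k(d := y)"
  have "sample_matrix \<phi> h' k' (Suc d) =
      four_block_mat (sample_matrix \<phi> h k d) (mat d 1 (\<lambda>(i, _). col_values y $ i))
        (mat 1 d (\<lambda>(_, j). row_values x $ j)) (mat 1 1 (\<lambda>_. \<phi> (x * y)))"
    by (intro eq_matI)
      (auto simp: sample_matrix_def h'_def k'_def row_values_def col_values_def less_Suc_eq)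
  moreover have "det (sample_matrix \<phi> h' k' (Suc d)) = 0"
    by (rule maximal) (auto simp: h'_def k'_def x y h_GL k_GL less_Suc_eq)
  ultimately show ?thesis
    using det_bordered[OF sample_GL, of "col_values y" "row_values x" "\<phi> (x * y)"] nonsingular
    by (simp add: \<Psi>_def)
qed

lemma row_moved: "i < d \<Longrightarrow> row (moved g) i = row_values (h i * g)"
  by (intro eq_vecI) (auto simp: moved_def row_values_def)

lemma col_moved:
  assumes "j < d" "g \<in> carrier (GL n)"
  shows "col (moved g) j = col_values (g * k j)"
  using assms GL_carrier[OF h_GL] GL_carrier[OF k_GL] GL_carrier[OF assms(2)]
  by (intro eq_vecI) (auto simp: moved_def col_values_def assoc_mult_mat[of _ n n _ n _ n])

lemma moved_mult:
  assumes x: "x \<in> carrier (GL n)" and y: "y \<in> carrier (GL n)"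
  shows "moved x * (\<Psi> * moved y) = moved (x * y)"
proof (rule eq_matI)
  fix i j assume "i < dim_row (moved (x * y))" "j < dim_col (moved (x * y))"
  then have ij: "i < d" "j < d" by (auto simp: moved_def)
  note C = GL_carrier[OF h_GL[OF ij(1)]] GL_carrier[OF k_GL[OF ij(2)]] GL_carrier[OF x] GL_carrier[OF y]
  have "(moved x * (\<Psi> * moved y)) $$ (i, j) = row (moved x) i \<bullet> col (\<Psi> * moved y) j"
    using ij values_carrier(3)[of x] values_carrier(3)[of y] \<Psi>_carrier
    by (intro index_mult_mat) auto
  also have "col (\<Psi> * moved y) j = \<Psi> *\<^sub>v col (moved y) j"
    using ij by (intro col_mult2[of _ d d _ d]) auto
  finally have "(moved x * (\<Psi> * moved y)) $$ (i, j) = \<phi> (h i * x * (y * k j))"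
    using ij x y by (simp add: row_moved col_moved factorization GL_mult h_GL k_GL)
  also have "h i * x * (y * k j) = h i * (x * y) * k j"
    using C by (simp add: assoc_mult_mat[of _ n n _ n _ n] mult_carrier_mat[of _ n n _ n])
  finally show "(moved x * (\<Psi> * moved y)) $$ (i, j) = moved (x * y) $$ (i, j)"
    using ij by (simp add: moved_def)
qed (use \<Psi>_carrier values_carrier(3) in auto)

lemma moved_one: "\<Psi> * moved (1\<^sub>m n) = 1\<^sub>m d"
proof -
  have "moved (1\<^sub>m n) = sample_matrix \<phi> h k d"
    by (intro eq_matI) (auto simp: moved_def sample_matrix_def right_mult_one_mat[OF GL_carrier[OF h_GL]])
  then show ?thesis by (simp add: \<Psi>_def gl_inv_left[OF sample_GL])
qed

lemma deg_rep [simp]: "deg rep = d" and act_rep [simp]: "act rep g = \<Psi> * moved g"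
  by (simp_all add: rep_def)

lemma rep_act_mult:
  assumes x: "x \<in> carrier (GL n)" and y: "y \<in> carrier (GL n)"
  shows "act rep (x * y) = act rep x * act rep y"
proof -
  have "\<Psi> * moved x * (\<Psi> * moved y) = \<Psi> * (moved x * (\<Psi> * moved y))"
    by (intro assoc_mult_mat[of _ d d _ d _ d] mult_carrier_mat[of _ d d _ d]) auto
  then show ?thesis by (simp add: moved_mult[OF x y])
qed

lemma rational_rep_rep:
  assumes reg: "regular_on_GL n \<phi>"
  shows "rational_rep n rep"
  unfolding rational_rep_def
proof (intro conjI allI impI)
  have G: "act rep g \<in> carrier (GL d)" if g: "g \<in> carrier (GL n)" for g
  proof (rule GL_of_inverse(1))
    show "act rep g * act rep (gl_inv g) = 1\<^sub>m d"
      using rep_act_mult[OF g gl_inv_GL[OF g]] moved_one by (simp add: gl_inv_right[OF g])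
  qed (auto intro!: mult_carrier_mat[of _ d d _ d])
  then show "act rep \<in> hom (GL n) (GL (deg rep))"
    using rep_act_mult by (auto simp: hom_def)
  show "\<exists>f\<in>regular_functions n. \<forall>g\<in>carrier (GL n). act rep g $$ (i, j) = f g"
    if ij: "i < deg rep" "j < deg rep" for i j
  proof -
    have "regular_on_GL n (\<lambda>g. \<Sum>m<d. \<Psi> $$ (i, m) * \<phi> (h m * g * k j))"
      using ij by (intro regular_intros regular_translate reg h_GL k_GL) auto
    then have "regular_on_GL n (\<lambda>g. act rep g $$ (i, j))"
      by (rule regular_cong)
        (use ij in \<open>simp add: mat_mult_entry[of _ d d _ d] moved_def del: index_mult_mat\<close>)
    then show ?thesis by (simp add: regular_on_GL_def)
  qed
qed

lemma act_cyclic_vector: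
  assumes g: "g \<in> carrier (GL n)"
  shows "act rep g *\<^sub>v cyclic_vector = \<Psi> *\<^sub>v col_values g"
proof -
  have "moved g *\<^sub>v (\<Psi> *\<^sub>v col_values (1\<^sub>m n)) = col_values g"
  proof (rule eq_vecI)
    fix i assume "i < dim_vec (col_values g)"
    then have i: "i < d" by (simp add: col_values_def)
    then have "(moved g *\<^sub>v (\<Psi> *\<^sub>v col_values (1\<^sub>m n))) $ i = row_values (h i * g) \<bullet> (\<Psi> *\<^sub>v col_values (1\<^sub>m n))"
      using values_carrier(3)[of g] by (simp add: row_moved)
    also have "\<dots> = \<phi> (h i * g)"
      using i g by (simp add: factorization h_GL GL_mult right_mult_one_mat[OF GL_carrier[OF GL_mult[OF h_GL[OF i] g]]])
    finally show "(moved g *\<^sub>v (\<Psi> *\<^sub>v col_values (1\<^sub>m n))) $ i = col_values g $ i"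
      using i by (simp add: col_values_def)
  qed (simp add: moved_def col_values_def)
  then show ?thesis
    unfolding cyclic_vector_def act_rep
    by (subst assoc_mult_mat_vec[of _ d d _ d]) (auto intro: mult_mat_vec_carrier[of _ d d])
qed

lemma cyclic_vector_carrier [simp]: "cyclic_vector \<in> carrier_vec d"
  unfolding cyclic_vector_def by (rule mult_mat_vec_carrier[of _ d d]) auto

text \<open>The translate of the cyclic vector by \<open>k\<^sub>j\<close> is the \<open>j\<close>-th unit vector.\<close>

lemma cyclic_vector_generates:
  assumes W: "invariant_subspace n rep W" and v: "cyclic_vector \<in> W"
  shows "W = carrier_vec d"
proof (rule ccontr)
  assume "W \<noteq> carrier_vec d"
  have sub: "subspace class_ring W (module_vec TYPE(complex) d)"
    using W by (simp add: invariant_subspace_def)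
  with \<open>W \<noteq> carrier_vec d\<close> obtain x where x: "x \<in> carrier_vec d" "x \<notin> W"
    using subspaceD(1) by blast
  obtain l where l: "l \<in> carrier_vec d" "\<forall>w\<in>W. l \<bullet> w = 0" "l \<bullet> x \<noteq> 0"
    using separating_functional[OF sub x] by blast
  have "l $ j = 0" if j: "j < d" for j
  proof -
    have "act rep (k j) *\<^sub>v cyclic_vector \<in> W"
      using W v k_GL[OF j] by (auto simp: invariant_subspace_def)
    moreover have "act rep (k j) *\<^sub>v cyclic_vector = unit_vec d j"
    proof -
      have "col_values (k j) = col (moved (1\<^sub>m n)) j"
        using j GL_carrier[OF k_GL[OF j]] by (simp add: col_moved)
      then have "\<Psi> *\<^sub>v col_values (k j) = col (\<Psi> * moved (1\<^sub>m n)) j"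
        using col_mult2[OF \<Psi>_carrier values_carrier(3) j, of "1\<^sub>m n"] by simp
      then show ?thesis using j by (simp add: act_cyclic_vector[OF k_GL[OF j]] moved_one del: act_rep)
    qed
    ultimately show ?thesis using l(1,2) j by auto
  qed
  then have "l = 0\<^sub>v d" using l(1) by (intro eq_vecI) auto
  then show False using l(3) x(1) by simp
qed

end

text \<open>In \<open>p\<^sub>0\<close> and \<open>q\<^sub>n\<^sub>-\<^sub>1\<close> of the product only the term through the first, respectively the last, coordinate survives
the limit. So the contraction splits \<open>\<phi> (x * y)\<close> into \<open>\<phi> x * \<phi> y\<close>: in the representation it projects onto the line of
the highest weight vector.\<close>

lemma highest_weight_function_limit:
  assumes n: "n \<ge> 1" and x: "x \<in> carrier (GL n)" and y: "y \<in> carrier (GL n)"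
  shows "((\<lambda>e. highest_weight_function n a b (x * one_param n e * y) / torus_weight n a b (one_param n e))
     \<longlongrightarrow> highest_weight_function n a b x * highest_weight_function n a b y) (at 0)"
proof -
  note C = GL_carrier[OF x] GL_carrier[OF y] GL_carrier[OF gl_inv_GL[OF x]] GL_carrier[OF gl_inv_GL[OF y]]
  define p where "p = (\<lambda>e. \<Sum>i<n. x $$ (0, i) * e ^ i * y $$ (i, 0))"
  define q where "q = (\<lambda>e. \<Sum>i<n. gl_inv y $$ (n - 1, i) * e ^ (n - 1 - i) * gl_inv x $$ (i, n - 1))"
  have "(p \<longlongrightarrow> (\<Sum>i<n. x $$ (0, i) * 0 ^ i * y $$ (i, 0))) (at 0)"
    unfolding p_def by (intro tendsto_intros)
  also have "(\<Sum>i<n. x $$ (0, i) * 0 ^ i * y $$ (i, 0)) = (\<Sum>i\<in>{0}. x $$ (0, i) * 0 ^ i * y $$ (i, 0))"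
    using n by (intro sum.mono_neutral_right) auto
  finally have p: "(p \<longlongrightarrow> x $$ (0, 0) * y $$ (0, 0)) (at 0)" by simp
  have "(q \<longlongrightarrow> (\<Sum>i<n. gl_inv y $$ (n - 1, i) * 0 ^ (n - 1 - i) * gl_inv x $$ (i, n - 1))) (at 0)"
    unfolding q_def by (intro tendsto_intros)
  also have "(\<Sum>i<n. gl_inv y $$ (n - 1, i) * 0 ^ (n - 1 - i) * gl_inv x $$ (i, n - 1)) =
      (\<Sum>i\<in>{n - 1}. gl_inv y $$ (n - 1, i) * 0 ^ (n - 1 - i) * gl_inv x $$ (i, n - 1))"
    using n by (intro sum.mono_neutral_right) auto
  finally have q: "(q \<longlongrightarrow> gl_inv y $$ (n - 1, n - 1) * gl_inv x $$ (n - 1, n - 1)) (at 0)" by simp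
  have "((\<lambda>e. p e ^ a * q e ^ b) \<longlongrightarrow> (x $$ (0, 0) * y $$ (0, 0)) ^ a *
      (gl_inv y $$ (n - 1, n - 1) * gl_inv x $$ (n - 1, n - 1)) ^ b) (at 0)"
    by (intro tendsto_intros p q)
  moreover have "\<forall>\<^sub>F e in at (0::complex). e \<noteq> 0" by (simp add: eventually_at_filter)
  then have "\<forall>\<^sub>F e in at 0. p e ^ a * q e ^ b =
      highest_weight_function n a b (x * one_param n e * y) / torus_weight n a b (one_param n e)"
  proof eventually_elim
    case (elim e)
    note t = torus_one_param[OF elim, of n]
    have tG: "one_param n e \<in> carrier (GL n)" using t by (simp add: torus_def)
    have te: "one_param n e $$ (i, i) = e ^ i" if "i < n" for i
      using that by (simp add: one_param_def)
    note tC = GL_carrier[OF tG] GL_carrier[OF gl_inv_GL[OF tG]]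
    have xt: "(x * one_param n e) $$ (0, i) = x $$ (0, i) * e ^ i" if "i < n" for i
      using mult_torus[OF C(1) t, of 0 i] that n by (simp add: one_param_def)
    have "(x * one_param n e * y) $$ (0, 0) = p e"
      unfolding p_def using n C tC
      by (subst mat_mult_entry[of _ n n _ n]) (auto intro!: sum.cong simp: xt simp del: index_mult_mat(1))
    moreover have "e ^ (n - 1) * gl_inv (x * one_param n e * y) $$ (n - 1, n - 1) = q e"
    proof -
      have inv: "gl_inv (x * one_param n e * y) = gl_inv y * (gl_inv (one_param n e) * gl_inv x)"
        by (simp add: gl_inv_mult[OF GL_mult[OF x tG] y] gl_inv_mult[OF x tG])
      have tx: "(gl_inv (one_param n e) * gl_inv x) $$ (i, n - 1) = inverse (e ^ i) * gl_inv x $$ (i, n - 1)"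
        if "i < n" for i
        using torus_mult[OF C(3) torus_gl_inv[OF t], of i "n - 1"] that n
        by (simp add: torus_diag_nonzero(2)[OF t] te)
      have "(gl_inv y * (gl_inv (one_param n e) * gl_inv x)) $$ (n - 1, n - 1) =
          (\<Sum>i<n. gl_inv y $$ (n - 1, i) * (inverse (e ^ i) * gl_inv x $$ (i, n - 1)))"
        using n C tC
        by (subst mat_mult_entry[of _ n n _ n]) (auto intro!: sum.cong simp: tx[simplified] simp del: index_mult_mat(1))
      then show ?thesis
        unfolding inv q_def using elim
        by (auto simp: sum_distrib_left power_diff field_simps intro!: sum.cong)
    qed
    moreover have "torus_weight n a b (one_param n e) = inverse (e ^ (n - 1)) ^ b"
      using n by (simp add: torus_weight_def one_param_def)
    ultimately have "highest_weight_function n a b (x * one_param n e * y) / torus_weight n a b (one_param n e)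
        = p e ^ a * (e ^ (n - 1) * gl_inv (x * one_param n e * y) $$ (n - 1, n - 1)) ^ b"
      unfolding highest_weight_function_def power_mult_distrib divide_inverse by (simp add: power_inverse)
    then show ?case
      using \<open>e ^ (n - 1) * gl_inv (x * one_param n e * y) $$ (n - 1, n - 1) = q e\<close> by simp
  qed
  ultimately have "((\<lambda>e. highest_weight_function n a b (x * one_param n e * y) / torus_weight n a b (one_param n e))
      \<longlongrightarrow> (x $$ (0, 0) * y $$ (0, 0)) ^ a *
      (gl_inv y $$ (n - 1, n - 1) * gl_inv x $$ (n - 1, n - 1)) ^ b) (at 0)"
    by (rule Lim_transform_eventually)
  then show ?thesis by (simp add: highest_weight_function_def power_mult_distrib mult_ac)
qed

definition finite_rank :: "nat \<Rightarrow> (complex mat \<Rightarrow> complex mat \<Rightarrow> complex) \<Rightarrow> bool" where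
  "finite_rank n K \<longleftrightarrow> (\<exists>N u w. \<forall>x\<in>carrier (GL n). \<forall>y\<in>carrier (GL n). K x y = (\<Sum>m<N::nat. u m x * w m y))"

lemma finite_rankI:
  assumes "\<And>x y. x \<in> carrier (GL n) \<Longrightarrow> y \<in> carrier (GL n) \<Longrightarrow> K x y = (\<Sum>m<N::nat. u m x * w m y)"
  shows "finite_rank n K"
  using assms unfolding finite_rank_def by blast

lemma sum_div_mod:
  fixes f :: "nat \<Rightarrow> nat \<Rightarrow> 'a :: comm_monoid_add"
  shows "(\<Sum>m<N * M. f (m div M) (m mod M)) = (\<Sum>i<N. \<Sum>j<M. f i j)"
proof -
  have "(\<Sum>m\<in>{i * M..<i * M + M}. f (m div M) (m mod M)) = (\<Sum>j<M. f i j)" for i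
  proof -
    have "(\<Sum>m\<in>{0 + i * M..<M + i * M}. f (m div M) (m mod M)) = (\<Sum>j\<in>{0..<M}. f i j)"
      unfolding sum.shift_bounds_nat_ivl by (intro sum.cong) auto
    then show ?thesis by (simp add: add.commute lessThan_atLeast0)
  qed
  then show ?thesis
    using sum.nat_group[of "\<lambda>m. f (m div M) (m mod M)" M N] by simp
qed

lemma finite_rank_mult:
  assumes "finite_rank n K" "finite_rank n L"
  shows "finite_rank n (\<lambda>x y. K x y * L x y)"
proof -
  obtain N u w where 1: "\<forall>x\<in>carrier (GL n). \<forall>y\<in>carrier (GL n). K x y = (\<Sum>m<N::nat. u m x * w m y)"
    using assms(1) unfolding finite_rank_def by blast
  obtain M u' w' where 2: "\<forall>x\<in>carrier (GL n). \<forall>y\<in>carrier (GL n). L x y = (\<Sum>m<M::nat. u' m x * w' m y)"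
    using assms(2) unfolding finite_rank_def by blast
  show ?thesis
  proof (rule finite_rankI[where N = "N * M" and u = "\<lambda>m x. u (m div M) x * u' (m mod M) x"
        and w = "\<lambda>m y. w (m div M) y * w' (m mod M) y"])
    fix x y assume "x \<in> carrier (GL n)" "y \<in> carrier (GL n)"
    then have "K x y * L x y = (\<Sum>i<N. \<Sum>j<M. (u i x * w i y) * (u' j x * w' j y))"
      by (simp add: 1 2 sum_product)
    also have "\<dots> = (\<Sum>i<N. \<Sum>j<M. (u i x * u' j x) * (w i y * w' j y))"
      by (simp add: mult_ac)
    finally have "K x y * L x y = (\<Sum>i<N. \<Sum>j<M. (u i x * u' j x) * (w i y * w' j y))" .
    then show "K x y * L x y = (\<Sum>m<N * M. u (m div M) x * u' (m mod M) x * (w (m div M) y * w' (m mod M) y))"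
      by (simp add: sum_div_mod[of "\<lambda>i j. (u i x * u' j x) * (w i y * w' j y)"])
  qed
qed

lemma finite_rank_power: "finite_rank n K \<Longrightarrow> finite_rank n (\<lambda>x y. K x y ^ k)"
proof (induction k)
  case 0
  show ?case unfolding finite_rank_def
    by (rule exI[of _ 1], rule exI[of _ "\<lambda>_ _. 1"], rule exI[of _ "\<lambda>_ _. 1"]) simp
next
  case (Suc k)
  then show ?case using finite_rank_mult[of n K "\<lambda>x y. K x y ^ k"] by simp
qed

lemma finite_rank_highest_weight_function:
  assumes n: "n \<ge> 1"
  shows "finite_rank n (\<lambda>x y. highest_weight_function n a b (x * y))"
proof -
  have "finite_rank n (\<lambda>x y. (x * y) $$ (0, 0))"
    by (rule finite_rankI[where N = n and u = "\<lambda>m x. x $$ (0, m)" and w = "\<lambda>m y. y $$ (m, 0)"])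
      (use n in \<open>auto simp: mat_mult_entry[of _ n n _ n] GL_iff simp del: index_mult_mat(1)\<close>)
  moreover have "finite_rank n (\<lambda>x y. gl_inv (x * y) $$ (n - 1, n - 1))"
    by (rule finite_rankI[where N = n and u = "\<lambda>m x. gl_inv x $$ (m, n - 1)" and w = "\<lambda>m y. gl_inv y $$ (n - 1, m)"])
      (use n GL_carrier[OF gl_inv_GL] in \<open>auto simp: gl_inv_mult mat_mult_entry[of _ n n _ n] mult.commute simp del: index_mult_mat(1)\<close>)
  ultimately show ?thesis
    unfolding highest_weight_function_def by (intro finite_rank_mult finite_rank_power)
qed

text \<open>The cyclic vector has the required weight by the equivariance of \<open>\<phi>\<close>. For irreducibility, let \<open>W\<close> be
invariant and \<open>l\<close> a functional that kills \<open>W\<close> but not the cyclic vector. For \<open>x\<close> in \<open>W\<close>, the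
rescaled limit of \<open>l\<close> applied to \<open>one_param n e\<close> and \<open>h i\<close> acting on \<open>x\<close> is the product of the value of \<open>l\<close> on the
cyclic vector and the value at \<open>h i\<close> of the function that \<open>x\<close> stands for. It is zero, so these values vanish,
and \<open>x = 0\<close> because the matrix of samples is invertible.\<close>

lemma irrep_exists:
  assumes n: "n \<ge> 2"
  shows "\<exists>R. is_irrep_with_highest_weight n (hook_weight n a b) R"
proof -
  let ?\<phi> = "highest_weight_function n a b"
  obtain N u w where rank: "\<And>x y. x \<in> carrier (GL n) \<Longrightarrow> y \<in> carrier (GL n) \<Longrightarrow>
      ?\<phi> (x * y) = (\<Sum>m<N::nat. u m x * w m y)"
    using finite_rank_highest_weight_function[of n a b] n unfolding finite_rank_def by (auto; blast)
  define P where "P = (\<lambda>d. \<exists>h k. (\<forall>i<d. h i \<in> carrier (GL n) \<and> k i \<in> carrier (GL n)) \<and>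
      det (sample_matrix ?\<phi> h k d) \<noteq> 0)"
  have P_le: "d \<le> N" if Pd: "P d" for d
  proof (rule ccontr)
    assume "\<not> d \<le> N"
    then show False
      using Pd sample_matrix_singular[of n ?\<phi> u w N d, OF rank] unfolding P_def by force
  qed
  have "P 1"
    unfolding P_def using n
    by (intro exI[of _ "\<lambda>_. 1\<^sub>m n"]) (simp add: sample_matrix_def det_single highest_weight_function_one)
  obtain d where d: "P d" "\<And>d'. P d' \<Longrightarrow> d' \<le> d"
    using Nat.ex_has_greatest_nat[of P 1 N] \<open>P 1\<close> P_le by blast
  have "d \<ge> 1" using d(2)[OF \<open>P 1\<close>] .
  obtain h k where hk: "\<forall>i<d. h i \<in> carrier (GL n) \<and> k i \<in> carrier (GL n)"
    "det (sample_matrix ?\<phi> h k d) \<noteq> 0"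
    using d(1) unfolding P_def by blast
  interpret maximal_minor n d ?\<phi> h k
  proof
    show "det (sample_matrix ?\<phi> h' k' (Suc d)) = 0"
      if "\<And>i. i < Suc d \<Longrightarrow> h' i \<in> carrier (GL n) \<and> k' i \<in> carrier (GL n)" for h' k'
      using that d(2)[of "Suc d"] unfolding P_def by auto
  qed (use hk in auto)
  have reg: "regular_on_GL n ?\<phi>" using n by (intro regular_intros) auto
  have rat: "rational_rep n rep" by (rule rational_rep_rep[OF reg])
  have cv: "row_values (1\<^sub>m n) \<bullet> cyclic_vector = 1"
    using n by (simp add: cyclic_vector_def factorization highest_weight_function_one)
  have "cyclic_vector \<noteq> 0\<^sub>v d"
  proof
    assume "cyclic_vector = 0\<^sub>v d"
    then have "row_values (1\<^sub>m n) \<bullet> cyclic_vector = 0" by simp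
    with cv show False by simp
  qed
  moreover have "act rep t *\<^sub>v cyclic_vector = torus_weight n a b t \<cdot>\<^sub>v cyclic_vector" if t: "torus n t" for t
  proof -
    have "col_values t = torus_weight n a b t \<cdot>\<^sub>v col_values (1\<^sub>m n)"
      using n by (intro eq_vecI)
        (auto simp: col_values_def highest_weight_function_torus[OF _ h_GL t] right_mult_one_mat[OF GL_carrier[OF h_GL]])
    then show ?thesis
      using act_cyclic_vector[of t] t
      by (simp add: torus_def cyclic_vector_def mult_mat_vec[of _ d d] del: act_rep)
  qed
  moreover have "act rep x *\<^sub>v cyclic_vector = cyclic_vector" if x: "upper_unitriangular n x" for x
  proof -
    have "col_values x = col_values (1\<^sub>m n)"
      using n by (intro eq_vecI)
        (auto simp: col_values_def highest_weight_function_upper[OF _ h_GL x] right_mult_one_mat[OF GL_carrier[OF h_GL]])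
    then show ?thesis
      using act_cyclic_vector[of x] x
      by (simp add: upper_unitriangular_def cyclic_vector_def del: act_rep)
  qed
  ultimately have hw: "highest_weight_vector n rep (hook_weight n a b) cyclic_vector"
    using n by (simp add: highest_weight_vector_def prod_hook_weight torus_def upper_unitriangular_def del: act_rep)
  have "W = {0\<^sub>v d} \<or> W = carrier_vec d" if W: "invariant_subspace n rep W" for W
  proof (cases "cyclic_vector \<in> W")
    case True
    then show ?thesis using cyclic_vector_generates[OF W] by simp
  next
    case False
    have sub: "subspace class_ring W (module_vec TYPE(complex) d)"
      using W by (simp add: invariant_subspace_def)
    obtain l where l: "l \<in> carrier_vec d" "\<forall>w\<in>W. l \<bullet> w = 0" "l \<bullet> cyclic_vector \<noteq> 0"
      using separating_functional[OF sub _ False] by auto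
    have "x = 0\<^sub>v d" if x: "x \<in> W" for x
    proof -
      have xc: "x \<in> carrier_vec d" using subspaceD(1)[OF sub] x by blast
      \<comment> \<open>the value at \<open>h i\<close> of the combination of right translates with coefficients \<open>x\<close>\<close>
      have zero: "(sample_matrix ?\<phi> h k d *\<^sub>v x) $ i = 0" if i: "i < d" for i
      proof -
        define lp where "lp = (\<lambda>m. \<Sum>m'<d. l $ m' * \<Psi> $$ (m', m))"
        define E where "E = (\<lambda>e. \<Sum>m<d. lp m * (\<Sum>j<d. ?\<phi> (h m * one_param n e * (h i * k j)) / torus_weight n a b (one_param n e) * x $ j))"
        have "(E \<longlongrightarrow> (\<Sum>m<d. lp m * (\<Sum>j<d. (?\<phi> (h m) * ?\<phi> (h i * k j)) * x $ j))) (at 0)"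
          unfolding E_def using n i h_GL k_GL
          by (intro tendsto_sum tendsto_mult tendsto_const highest_weight_function_limit) auto
        moreover have "\<forall>\<^sub>F e in at (0::complex). e \<noteq> 0" by (simp add: eventually_at_filter)
        then have "\<forall>\<^sub>F e in at 0. E e = 0"
        proof eventually_elim
          case (elim e)
          let ?g = "one_param n e * h i"
          have tG: "one_param n e \<in> carrier (GL n)" using torus_one_param[OF elim] by (simp add: torus_def)
          have g: "?g \<in> carrier (GL n)" using tG h_GL[OF i] by auto
          have "l \<bullet> (act rep ?g *\<^sub>v x) = 0"
            using W x g l(2) by (auto simp: invariant_subspace_def)
          then have "l \<bullet> (\<Psi> *\<^sub>v (moved ?g *\<^sub>v x)) = 0"
            using xc by (simp add: assoc_mult_mat_vec[of _ d d _ d])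
          then have "(\<Sum>m'<d. \<Sum>m<d. l $ m' * \<Psi> $$ (m', m) * (moved ?g *\<^sub>v x) $ m) = 0"
            using xc l(1) by (subst (asm) scalar_prod_mult_vec[of _ d]) (auto intro: mult_mat_vec_carrier[of _ d d])
          then have "(\<Sum>m<d. lp m * (moved ?g *\<^sub>v x) $ m) = 0"
            by (subst (asm) sum.swap) (simp add: lp_def sum_distrib_right)
          moreover have "(moved ?g *\<^sub>v x) $ m = (\<Sum>j<d. ?\<phi> (h m * one_param n e * (h i * k j)) * x $ j)"
            if m: "m < d" for m
          proof -
            have "h m * ?g * k j = h m * one_param n e * (h i * k j)" if "j < d" for j
              using GL_carrier[OF h_GL[OF m]] GL_carrier[OF tG] GL_carrier[OF h_GL[OF i]] GL_carrier[OF k_GL[OF that]]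
              by (simp add: assoc_mult_mat[of _ n n _ n _ n] mult_carrier_mat[of _ n n _ n])
            then show ?thesis
              using m xc by (auto simp: moved_def scalar_prod_def lessThan_atLeast0 intro!: sum.cong)
          qed
          ultimately have "(\<Sum>m<d. lp m * (\<Sum>j<d. ?\<phi> (h m * one_param n e * (h i * k j)) * x $ j)) = 0" by simp
          moreover have "E e = (\<Sum>m<d. lp m * (\<Sum>j<d. ?\<phi> (h m * one_param n e * (h i * k j)) * x $ j)) / torus_weight n a b (one_param n e)"
            unfolding E_def by (simp add: sum_divide_distrib sum_distrib_left)
          ultimately show ?case by simp
        qed
        ultimately have "((\<lambda>_. 0) \<longlongrightarrow> (\<Sum>m<d. lp m * (\<Sum>j<d. (?\<phi> (h m) * ?\<phi> (h i * k j)) * x $ j))) (at (0::complex))"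
          by (rule Lim_transform_eventually)
        then have "(\<Sum>m<d. lp m * (\<Sum>j<d. (?\<phi> (h m) * ?\<phi> (h i * k j)) * x $ j)) = 0"
          by (intro tendsto_unique[OF _ _ tendsto_const]) auto
        moreover have "(\<Sum>m<d. lp m * (\<Sum>j<d. (?\<phi> (h m) * ?\<phi> (h i * k j)) * x $ j)) =
            (\<Sum>m<d. lp m * ?\<phi> (h m)) * (\<Sum>j<d. ?\<phi> (h i * k j) * x $ j)"
          by (simp add: sum_product) (simp add: sum_distrib_left mult_ac)
        moreover have "(\<Sum>m<d. lp m * ?\<phi> (h m)) = l \<bullet> cyclic_vector"
        proof -
          have "l \<bullet> cyclic_vector = (\<Sum>m'<d. \<Sum>m<d. l $ m' * \<Psi> $$ (m', m) * col_values (1\<^sub>m n) $ m)"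
            unfolding cyclic_vector_def using l(1) by (intro scalar_prod_mult_vec) auto
          also have "\<dots> = (\<Sum>m<d. lp m * ?\<phi> (h m))"
            by (subst sum.swap) (simp add: lp_def sum_distrib_right col_values_def right_mult_one_mat[OF GL_carrier[OF h_GL]])
          finally show ?thesis by simp
        qed
        ultimately have "(\<Sum>j<d. ?\<phi> (h i * k j) * x $ j) = 0" using l(3) by simp
        then show ?thesis
          using i xc by (simp add: sample_matrix_def scalar_prod_def lessThan_atLeast0)
      qed
      then have "sample_matrix ?\<phi> h k d *\<^sub>v x = 0\<^sub>v d"
        by (intro eq_vecI) (auto simp: sample_matrix_def)
      then show ?thesis
        using det_0_iff_vec_prod_zero_field[OF sample_matrix_carrier[of ?\<phi> h k d]] hk(2) xc by blast
    qed
    then show ?thesis using subspaceD(2)[OF sub] by blast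
  qed
  then have "irreducible_rep n rep"
    using \<open>d \<ge> 1\<close> by (simp add: irreducible_rep_def)
  then show ?thesis using rat hw by (auto simp: is_irrep_with_highest_weight_def)
qed

lemma F_irrep:
  "n \<ge> 2 \<Longrightarrow> is_irrep_with_highest_weight n (hook_weight n a b) (F n (hook_weight n a b))"
  unfolding F_def by (rule someI_ex[OF irrep_exists])

section \<open>Spans of functions\<close>

text \<open>The linear span of \<open>B\<close>, where functions are compared on \<open>X\<close> only. The inductive form lets properties
that are closed under linear combinations be proved by rule induction.\<close>

inductive_set fspan :: "'x set \<Rightarrow> ('x \<Rightarrow> complex) set \<Rightarrow> ('x \<Rightarrow> complex) set"
  for X :: "'x set" and B :: "('x \<Rightarrow> complex) set" where
  zero: "\<forall>x\<in>X. f x = 0 \<Longrightarrow> f \<in> fspan X B"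
| step: "h \<in> fspan X B \<Longrightarrow> m \<in> B \<Longrightarrow> \<forall>x\<in>X. f x = h x + c * m x \<Longrightarrow> f \<in> fspan X B"

lemma fspan_cong: "h \<in> fspan X B \<Longrightarrow> (\<And>x. x \<in> X \<Longrightarrow> f x = h x) \<Longrightarrow> f \<in> fspan X B"
proof (induction arbitrary: f rule: fspan.induct)
  case (step h m f' c)
  then show ?case by (intro fspan.step[of h X B m f c]) auto
qed (auto intro: fspan.zero)

lemma fspan_add_scaled:
  assumes "f \<in> fspan X B" "h \<in> fspan X B"
  shows "(\<lambda>x. f x + c * h x) \<in> fspan X B"
  using assms(2)
proof induction
  case (zero h)
  then show ?case using fspan_cong[OF assms(1)] by auto
next
  case (step h' m h e)
  then show ?case by (intro fspan.step[OF step.IH step.hyps(2), of _ "c * e"]) (auto simp: algebra_simps)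
qed

lemma fspan_zero [intro, simp]: "(\<lambda>_. 0) \<in> fspan X B"
  by (rule fspan.zero) simp

lemma fspan_base: "m \<in> B \<Longrightarrow> m \<in> fspan X B"
  by (rule fspan.step[of "\<lambda>_. 0" X B m _ 1]) auto

lemma fspan_scaled: "f \<in> fspan X B \<Longrightarrow> (\<lambda>x. c * f x) \<in> fspan X B"
  using fspan_add_scaled[of "\<lambda>_. 0" X B f c] by simp

lemma fspan_add: "f \<in> fspan X B \<Longrightarrow> h \<in> fspan X B \<Longrightarrow> (\<lambda>x. f x + h x) \<in> fspan X B"
  using fspan_add_scaled[of f X B h 1] by simp

lemma fspan_sum: "(\<And>i. i \<in> I \<Longrightarrow> f i \<in> fspan X B) \<Longrightarrow> (\<lambda>x. \<Sum>i\<in>I. f i x) \<in> fspan X B"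
  by (induction I rule: infinite_finite_induct) (auto intro: fspan_add)

lemma fspan_mult:
  assumes "f \<in> fspan X B" and "\<And>m. m \<in> B \<Longrightarrow> (\<lambda>x. u x * m x) \<in> fspan X B'"
  shows "(\<lambda>x. u x * f x) \<in> fspan X B'"
  using assms(1)
proof induction
  case (zero f)
  then show ?case by (intro fspan.zero) auto
next
  case (step h m f c)
  have "(\<lambda>x. u x * h x + c * (u x * m x)) \<in> fspan X B'"
    using step.IH assms(2)[OF step.hyps(2)] by (rule fspan_add_scaled)
  then show ?case by (rule fspan_cong) (use step.hyps(3) in \<open>auto simp: algebra_simps\<close>)
qed

lemma fspan_explicit:
  assumes "f \<in> fspan X (m ` I)"
  shows "\<exists>S c. finite S \<and> S \<subseteq> I \<and> (\<forall>x\<in>X. f x = (\<Sum>k\<in>S. c k * m k x))"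
  using assms
proof induction
  case (zero f)
  then show ?case by (intro exI[of _ "{}"]) auto
next
  case (step h m' f e)
  then obtain S c k where S: "finite S" "S \<subseteq> I" "\<forall>x\<in>X. h x = (\<Sum>k\<in>S. c k * m k x)"
    and k: "k \<in> I" "m' = m k" by blast
  define c' where "c' = (\<lambda>j. (if j \<in> S then c j else 0) + (if j = k then e else 0))"
  have "f x = (\<Sum>j\<in>insert k S. c' j * m j x)" if x: "x \<in> X" for x
  proof -
    have "(\<Sum>j\<in>insert k S. c' j * m j x) = (\<Sum>j\<in>insert k S. (if j \<in> S then c j * m j x else 0)) +
        (\<Sum>j\<in>insert k S. (if j = k then e * m j x else 0))"
      unfolding c'_def sum.distrib[symmetric] by (intro sum.cong) (auto simp: algebra_simps)
    also have "(\<Sum>j\<in>insert k S. (if j \<in> S then c j * m j x else 0)) = (\<Sum>j\<in>S. c j * m j x)"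
      using S(1) by (intro sum.mono_neutral_cong_right) auto
    finally show ?thesis using S step.hyps(3) k x by simp
  qed
  then show ?case using S k by (intro exI[of _ "insert k S"] exI[of _ c']) auto
qed

section \<open>Matrix coefficients as monomials on the cone\<close>

text \<open>A multiset of coordinates encodes a monomial in \<open>n\<close> variables.\<close>

definition indices :: "nat \<Rightarrow> nat \<Rightarrow> nat multiset set" where
  "indices n a = {A. set_mset A \<subseteq> {..<n} \<and> size A = a}"

definition monomial :: "nat \<Rightarrow> nat multiset \<Rightarrow> nat multiset \<Rightarrow> complex mat \<Rightarrow> complex" where
  "monomial n A B g = (\<Prod>k\<in>#A. g $$ (0, k)) * (\<Prod>k\<in>#B. gl_inv g $$ (k, n - 1))"

definition monomials :: "nat \<Rightarrow> nat \<Rightarrow> nat \<Rightarrow> (complex mat \<Rightarrow> complex) set" where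
  "monomials n a b = (\<lambda>(A, B). monomial n A B) ` (indices n a \<times> indices n b)"

lemma indices_add: "A \<in> indices n a \<Longrightarrow> k < n \<Longrightarrow> add_mset k A \<in> indices n (Suc a)"
  by (auto simp: indices_def)

lemma linear_forms_in_span:
  "(\<lambda>g. (\<Sum>k<n. c k * g $$ (0, k)) ^ a * (\<Sum>k<n. e k * gl_inv g $$ (k, n - 1)) ^ b) \<in> fspan X (monomials n a b)"
proof (induction a)
  case 0
  show ?case
  proof (induction b)
    case 0
    have "monomial n {#} {#} \<in> monomials n 0 0"
      unfolding monomials_def by (rule image_eqI[of _ _ "({#}, {#})"]) (auto simp: indices_def)
    then have "monomial n {#} {#} \<in> fspan X (monomials n 0 0)" by (rule fspan_base)
    then show ?case by (rule fspan_cong) (simp add: monomial_def)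
  next
    case (Suc b)
    let ?f = "\<lambda>g. (\<Sum>k<n. c k * g $$ (0, k)) ^ 0 * (\<Sum>k<n. e k * gl_inv g $$ (k, n - 1)) ^ b"
    have "(\<lambda>g. gl_inv g $$ (k, n - 1) * ?f g) \<in> fspan X (monomials n 0 (Suc b))" if k: "k < n" for k
    proof (rule fspan_mult[OF Suc.IH])
      fix m assume "m \<in> monomials n 0 b"
      then obtain A B where AB: "A \<in> indices n 0" "B \<in> indices n b" "m = monomial n A B"
        by (auto simp: monomials_def)
      then have "monomial n A (add_mset k B) \<in> monomials n 0 (Suc b)"
        using k by (auto simp: monomials_def indices_add)
      then show "(\<lambda>x. gl_inv x $$ (k, n - 1) * m x) \<in> fspan X (monomials n 0 (Suc b))"
        by (rule fspan_cong[OF fspan_base]) (simp add: AB monomial_def)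
    qed
    then have "(\<lambda>g. \<Sum>k<n. e k * (gl_inv g $$ (k, n - 1) * ?f g)) \<in> fspan X (monomials n 0 (Suc b))"
      by (intro fspan_sum fspan_scaled) auto
    then show ?case by (rule fspan_cong) (simp add: sum_distrib_left sum_distrib_right mult_ac)
  qed
next
  case (Suc a)
  let ?f = "\<lambda>g. (\<Sum>k<n. c k * g $$ (0, k)) ^ a * (\<Sum>k<n. e k * gl_inv g $$ (k, n - 1)) ^ b"
  have "(\<lambda>g. g $$ (0, k) * ?f g) \<in> fspan X (monomials n (Suc a) b)" if k: "k < n" for k
  proof (rule fspan_mult[OF Suc.IH])
    fix m assume "m \<in> monomials n a b"
    then obtain A B where AB: "A \<in> indices n a" "B \<in> indices n b" "m = monomial n A B"
      by (auto simp: monomials_def)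
    then have "monomial n (add_mset k A) B \<in> monomials n (Suc a) b"
      using k by (auto simp: monomials_def indices_add)
    then show "(\<lambda>x. x $$ (0, k) * m x) \<in> fspan X (monomials n (Suc a) b)"
      by (rule fspan_cong[OF fspan_base]) (simp add: AB monomial_def)
  qed
  then have "(\<lambda>g. \<Sum>k<n. c k * (g $$ (0, k) * ?f g)) \<in> fspan X (monomials n (Suc a) b)"
    by (intro fspan_sum fspan_scaled) auto
  then show ?case by (rule fspan_cong) (simp add: sum_distrib_left sum_distrib_right mult_ac)
qed

text \<open>For \<open>x = h v\<close> the coefficient is the highest weight function at \<open>g * h\<close>, a power of a linear form in \<open>p(g)\<close> times a power of a
linear form in \<open>q(g)\<close>. The orbit spans, and a functional vanishing on all vectors with the
claimed property vanishes on the orbit, so it is zero.\<close>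

lemma coefficients_in_span:
  assumes n: "n \<ge> 1" and R: "rational_rep n R" "irreducible_rep n R"
    and v: "v \<in> carrier_vec (deg R)" "v \<noteq> 0\<^sub>v (deg R)"
    and f: "f \<in> carrier_vec (deg R)"
      "\<And>g. g \<in> carrier (GL n) \<Longrightarrow> f \<bullet> (act R g *\<^sub>v v) = highest_weight_function n a b g"
    and x: "x \<in> carrier_vec (deg R)"
  shows "(\<lambda>g. f \<bullet> (act R g *\<^sub>v x)) \<in> fspan (carrier (GL n)) (monomials n a b)"
proof (rule ccontr)
  let ?d = "deg R" and ?S = "fspan (carrier (GL n)) (monomials n a b)"
  assume not: "(\<lambda>g. f \<bullet> (act R g *\<^sub>v x)) \<notin> ?S"
  note RC = GL_carrier[OF rep_GL[OF R(1)]]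
  define W where "W = {x \<in> carrier_vec ?d. (\<lambda>g. f \<bullet> (act R g *\<^sub>v x)) \<in> ?S}"
  have "subspace class_ring W (module_vec TYPE(complex) ?d)"
  proof (rule subspaceI)
    show "0\<^sub>v ?d \<in> W" using f(1) RC by (auto simp: W_def mult_zero_vec[of _ ?d ?d] intro!: fspan.zero)
    show "y + z \<in> W" if yz: "y \<in> W" "z \<in> W" for y z
    proof -
      have "(\<lambda>g. f \<bullet> (act R g *\<^sub>v y) + f \<bullet> (act R g *\<^sub>v z)) \<in> ?S"
        using yz by (auto simp: W_def intro: fspan_add)
      then have "(\<lambda>g. f \<bullet> (act R g *\<^sub>v (y + z))) \<in> ?S"
        by (rule fspan_cong)
          (use yz f(1) RC mult_mat_vec_carrier[OF RC] in \<open>auto simp: W_def mult_add_distrib_mat_vec[of _ ?d ?d] scalar_prod_add_distrib[of _ ?d]\<close>)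
      then show ?thesis using yz by (auto simp: W_def)
    qed
    show "c \<cdot>\<^sub>v y \<in> W" if y: "y \<in> W" for c y
    proof -
      have "(\<lambda>g. c * (f \<bullet> (act R g *\<^sub>v y))) \<in> ?S"
        using y by (auto simp: W_def intro: fspan_scaled)
      then have "(\<lambda>g. f \<bullet> (act R g *\<^sub>v (c \<cdot>\<^sub>v y))) \<in> ?S"
        by (rule fspan_cong)
          (use y f(1) RC mult_mat_vec_carrier[OF RC] in \<open>auto simp: W_def mult_mat_vec[of _ ?d ?d]\<close>)
      then show ?thesis using y by (auto simp: W_def)
    qed
  qed (auto simp: W_def)
  moreover have "x \<notin> W" using not by (simp add: W_def)
  ultimately obtain l where l: "l \<in> carrier_vec ?d" "\<forall>w\<in>W. l \<bullet> w = 0" "l \<bullet> x \<noteq> 0"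
    using separating_functional[of W ?d x] x by blast
  have "act R h *\<^sub>v v \<in> W" if h: "h \<in> carrier (GL n)" for h
  proof -
    have "(\<lambda>g. (\<Sum>k<n. h $$ (k, 0) * g $$ (0, k)) ^ a *
        (\<Sum>k<n. gl_inv h $$ (n - 1, k) * gl_inv g $$ (k, n - 1)) ^ b) \<in> ?S"
      by (rule linear_forms_in_span)
    then have "(\<lambda>g. f \<bullet> (act R g *\<^sub>v (act R h *\<^sub>v v))) \<in> ?S"
    proof (rule fspan_cong)
      fix g assume g: "g \<in> carrier (GL n)"
      note C = GL_carrier[OF g] GL_carrier[OF h] GL_carrier[OF gl_inv_GL[OF g]] GL_carrier[OF gl_inv_GL[OF h]]
      have "f \<bullet> (act R g *\<^sub>v (act R h *\<^sub>v v)) = f \<bullet> (act R (g * h) *\<^sub>v v)"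
        using RC[OF g] RC[OF h] v(1) by (simp add: rep_mult[OF R(1) g h])
      also have "\<dots> = highest_weight_function n a b (g * h)" by (rule f(2)) (use g h in auto)
      also have "\<dots> = (\<Sum>k<n. h $$ (k, 0) * g $$ (0, k)) ^ a *
        (\<Sum>k<n. gl_inv h $$ (n - 1, k) * gl_inv g $$ (k, n - 1)) ^ b"
        using n C by (simp add: highest_weight_function_def gl_inv_mult[OF g h]
          mat_mult_entry[of _ n n _ n] mult.commute del: index_mult_mat(1))
      finally show "f \<bullet> (act R g *\<^sub>v (act R h *\<^sub>v v)) = (\<Sum>k<n. h $$ (k, 0) * g $$ (0, k)) ^ a *
        (\<Sum>k<n. gl_inv h $$ (n - 1, k) * gl_inv g $$ (k, n - 1)) ^ b" .
    qed
    then show ?thesis using RC[OF h] v(1) by (auto simp: W_def)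
  qed
  then have "l = 0\<^sub>v ?d" using l by (intro irreducible_cyclic[OF R v]) auto
  then show False using l(3) x by simp
qed

section \<open>Every monomial is a matrix coefficient\<close>

text \<open>A linear set of functions that contains all values of a polynomial family contains its coefficients:
replacing \<open>t\<close> by \<open>2 * t\<close> and subtracting a multiple of the original removes the leading coefficient and rescales
the others by nonzero factors.\<close>

lemma polynomial_coefficients_in_subspace:
  fixes \<chi> :: "nat \<Rightarrow> 'x \<Rightarrow> complex"
  assumes lin: "\<And>f h c. f \<in> P \<Longrightarrow> h \<in> P \<Longrightarrow> (\<lambda>x. f x + c * h x) \<in> P" and zero: "(\<lambda>_. 0) \<in> P"
    and poly: "\<And>t. (\<lambda>x. \<Sum>k\<le>m. t ^ k * \<chi> k x) \<in> P"
    and k: "k \<le> m"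
  shows "\<chi> k \<in> P"
  using poly k
proof (induction m arbitrary: \<chi> k)
  case 0
  then show ?case using "0.prems"(1)[of 1] by simp
next
  case (Suc m)
  have scaled: "(\<lambda>x. c * f x) \<in> P" if "f \<in> P" for c f
    using lin[OF zero that, of c] by simp
  have low: "\<chi> j \<in> P" if j: "j \<le> m" for j
  proof -
    have "(\<lambda>x. (2 ^ j - 2 ^ Suc m) * \<chi> j x) \<in> P"
    proof (rule Suc.IH[OF _ j])
      fix t :: complex
      have "(\<lambda>x. (\<Sum>k\<le>Suc m. (2 * t) ^ k * \<chi> k x) + (- (2 ^ Suc m)) * (\<Sum>k\<le>Suc m. t ^ k * \<chi> k x)) \<in> P"
        by (intro lin Suc.prems(1))
      also have "(\<lambda>x. (\<Sum>k\<le>Suc m. (2 * t) ^ k * \<chi> k x) + (- (2 ^ Suc m)) * (\<Sum>k\<le>Suc m. t ^ k * \<chi> k x)) =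
          (\<lambda>x. \<Sum>k\<le>m. t ^ k * ((2 ^ k - 2 ^ Suc m) * \<chi> k x))"
      proof
        fix x
        have "(\<Sum>k\<le>Suc m. (2 * t) ^ k * \<chi> k x) + (- (2 ^ Suc m)) * (\<Sum>k\<le>Suc m. t ^ k * \<chi> k x)
            = (\<Sum>k\<le>Suc m. t ^ k * ((2 ^ k - 2 ^ Suc m) * \<chi> k x))"
          unfolding sum_distrib_left sum.distrib[symmetric]
          by (intro sum.cong) (auto simp: power_mult_distrib algebra_simps)
        then show "(\<Sum>k\<le>Suc m. (2 * t) ^ k * \<chi> k x) + (- (2 ^ Suc m)) * (\<Sum>k\<le>Suc m. t ^ k * \<chi> k x)
            = (\<Sum>k\<le>m. t ^ k * ((2 ^ k - 2 ^ Suc m) * \<chi> k x))" by simp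
      qed
      finally show "(\<lambda>x. \<Sum>k\<le>m. t ^ k * ((2 ^ k - 2 ^ Suc m) * \<chi> k x)) \<in> P" .
    qed
    from scaled[OF this, of "inverse (2 ^ j - 2 ^ Suc m)"]
    have "(\<lambda>x. inverse (2 ^ j - 2 ^ Suc m) * ((2 ^ j - 2 ^ Suc m) * \<chi> j x)) \<in> P" .
    moreover have "(2::complex) ^ j - 2 ^ Suc m \<noteq> 0"
    proof -
      have "(2::nat) ^ j < 2 ^ Suc m" using j by (intro power_strict_increasing) auto
      then have "of_nat (2 ^ j) \<noteq> (of_nat (2 ^ Suc m) :: complex)" by (metis of_nat_eq_iff less_irrefl)
      then show ?thesis by simp
    qed
    ultimately show ?thesis by (simp add: mult.assoc[symmetric] del: power_Suc)
  qed
  show ?case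
  proof (cases "k \<le> m")
    case True
    then show ?thesis by (rule low)
  next
    case False
    with Suc.prems(2) have k: "k = Suc m" by simp
    have sum_low: "(\<lambda>x. \<Sum>j\<in>J. \<chi> j x) \<in> P" if "finite J" "J \<subseteq> {..m}" for J
      using that
    proof (induction J)
      case (insert j J)
      then show ?case using lin[of "\<lambda>x. \<Sum>j\<in>J. \<chi> j x" "\<chi> j" 1] low by (simp add: add.commute)
    qed (use zero in simp)
    have "(\<lambda>x. (\<Sum>j\<le>Suc m. 1 ^ j * \<chi> j x) + (-1) * (\<Sum>j\<le>m. \<chi> j x)) \<in> P"
      by (intro lin Suc.prems(1) sum_low) auto
    then show ?thesis by (simp add: k)
  qed
qed

definition transvection :: "nat \<Rightarrow> nat \<Rightarrow> nat \<Rightarrow> complex \<Rightarrow> complex mat" where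
  "transvection n i j t = mat n n (\<lambda>(k, l). if k = l then 1 else if k = i \<and> l = j then t else 0)"

lemma transvection_carrier: "transvection n i j t \<in> carrier_mat n n"
  by (simp add: transvection_def)

lemma mult_transvection:
  assumes "A \<in> carrier_mat m n" "i \<noteq> j" "i < n" "r < m" "k < n"
  shows "(A * transvection n i j t) $$ (r, k) = A $$ (r, k) + (if k = j then t * A $$ (r, i) else 0)"
proof -
  have "(A * transvection n i j t) $$ (r, k) =
     (\<Sum>l<n. (if l = k then A $$ (r, l) else 0) + (if l = i then (if k = j then t * A $$ (r, l) else 0) else 0))"
    unfolding mat_mult_entry[OF assms(1) transvection_carrier assms(4,5)]
    using assms by (intro sum.cong) (auto simp: transvection_def)
  then show ?thesis using assms by (simp add: sum.distrib)
qed

lemma transvection_mult: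
  assumes "A \<in> carrier_mat n m" "i \<noteq> j" "j < n" "k < n" "r < m"
  shows "(transvection n i j t * A) $$ (k, r) = A $$ (k, r) + (if k = i then t * A $$ (j, r) else 0)"
proof -
  have "(transvection n i j t * A) $$ (k, r) =
     (\<Sum>l<n. (if l = k then A $$ (l, r) else 0) + (if l = j then (if k = i then t * A $$ (l, r) else 0) else 0))"
    unfolding mat_mult_entry[OF transvection_carrier assms(1,4,5)]
    using assms by (intro sum.cong) (auto simp: transvection_def)
  then show ?thesis using assms by (simp add: sum.distrib)
qed

lemma transvection_GL:
  assumes "i \<noteq> j" "i < n" "j < n"
  shows "transvection n i j t \<in> carrier (GL n)" "gl_inv (transvection n i j t) = transvection n i j (- t)"
proof -
  have c: "transvection n i j t \<in> carrier_mat n n" for t by (simp add: transvection_def)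
  have "transvection n i j t * transvection n i j (- t) = 1\<^sub>m n"
  proof (rule eq_matI)
    fix k l assume "k < dim_row (1\<^sub>m n)" "l < dim_col (1\<^sub>m n)"
    then have kl: "k < n" "l < n" by auto
    show "(transvection n i j t * transvection n i j (- t)) $$ (k, l) = 1\<^sub>m n $$ (k, l)"
      unfolding mult_transvection[OF c assms(1,2) kl]
      using assms kl by (auto simp: transvection_def)
  qed (auto simp: transvection_def)
  from GL_of_inverse[OF c c this]
  show "transvection n i j t \<in> carrier (GL n)" "gl_inv (transvection n i j t) = transvection n i j (- t)" by auto
qed

text \<open>The monomial of \<open>A\<close> after the substitution of \<open>x\<^sub>j + t * y\<close> for \<open>x\<^sub>j\<close>, as a polynomial in \<open>t\<close>.\<close>

definition perturbed_product :: "(nat \<Rightarrow> complex) \<Rightarrow> complex \<Rightarrow> nat \<Rightarrow> nat multiset \<Rightarrow> complex poly" where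
  "perturbed_product x y j A = (\<Prod>k\<in>#A. [:x k, if k = j then y else 0:])"

lemma coeff_perturbed_product:
  shows "coeff (perturbed_product x y j A) 0 = (\<Prod>k\<in>#A. x k)"
    and "coeff (perturbed_product x y j A) 1 = of_nat (count A j) * y * (\<Prod>k\<in>#A - {#j#}. x k)"
    and "degree (perturbed_product x y j A) \<le> size A"
proof -
  define Q where "Q = perturbed_product x y j"
  note Q_def = Q_def perturbed_product_def
  have c0: "coeff (Q A) 0 = (\<Prod>k\<in>#A. x k)" for A
    by (induction A) (auto simp: Q_def coeff_mult)
  then show "coeff (perturbed_product x y j A) 0 = (\<Prod>k\<in>#A. x k)" by (simp add: Q_def)
  have "coeff (Q A) 1 = of_nat (count A j) * y * (\<Prod>k\<in>#A - {#j#}. x k)"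
  proof (induction A)
    case empty
    show ?case by (simp add: Q_def)
  next
    case (add k A)
    have "coeff (Q (add_mset k A)) 1 = x k * coeff (Q A) 1 + (if k = j then y else 0) * coeff (Q A) 0"
      by (simp add: Q_def)
    also have "\<dots> = of_nat (count (add_mset k A) j) * y * (\<Prod>k\<in>#add_mset k A - {#j#}. x k)"
    proof (cases "k = j")
      case True
      show ?thesis
      proof (cases "j \<in># A")
        case jA: True
        define p r where "p = (\<Prod>k\<in>#A. x k)" and "r = (\<Prod>k\<in>#A - {#j#}. x k)"
        have "p = x j * r"
          unfolding p_def r_def using jA by (metis image_mset_add_mset insert_DiffM prod_mset.add_mset)
        then have "x j * (of_nat (count A j) * y * r) + y * p = of_nat (Suc (count A j)) * y * p"
          by (simp add: algebra_simps)
        then show ?thesis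
          unfolding True add.IH c0 p_def r_def
          by (simp only: count_add_mset if_True simp_thms add_mset_remove_trivial)
      next
        case False
        then have cnt: "count A j = 0" by (simp add: not_in_iff)
        have IH0: "coeff (Q A) 1 = 0" unfolding add.IH cnt by simp
        show ?thesis
          unfolding True IH0 c0 by (simp only: cnt count_add_mset if_True simp_thms add_mset_remove_trivial) simp
      qed
    next
      case False
      then show ?thesis
      proof (cases "j \<in># A")
        case True
        then have "add_mset k A - {#j#} = add_mset k (A - {#j#})" using diff_union_swap[of j k A] False by metis
        then show ?thesis unfolding add.IH using False by simp
      next
        case nj: False
        then have cnt: "count A j = 0" by (simp add: not_in_iff)
        have IH0: "coeff (Q A) 1 = 0" unfolding add.IH cnt by simp
        show ?thesis unfolding IH0 using False cnt by simp
      qed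
    qed
    finally show ?case .
  qed
  then show "coeff (perturbed_product x y j A) 1 = of_nat (count A j) * y * (\<Prod>k\<in>#A - {#j#}. x k)"
    by (simp add: Q_def)
  have "degree (Q A) \<le> size A"
  proof (induction A)
    case (add k A)
    have "Q (add_mset k A) = [:x k, if k = j then y else 0:] * Q A"
      unfolding Q_def by (simp only: image_mset_add_mset prod_mset.add_mset)
    then have "degree (Q (add_mset k A)) \<le> degree [:x k, if k = j then y else 0:] + degree (Q A)"
      by (simp only: degree_mult_le)
    also have "\<dots> \<le> 1 + size A" using add.IH by (intro add_mono) (auto intro: degree_pCons_le)
    finally show ?case by simp
  qed (simp add: Q_def)
  then show "degree (perturbed_product x y j A) \<le> size A" by (simp add: Q_def)
qed

text \<open>Right translation by a transvection replaces \<open>p\<^sub>j\<close> by \<open>p\<^sub>j + t * p\<^sub>i\<close> and \<open>q\<^sub>i\<close> by \<open>q\<^sub>i - t * q\<^sub>j\<close>. The coefficient of \<open>t\<close> is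
the derivation \<open>p\<^sub>i \<partial>/\<partial>p\<^sub>j - q\<^sub>j \<partial>/\<partial>q\<^sub>i\<close> applied to the monomial.\<close>

lemma lie_derivative_in_subspace:
  fixes P :: "(complex mat \<Rightarrow> complex) set"
  assumes lin: "\<And>f h c. f \<in> P \<Longrightarrow> h \<in> P \<Longrightarrow> (\<lambda>x. f x + c * h x) \<in> P"
    and cong: "\<And>f h. f \<in> P \<Longrightarrow> (\<And>g. g \<in> carrier (GL n) \<Longrightarrow> h g = f g) \<Longrightarrow> h \<in> P"
    and translate: "\<And>f y. f \<in> P \<Longrightarrow> y \<in> carrier (GL n) \<Longrightarrow> (\<lambda>g. f (g * y)) \<in> P"
    and AB: "set_mset A \<subseteq> {..<n}" "set_mset B \<subseteq> {..<n}" "monomial n A B \<in> P"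
    and ij: "i \<noteq> j" "i < n" "j < n"
  shows "(\<lambda>g. of_nat (count A j) * monomial n (add_mset i (A - {#j#})) B g
      - of_nat (count B i) * monomial n A (add_mset j (B - {#i#})) g) \<in> P"
proof -
  define Q1 where "Q1 = (\<lambda>g::complex mat. perturbed_product (\<lambda>k. g $$ (0, k)) (g $$ (0, i)) j A)"
  define Q2 where "Q2 = (\<lambda>g. perturbed_product (\<lambda>k. gl_inv g $$ (k, n - 1)) (- gl_inv g $$ (j, n - 1)) i B)"
  define Q where "Q = (\<lambda>g. Q1 g * Q2 g)"
  have cQ1: "coeff (Q1 g) 0 = (\<Prod>k\<in>#A. g $$ (0, k))"
      "coeff (Q1 g) 1 = of_nat (count A j) * g $$ (0, i) * (\<Prod>k\<in>#A - {#j#}. g $$ (0, k))"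
      "degree (Q1 g) \<le> size A" for g
    unfolding Q1_def by (rule coeff_perturbed_product)+
  have cQ2: "coeff (Q2 g) 0 = (\<Prod>k\<in>#B. gl_inv g $$ (k, n - 1))"
      "coeff (Q2 g) 1 = of_nat (count B i) * (- gl_inv g $$ (j, n - 1)) * (\<Prod>k\<in>#B - {#i#}. gl_inv g $$ (k, n - 1))"
      "degree (Q2 g) \<le> size B" for g
    unfolding Q2_def by (rule coeff_perturbed_product)+
  let ?m = "size A + size B + 1"
  have degQ: "degree (Q g) < Suc ?m" for g
    using degree_mult_le[of "Q1 g" "Q2 g"] cQ1(3)[of g] cQ2(3)[of g] unfolding Q_def by linarith
  have val: "(\<Sum>k\<le>?m. t ^ k * coeff (Q g) k) = monomial n A B (g * transvection n i j t)"
    if g: "g \<in> carrier (GL n)" for g t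
  proof -
    have "(\<Sum>k\<le>?m. t ^ k * coeff (Q g) k) = poly (Q g) t"
      unfolding poly_altdef using degQ[of g]
      by (intro sum.mono_neutral_cong_right) (auto simp: mult.commute coeff_eq_0)
    also have "\<dots> = monomial n A B (g * transvection n i j t)"
    proof -
      note tr = transvection_GL[OF ij, of t]
      have n: "0 < n" using ij by simp
      have "(g * transvection n i j t) $$ (0, k) = g $$ (0, k) + t * (if k = j then g $$ (0, i) else 0)"
        if "k \<in># A" for k
        using mult_transvection[OF GL_carrier[OF g] ij(1,2) n, of k t] that AB(1) by auto
      moreover have "gl_inv (g * transvection n i j t) $$ (k, n - 1) =
          gl_inv g $$ (k, n - 1) + t * (if k = i then - gl_inv g $$ (j, n - 1) else 0)" if "k \<in># B" for k
        using transvection_mult[OF GL_carrier[OF gl_inv_GL[OF g]] ij(1,3), of k "n - 1" "- t"] that AB(2) n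
        by (auto simp: gl_inv_mult[OF g tr(1)] tr(2))
      ultimately show ?thesis
        unfolding Q_def Q1_def Q2_def perturbed_product_def monomial_def poly_mult poly_prod_mset image_mset.compositionality o_def
        by (intro arg_cong2[where f = "(*)"] arg_cong[where f = prod_mset] image_mset_cong) auto
    qed
    finally show ?thesis .
  qed
  have zero: "(\<lambda>_. 0) \<in> P"
    using lin[OF AB(3) AB(3), of "-1"] by simp
  have "(\<lambda>g. coeff (Q g) 1) \<in> P"
  proof (rule polynomial_coefficients_in_subspace[OF lin zero, where m = ?m and \<chi> = "\<lambda>k g. coeff (Q g) k"])
    show "(\<lambda>g. \<Sum>k\<le>?m. t ^ k * coeff (Q g) k) \<in> P" for t
      by (rule cong[OF translate[OF AB(3) transvection_GL(1)[OF ij, of t]]]) (rule val)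
  qed simp_all
  moreover have "coeff (Q g) 1 = of_nat (count A j) * monomial n (add_mset i (A - {#j#})) B g
      - of_nat (count B i) * monomial n A (add_mset j (B - {#i#})) g" for g
  proof -
    have "coeff (Q g) 1 = coeff (Q1 g) 0 * coeff (Q2 g) 1 + coeff (Q1 g) 1 * coeff (Q2 g) 0"
      unfolding Q_def coeff_mult by (simp add: numeral_2_eq_2)
    then show ?thesis unfolding cQ1 cQ2 by (simp add: monomial_def algebra_simps)
  qed
  ultimately show ?thesis by simp
qed

lemma contraction_zero:
  assumes n: "n \<ge> 2" and g: "g \<in> carrier (GL n)"
  shows "(\<Sum>k<n. g $$ (0, k) * gl_inv g $$ (k, n - 1)) = 0"
  using mat_mult_entry[OF GL_carrier[OF g] GL_carrier[OF gl_inv_GL[OF g]], of 0 "n - 1"] n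
  by (simp add: gl_inv_right[OF g] del: index_mult_mat)

text \<open>This replaces complete reducibility. The derivations lead from \<open>p\<^sub>0\<^sup>a * q\<^sub>n\<^sub>-\<^sub>1\<^sup>b\<close> to all monomials in three steps.
Monomials \<open>p\<^sub>0\<^sup>a * q\<^sup>B\<close> in which \<open>q\<^sub>0\<close> does not occur, and for \<open>a = 0\<close> all of them, are reached by turning factors \<open>q\<^sub>n\<^sub>-\<^sub>1\<close> into others.
Factors \<open>q\<^sub>0\<close> are then introduced one at a time: for a monomial \<open>m\<close> put \<open>X\<^sub>i = p\<^sub>i * q\<^sub>i * m\<close>. Deriving \<open>p\<^sub>0 * q\<^sub>i * m\<close>
shows that a positive multiple of \<open>X\<^sub>i\<close> minus a positive multiple of \<open>X\<^sub>0\<close> lies in \<open>P\<close>, and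
\<open>X\<^sub>0 + \<dots> + X\<^sub>n\<^sub>-\<^sub>1 = 0\<close>; adding up, a nonzero multiple of \<open>X\<^sub>0\<close> lies in \<open>P\<close>. Finally factors \<open>p\<^sub>0\<close> are turned
into arbitrary \<open>p\<^sub>i\<close>.\<close>

lemma all_monomials_in_subspace:
  fixes P :: "(complex mat \<Rightarrow> complex) set"
  assumes n: "n \<ge> 2"
    and lin: "\<And>f h c. f \<in> P \<Longrightarrow> h \<in> P \<Longrightarrow> (\<lambda>x. f x + c * h x) \<in> P"
    and cong: "\<And>f h. f \<in> P \<Longrightarrow> (\<And>g. g \<in> carrier (GL n) \<Longrightarrow> h g = f g) \<Longrightarrow> h \<in> P"
    and translate: "\<And>f y. f \<in> P \<Longrightarrow> y \<in> carrier (GL n) \<Longrightarrow> (\<lambda>g. f (g * y)) \<in> P"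
    and start: "highest_weight_function n a b \<in> P"
    and AB: "A \<in> indices n a" "B \<in> indices n b"
  shows "monomial n A B \<in> P"
proof -
  have zero: "(\<lambda>_. 0) \<in> P"
    using lin[OF start start, of "-1"] by simp
  have scaled: "(\<lambda>x. c * f x) \<in> P" if "f \<in> P" for c f
    using lin[OF zero that, of c] by simp
  have unscale: "f \<in> P" if "(\<lambda>x. c * f x) \<in> P" "c \<noteq> 0" for c f
    using scaled[OF that(1), of "inverse c"] that(2) by (simp add: mult.assoc[symmetric])
  note lie = lie_derivative_in_subspace[OF lin cong translate]
  define z where "z = replicate_mset a (0::nat)"
  have z: "set_mset z \<subseteq> {..<n}" using n by (auto simp: z_def)
  have base: "monomial n z (C + replicate_mset (b - size C) (n - 1)) \<in> P"
    if "size C \<le> b" "set_mset C \<subseteq> {..<n}" "a = 0 \<or> 0 \<notin># C" for C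
    using that
  proof (induction C)
    case empty
    have "highest_weight_function n a b = monomial n z ({#} + replicate_mset (b - size {#}) (n - 1))"
      by (auto simp: highest_weight_function_def monomial_def z_def)
    then show ?case using start by simp
  next
    case (add k C)
    let ?B = "C + replicate_mset (b - size C) (n - 1)"
    have IH: "monomial n z ?B \<in> P" using add by auto
    have rep: "replicate_mset (b - size C) (n - 1) = add_mset (n - 1) (replicate_mset (b - size (add_mset k C)) (n - 1))"
    proof -
      have "b - size C = Suc (b - size (add_mset k C))" using add.prems(1) by simp
      then show ?thesis by (metis replicate_mset_Suc)
    qed
    show ?case
    proof (cases "k = n - 1")
      case True
      then show ?thesis using IH unfolding rep by simp
    next
      case False
      have k: "k < n" using add.prems by auto
      have cz: "count z k = 0" using add.prems(3) by (auto simp: z_def)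
      have B: "set_mset ?B \<subseteq> {..<n}" using add.prems(2) n by (auto split: if_splits)
      have "(\<lambda>g. of_nat (count z k) * monomial n (add_mset (n - 1) (z - {#k#})) ?B g
          - of_nat (count ?B (n - 1)) * monomial n z (add_mset k (?B - {#n - 1#})) g) \<in> P"
        using False k n by (intro lie z B IH) auto
      then have "(\<lambda>g. (- of_nat (count ?B (n - 1))) * monomial n z (add_mset k (?B - {#n - 1#})) g) \<in> P"
        unfolding cz by (simp only: of_nat_0 mult_zero_left diff_0 minus_mult_left)
      moreover have "count ?B (n - 1) \<noteq> 0" unfolding rep by simp
      then have "- of_nat (count ?B (n - 1)) \<noteq> (0 :: complex)"
        by (simp only: neg_equal_0_iff_equal of_nat_eq_0_iff not_False_eq_True)
      ultimately have "monomial n z (add_mset k (?B - {#n - 1#})) \<in> P"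
        by (rule unscale)
      then show ?thesis unfolding rep by simp
    qed
  qed
  have first_row: "monomial n z B \<in> P" if "B \<in> indices n b" for B
    using that
  proof (induction "count B 0" arbitrary: B)
    case 0
    then show ?case using base[of B] by (auto simp: indices_def not_in_iff)
  next
    case (Suc c)
    show ?case
    proof (cases "a = 0")
      case True
      then show ?thesis using base[of B] Suc.prems by (auto simp: indices_def)
    next
      case False
      define A' where "A' = replicate_mset (a - 1) (0::nat)"
      define B' where "B' = B - {#0#}"
      have "0 \<in># B" using Suc.hyps(2) by (metis count_inI nat.distinct(1))
      then have B: "B = add_mset 0 B'" by (simp add: B'_def)
      have zA: "z = add_mset 0 A'" using False by (cases a) (auto simp: z_def A'_def)
      have A': "set_mset A' \<subseteq> {..<n}" "count A' 0 = a - 1" using n by (auto simp: A'_def)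
      have B': "set_mset B' \<subseteq> {..<n}" using Suc.prems by (auto simp: B indices_def)
      define X where "X = (\<lambda>i. monomial n (add_mset i A') (add_mset i B'))"
      have rel: "(\<lambda>g. of_nat a * X i g - of_nat (Suc (count B' i)) * X 0 g) \<in> P" if i: "i < n" "i \<noteq> 0" for i
      proof -
        have "monomial n z (add_mset i B') \<in> P"
          using Suc.hyps(2) Suc.prems i by (intro Suc.hyps(1)) (auto simp: B indices_def)
        then have "(\<lambda>g. of_nat (count z 0) * monomial n (add_mset i (z - {#0#})) (add_mset i B') g
            - of_nat (count (add_mset i B') i) * monomial n z (add_mset 0 (add_mset i B' - {#i#})) g) \<in> P"
          using i n B' by (intro lie z) auto
        moreover have "count z 0 = a" by (simp add: z_def)
        moreover have "z - {#0#} = A'" by (simp add: zA)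
        moreover have "count (add_mset i B') i = Suc (count B' i)" by simp
        ultimately show ?thesis
          unfolding X_def zA[symmetric] by (simp only: add_mset_remove_trivial)
      qed
      define s where "s = a + (\<Sum>i\<in>{1..<n}. Suc (count B' i))"
      have fin: "(\<lambda>g. \<Sum>i\<in>J. (of_nat a * X i g - of_nat (Suc (count B' i)) * X 0 g)) \<in> P"
        if "finite J" "J \<subseteq> {1..<n}" for J
        using that
      proof (induction J)
        case (insert i J)
        then have "(\<lambda>g. of_nat a * X i g - of_nat (Suc (count B' i)) * X 0 g) \<in> P"
          by (intro rel) auto
        from lin[OF this insert.IH, of 1] insert show ?case by simp
      qed (simp add: zero)
      \<comment> \<open>the relations for all \<open>i \<noteq> 0\<close> added up, with \<open>X\<^sub>1 + \<dots> + X\<^sub>n\<^sub>-\<^sub>1 = - X\<^sub>0\<close>\<close>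
      have "(\<lambda>g. - of_nat s * X 0 g) \<in> P"
      proof (rule cong[OF fin])
        fix g assume g: "g \<in> carrier (GL n)"
        have "X i g = g $$ (0, i) * gl_inv g $$ (i, n - 1) * monomial n A' B' g" for i
          by (simp add: X_def monomial_def)
        then have "(\<Sum>i<n. X i g) = 0"
          using contraction_zero[OF n g] by (simp flip: sum_distrib_right)
        moreover have "{..<n} = insert 0 {1..<n}" using n by auto
        ultimately have sum_X: "(\<Sum>i\<in>{1..<n}. X i g) = - X 0 g"
          by (simp add: eq_neg_iff_add_eq_0 add.commute)
        have "(\<Sum>i\<in>{1..<n}. (of_nat a * X i g - of_nat (Suc (count B' i)) * X 0 g)) =
            of_nat a * (\<Sum>i\<in>{1..<n}. X i g) - (\<Sum>i\<in>{1..<n}. of_nat (Suc (count B' i))) * X 0 g"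
          by (simp only: sum_subtractf sum_distrib_left sum_distrib_right)
        also have "\<dots> = of_nat a * (- X 0 g) - (\<Sum>i\<in>{1..<n}. of_nat (Suc (count B' i))) * X 0 g"
          by (simp only: sum_X)
        also have "\<dots> = - of_nat s * X 0 g" by (simp add: s_def algebra_simps)
        finally show "- of_nat s * X 0 g = (\<Sum>i\<in>{1..<n}. (of_nat a * X i g - of_nat (Suc (count B' i)) * X 0 g))" by simp
      qed auto
      moreover have "s \<noteq> 0" using False by (simp add: s_def)
      then have "- of_nat s \<noteq> (0 :: complex)"
        by (simp only: neg_equal_0_iff_equal of_nat_eq_0_iff not_False_eq_True)
      ultimately have "X 0 \<in> P" by (rule unscale)
      then show ?thesis by (simp only: X_def zA B)
    qed
  qed
  have "\<forall>B\<in>indices n b. monomial n (C + replicate_mset (a - size C) 0) B \<in> P"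
    if "size C \<le> a" "set_mset C \<subseteq> {..<n}" for C
    using that
  proof (induction C)
    case empty
    then show ?case using first_row by (simp add: z_def)
  next
    case (add i C)
    let ?A = "C + replicate_mset (a - size C) 0"
    have IH: "\<forall>B\<in>indices n b. monomial n ?A B \<in> P" using add by auto
    have rep: "replicate_mset (a - size C) (0::nat) = add_mset 0 (replicate_mset (a - size (add_mset i C)) 0)"
    proof -
      have "a - size C = Suc (a - size (add_mset i C))" using add.prems(1) by simp
      then show ?thesis by (metis replicate_mset_Suc)
    qed
    show ?case
    proof (cases "i = 0")
      case True
      then show ?thesis using IH unfolding rep by simp
    next
      case False
      have i: "i < n" using add.prems by auto
      have A: "set_mset ?A \<subseteq> {..<n}" using add.prems(2) n by (auto split: if_splits)
      show ?thesis
      proof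
        fix B assume B: "B \<in> indices n b"
        have "(\<lambda>g. of_nat (count ?A 0) * monomial n (add_mset i (?A - {#0#})) B g
            - of_nat (count B i) * monomial n ?A (add_mset 0 (B - {#i#})) g) \<in> P" (is "?f \<in> P")
          using False i n B IH by (intro lie A) (auto simp: indices_def)
        moreover have "(\<lambda>g. of_nat (count B i) * monomial n ?A (add_mset 0 (B - {#i#})) g) \<in> P" (is "?h \<in> P")
        proof (cases "i \<in># B")
          case True
          then have "add_mset 0 (B - {#i#}) \<in> indices n b"
            using B n by (auto simp: indices_def size_Diff_singleton dest: in_diffD)
              (metis One_nat_def Suc_pred nonempty_has_size empty_iff set_mset_empty)
          then show ?thesis using IH by (intro scaled) auto
        next
          case False
          then have "count B i = 0" by (simp add: not_in_iff)
          then show ?thesis using zero by simp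
        qed
        ultimately have "(\<lambda>g. ?f g + 1 * ?h g) \<in> P" by (rule lin)
        then have "(\<lambda>g. of_nat (count ?A 0) * monomial n (add_mset i (?A - {#0#})) B g) \<in> P" by simp
        moreover have "count ?A 0 \<noteq> 0" unfolding rep by simp
        then have "of_nat (count ?A 0) \<noteq> (0 :: complex)"
          by (simp only: of_nat_eq_0_iff not_False_eq_True)
        ultimately have "monomial n (add_mset i (?A - {#0#})) B \<in> P"
          by (rule unscale)
        then show "monomial n (add_mset i C + replicate_mset (a - size (add_mset i C)) 0) B \<in> P"
          unfolding rep by simp
      qed
    qed
  qed
  from this[of A] AB show ?thesis by (auto simp: indices_def)
qed

lemma monomial_is_coefficient:
  assumes n: "n \<ge> 2" and R: "rational_rep n R"
    and v: "v \<in> carrier_vec (deg R)"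
    and f: "f \<in> carrier_vec (deg R)"
      "\<And>g. g \<in> carrier (GL n) \<Longrightarrow> f \<bullet> (act R g *\<^sub>v v) = highest_weight_function n a b g"
    and AB: "A \<in> indices n a" "B \<in> indices n b"
  shows "\<exists>x\<in>carrier_vec (deg R). \<forall>g\<in>carrier (GL n). monomial n A B g = f \<bullet> (act R g *\<^sub>v x)"
proof -
  let ?d = "deg R"
  note RC = GL_carrier[OF rep_GL[OF R]]
  define P where "P = {\<psi>. \<exists>x\<in>carrier_vec ?d. \<forall>g\<in>carrier (GL n). \<psi> g = f \<bullet> (act R g *\<^sub>v x)}"
  have "monomial n A B \<in> P"
  proof (rule all_monomials_in_subspace[OF n _ _ _ _ AB])
    show "(\<lambda>g. \<psi> g + c * \<chi> g) \<in> P" if \<psi>: "\<psi> \<in> P" and \<chi>: "\<chi> \<in> P" for \<psi> \<chi> c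
    proof -
      obtain x where x: "x \<in> carrier_vec ?d" "\<forall>g\<in>carrier (GL n). \<psi> g = f \<bullet> (act R g *\<^sub>v x)"
        using \<psi> by (auto simp: P_def)
      obtain y where y: "y \<in> carrier_vec ?d" "\<forall>g\<in>carrier (GL n). \<chi> g = f \<bullet> (act R g *\<^sub>v y)"
        using \<chi> by (auto simp: P_def)
      have "\<psi> g + c * \<chi> g = f \<bullet> (act R g *\<^sub>v (x + c \<cdot>\<^sub>v y))" if "g \<in> carrier (GL n)" for g
        using x y f(1) RC[OF that] mult_mat_vec_carrier[OF RC[OF that]] that
        by (simp add: mult_add_distrib_mat_vec[of _ ?d ?d] mult_mat_vec[of _ ?d ?d] scalar_prod_add_distrib[of _ ?d])
      then show ?thesis unfolding P_def using x y by (auto intro!: bexI[of _ "x + c \<cdot>\<^sub>v y"])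
    qed
    show "(\<lambda>g. \<psi> (g * y)) \<in> P" if \<psi>: "\<psi> \<in> P" and y: "y \<in> carrier (GL n)" for \<psi> y
    proof -
      obtain x where x: "x \<in> carrier_vec ?d" "\<forall>g\<in>carrier (GL n). \<psi> g = f \<bullet> (act R g *\<^sub>v x)"
        using \<psi> by (auto simp: P_def)
      have "\<psi> (g * y) = f \<bullet> (act R g *\<^sub>v (act R y *\<^sub>v x))" if g: "g \<in> carrier (GL n)" for g
        using x GL_mult[OF g y] RC[OF g] RC[OF y] by (simp add: rep_mult[OF R g y])
      then show ?thesis unfolding P_def using x RC[OF y] by (auto intro!: bexI[of _ "act R y *\<^sub>v x"])
    qed
    show "highest_weight_function n a b \<in> P" unfolding P_def using f v by (auto intro!: bexI[of _ v])
  qed (auto simp: P_def)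
  then show ?thesis by (simp add: P_def)
qed

text \<open>Everything about a representation that the computation of invariants uses: the functions \<open>\<xi>\<^sub>k\<close> are the
coordinates of the embedding \<open>x \<mapsto> (g \<mapsto> f (g x))\<close>. They transform by the matrices of the
representation, they are linearly independent, and they have the same span as the monomials of bidegree \<open>(a, b)\<close>.\<close>

definition coefficient_model ::
  "nat \<Rightarrow> nat \<Rightarrow> nat \<Rightarrow> mat_rep \<Rightarrow> (nat \<Rightarrow> complex mat \<Rightarrow> complex) \<Rightarrow> bool" where
  "coefficient_model n a b R \<xi> \<longleftrightarrow>
     (\<forall>g\<in>carrier (GL n). act R g \<in> carrier_mat (deg R) (deg R)) \<and>
     (\<forall>g\<in>carrier (GL n). \<forall>h\<in>carrier (GL n). \<forall>k<deg R.
        \<xi> k (g * h) = (\<Sum>l<deg R. \<xi> l g * act R h $$ (l, k))) \<and>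
     (\<forall>x. (\<forall>g\<in>carrier (GL n). (\<Sum>k<deg R. \<xi> k g * x k) = 0) \<longrightarrow> (\<forall>k<deg R. x k = 0)) \<and>
     (\<forall>k<deg R. \<xi> k \<in> fspan (carrier (GL n)) (monomials n a b)) \<and>
     (\<forall>A\<in>indices n a. \<forall>B\<in>indices n b. \<exists>x. \<forall>g\<in>carrier (GL n).
        monomial n A B g = (\<Sum>k<deg R. \<xi> k g * x k))"

lemma irrep_has_coefficient_model:
  assumes n: "n \<ge> 2" and irrep: "is_irrep_with_highest_weight n (hook_weight n a b) R"
  shows "\<exists>\<xi>. coefficient_model n a b R \<xi>"
proof -
  let ?d = "deg R"
  have R: "rational_rep n R" "irreducible_rep n R"
    using irrep by (auto simp: is_irrep_with_highest_weight_def)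
  obtain v where hw: "highest_weight_vector n R (hook_weight n a b) v"
    using irrep by (auto simp: is_irrep_with_highest_weight_def)
  note v = highest_weight_vectorD(1,2)[OF n hw]
  obtain f where f: "f \<in> carrier_vec ?d"
    "\<And>g. g \<in> carrier (GL n) \<Longrightarrow> f \<bullet> (act R g *\<^sub>v v) = highest_weight_function n a b g"
    using highest_weight_functional[OF n R(1) hw] by blast
  note RC = GL_carrier[OF rep_GL[OF R(1)]]
  have f0: "f \<noteq> 0\<^sub>v ?d"
  proof
    assume "f = 0\<^sub>v ?d"
    then have "f \<bullet> (act R (1\<^sub>m n) *\<^sub>v v) = 0"
      using mult_mat_vec_carrier[OF RC[OF GL_one] v(1)] by simp
    moreover have "f \<bullet> (act R (1\<^sub>m n) *\<^sub>v v) = 1"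
      using n f(2)[OF GL_one] by (simp add: highest_weight_function_one)
    ultimately show False by simp
  qed
  define \<xi> where "\<xi> = (\<lambda>k g. \<Sum>i<?d. f $ i * act R g $$ (i, k))"
  have \<xi>_sum: "(\<Sum>k<?d. \<xi> k g * x k) = f \<bullet> (act R g *\<^sub>v vec ?d x)" if "g \<in> carrier (GL n)" for g x
  proof -
    have "(\<Sum>k<?d. \<xi> k g * x k) = (\<Sum>k<?d. \<Sum>i<?d. f $ i * act R g $$ (i, k) * x k)"
      by (simp add: \<xi>_def sum_distrib_right)
    also have "\<dots> = (\<Sum>i<?d. \<Sum>k<?d. f $ i * act R g $$ (i, k) * x k)"
      by (rule sum.swap)
    also have "\<dots> = f \<bullet> (act R g *\<^sub>v vec ?d x)"
      by (subst scalar_prod_mult_vec[OF f(1) RC[OF that]]) auto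
    finally show ?thesis .
  qed
  have unit: "\<xi> k g = f \<bullet> (act R g *\<^sub>v unit_vec ?d k)" if "g \<in> carrier (GL n)" "k < ?d" for g k
  proof -
    have "(\<Sum>j<?d. \<xi> j g * (if j = k then 1 else 0)) = (\<Sum>j<?d. if j = k then \<xi> j g else 0)"
      by (intro sum.cong) auto
    then have "(\<Sum>j<?d. \<xi> j g * (if j = k then 1 else 0)) = \<xi> k g" using that by simp
    moreover have "vec ?d (\<lambda>j. if j = k then 1 else 0) = (unit_vec ?d k :: complex vec)"
      by (simp add: unit_vec_def)
    ultimately show ?thesis using \<xi>_sum[OF that(1), of "\<lambda>j. if j = k then 1 else 0"] by simp
  qed
  have "coefficient_model n a b R \<xi>"
    unfolding coefficient_model_def
  proof (intro conjI ballI allI impI)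
    show "act R g \<in> carrier_mat ?d ?d" if "g \<in> carrier (GL n)" for g using RC[OF that] .
    show "\<xi> k (g * h) = (\<Sum>l<?d. \<xi> l g * act R h $$ (l, k))"
      if g: "g \<in> carrier (GL n)" and h: "h \<in> carrier (GL n)" and k: "k < ?d" for g h k
    proof -
      have "\<xi> k (g * h) = (\<Sum>i<?d. \<Sum>l<?d. f $ i * (act R g $$ (i, l) * act R h $$ (l, k)))"
        unfolding \<xi>_def rep_mult[OF R(1) g h] sum_distrib_left[symmetric]
        using mat_mult_entry[OF RC[OF g] RC[OF h] _ k] by (intro sum.cong) auto
      also have "\<dots> = (\<Sum>l<?d. \<Sum>i<?d. f $ i * (act R g $$ (i, l) * act R h $$ (l, k)))"
        by (rule sum.swap)
      finally show ?thesis by (simp add: \<xi>_def sum_distrib_right mult.assoc)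
    qed
    show "x k = 0" if x: "\<forall>g\<in>carrier (GL n). (\<Sum>k<?d. \<xi> k g * x k) = 0" and k: "k < ?d" for x k
    proof -
      have "vec ?d x = 0\<^sub>v ?d"
        using x by (intro irreducible_coefficients_separate[OF R f(1) f0]) (auto simp: \<xi>_sum)
      then show ?thesis using k by (metis index_vec index_zero_vec(1))
    qed
    show "\<xi> k \<in> fspan (carrier (GL n)) (monomials n a b)" if "k < ?d" for k
      using n unit that
      by (intro fspan_cong[OF coefficients_in_span[OF _ R v f, of "unit_vec ?d k"]]) auto
    show "\<exists>x. \<forall>g\<in>carrier (GL n). monomial n A B g = (\<Sum>k<?d. \<xi> k g * x k)"
      if A: "A \<in> indices n a" and B: "B \<in> indices n b" for A B
    proof -
      obtain x where x: "x \<in> carrier_vec ?d" "\<forall>g\<in>carrier (GL n). monomial n A B g = f \<bullet> (act R g *\<^sub>v x)"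
        using monomial_is_coefficient[OF n R(1) v(1) f A B] by blast
      then have "vec ?d (\<lambda>k. x $ k) = x" by (intro eq_vecI) auto
      then show ?thesis using x \<xi>_sum[of _ "\<lambda>k. x $ k"] by (intro exI[of _ "\<lambda>k. x $ k"]) auto
    qed
  qed
  then show ?thesis by blast
qed

section \<open>Tensor products\<close>

text \<open>Functions on a tensor product are functions of one group element for each factor. Lists follow the
recursion that defines \<open>tensor_reps\<close>.\<close>

definition GL_tuples :: "nat \<Rightarrow> nat \<Rightarrow> complex mat list set" where
  "GL_tuples n r = {gs. length gs = r \<and> set gs \<subseteq> carrier (GL n)}"

lemma Cons_GL_tuples [simp]:
  "g # gs \<in> GL_tuples n (Suc r) \<longleftrightarrow> g \<in> carrier (GL n) \<and> gs \<in> GL_tuples n r"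
  by (auto simp: GL_tuples_def)

lemma GL_tuples_0 [simp]: "GL_tuples n 0 = {[]}"
  by (auto simp: GL_tuples_def)

lemma GL_tuples_Suc_cases:
  assumes "gs \<in> GL_tuples n (Suc r)"
  obtains g gs' where "gs = g # gs'" "g \<in> carrier (GL n)" "gs' \<in> GL_tuples n r"
  using assms by (cases gs) (auto simp: GL_tuples_def)

fun monomial_product :: "nat \<Rightarrow> (nat multiset \<times> nat multiset) list \<Rightarrow> complex mat list \<Rightarrow> complex" where
  "monomial_product n [] gs = 1"
| "monomial_product n (AB # ABs) gs = monomial n (fst AB) (snd AB) (hd gs) * monomial_product n ABs (tl gs)"

definition multidegree :: "nat \<Rightarrow> (nat \<times> nat) list \<Rightarrow> (nat multiset \<times> nat multiset) list set" where
  "multidegree n ab = {ABs. list_all2 (\<lambda>AB ab. fst AB \<in> indices n (fst ab) \<and> snd AB \<in> indices n (snd ab)) ABs ab}"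

lemma Cons_multidegree [simp]:
  "AB # ABs \<in> multidegree n (ab # ds) \<longleftrightarrow>
     fst AB \<in> indices n (fst ab) \<and> snd AB \<in> indices n (snd ab) \<and> ABs \<in> multidegree n ds"
  by (auto simp: multidegree_def)

lemma multidegree_Nil [simp]: "multidegree n [] = {[]}"
  by (auto simp: multidegree_def)

lemma multidegree_Cons_cases:
  assumes "ABs \<in> multidegree n (ab # ds)"
  obtains AB ABs' where "ABs = AB # ABs'" "fst AB \<in> indices n (fst ab)" "snd AB \<in> indices n (snd ab)"
    "ABs' \<in> multidegree n ds"
  using assms by (auto simp: multidegree_def list_all2_Cons2)

definition monomial_products :: "nat \<Rightarrow> (nat \<times> nat) list \<Rightarrow> (complex mat list \<Rightarrow> complex) set" where
  "monomial_products n ab = monomial_product n ` multidegree n ab"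

text \<open>The index arithmetic is that of \<open>kronecker\<close>: the quotient indexes the first factor and the remainder the
others.\<close>

fun tensor_coefficient ::
  "(mat_rep \<times> (nat \<Rightarrow> complex mat \<Rightarrow> complex)) list \<Rightarrow> nat \<Rightarrow> complex mat list \<Rightarrow> complex" where
  "tensor_coefficient [] k gs = 1"
| "tensor_coefficient (D # Ds) k gs =
     snd D (k div deg (tensor_reps (map fst Ds))) (hd gs) *
     tensor_coefficient Ds (k mod deg (tensor_reps (map fst Ds))) (tl gs)"

lemma tensor_reps_Nil [simp]: "tensor_reps [] = trivial_rep"
  and tensor_reps_Cons [simp]: "tensor_reps (R # Rs) = tensor_rep R (tensor_reps Rs)"
  by (simp_all add: tensor_reps_def)

lemma deg_tensor [simp]: "deg trivial_rep = 1" "deg (tensor_rep R S) = deg R * deg S"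
  by (simp_all add: trivial_rep_def tensor_rep_def)

definition tensor_model ::
  "nat \<Rightarrow> (nat \<times> nat) list \<Rightarrow> (mat_rep \<times> (nat \<Rightarrow> complex mat \<Rightarrow> complex)) list \<Rightarrow> bool" where
  "tensor_model n ab Ds \<longleftrightarrow>
     list_all2 (\<lambda>ab D. coefficient_model n (fst ab) (snd ab) (fst D) (snd D)) ab Ds"

lemma tensor_model_Nil [simp]: "tensor_model n [] Ds \<longleftrightarrow> Ds = []"
  by (simp add: tensor_model_def)

lemma tensor_model_Cons:
  "tensor_model n (ab # ds) Ds \<longleftrightarrow> (\<exists>R \<xi> Ds'. Ds = (R, \<xi>) # Ds' \<and>
     coefficient_model n (fst ab) (snd ab) R \<xi> \<and> tensor_model n ds Ds')"
  by (auto simp: tensor_model_def list_all2_Cons1)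

lemma act_tensor_entry:
  assumes "act R h \<in> carrier_mat d d" "act S h \<in> carrier_mat e e" "l < d * e" "k < d * e"
  shows "act (tensor_rep R S) h $$ (l, k) =
    act R h $$ (l div e, k div e) * act S h $$ (l mod e, k mod e)"
  using assms by (simp add: tensor_rep_def kronecker_def)

lemma act_tensor_carrier:
  assumes "tensor_model n ab Ds" "h \<in> carrier (GL n)"
  shows "act (tensor_reps (map fst Ds)) h
    \<in> carrier_mat (deg (tensor_reps (map fst Ds))) (deg (tensor_reps (map fst Ds)))"
  using assms
proof (induction ab arbitrary: Ds)
  case Nil
  then show ?case by (simp add: trivial_rep_def)
next
  case (Cons a ds)
  then obtain R \<xi> Ds' where D: "Ds = (R, \<xi>) # Ds'" "coefficient_model n (fst a) (snd a) R \<xi>"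
    "tensor_model n ds Ds'" by (auto simp: tensor_model_Cons)
  have "act R h \<in> carrier_mat (deg R) (deg R)" using D(2) Cons.prems by (simp add: coefficient_model_def)
  then show ?case
    using Cons.IH[OF D(3) Cons.prems(2)] by (auto simp: D(1) tensor_rep_def kronecker_def)
qed

lemma tensor_coefficient_translate:
  assumes "tensor_model n ab Ds" "gs \<in> GL_tuples n (length ab)" "h \<in> carrier (GL n)"
    and "k < deg (tensor_reps (map fst Ds))"
  shows "tensor_coefficient Ds k (map (\<lambda>g. g * h) gs) =
    (\<Sum>l<deg (tensor_reps (map fst Ds)).
       tensor_coefficient Ds l gs * act (tensor_reps (map fst Ds)) h $$ (l, k))"
  using assms
proof (induction ab arbitrary: Ds gs k)
  case Nil
  then show ?case by (simp add: trivial_rep_def)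
next
  case (Cons a ds)
  then obtain R \<xi> Ds' where D: "Ds = (R, \<xi>) # Ds'" "coefficient_model n (fst a) (snd a) R \<xi>"
    "tensor_model n ds Ds'" by (auto simp: tensor_model_Cons)
  obtain g gs' where gs: "gs = g # gs'" "g \<in> carrier (GL n)" "gs' \<in> GL_tuples n (length ds)"
    using Cons.prems(2) GL_tuples_Suc_cases by (metis length_Cons)
  let ?S = "tensor_reps (map fst Ds')"
  let ?d = "deg R" and ?e = "deg ?S"
  have k: "k < ?d * ?e" using Cons.prems(4) by (simp add: D(1))
  then have k': "k div ?e < ?d" "k mod ?e < ?e"
    by (auto simp: less_mult_imp_div_less intro!: mod_less_divisor) (metis gr0I mult_0_right not_less0)
  note C = act_tensor_carrier[OF D(3) Cons.prems(3)]
  have RC: "act R h \<in> carrier_mat ?d ?d" using D(2) Cons.prems by (simp add: coefficient_model_def)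
  have "tensor_coefficient Ds k (map (\<lambda>g. g * h) gs) =
      \<xi> (k div ?e) (g * h) * tensor_coefficient Ds' (k mod ?e) (map (\<lambda>g. g * h) gs')"
    by (simp add: D(1) gs(1))
  also have "\<xi> (k div ?e) (g * h) = (\<Sum>l<?d. \<xi> l g * act R h $$ (l, k div ?e))"
    using D(2) gs(2) Cons.prems(3) k'(1) by (simp add: coefficient_model_def)
  also have "tensor_coefficient Ds' (k mod ?e) (map (\<lambda>g. g * h) gs') =
      (\<Sum>l<?e. tensor_coefficient Ds' l gs' * act ?S h $$ (l, k mod ?e))"
    by (rule Cons.IH[OF D(3) gs(3) Cons.prems(3) k'(2)])
  also have "(\<Sum>l<?d. \<xi> l g * act R h $$ (l, k div ?e)) *
      (\<Sum>l<?e. tensor_coefficient Ds' l gs' * act ?S h $$ (l, k mod ?e)) =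
      (\<Sum>l<?d * ?e. (\<xi> (l div ?e) g * act R h $$ (l div ?e, k div ?e)) *
        (tensor_coefficient Ds' (l mod ?e) gs' * act ?S h $$ (l mod ?e, k mod ?e)))"
    unfolding sum_product
    by (rule sum_div_mod[symmetric, where f = "\<lambda>i j. (\<xi> i g * act R h $$ (i, k div ?e)) *
        (tensor_coefficient Ds' j gs' * act ?S h $$ (j, k mod ?e))"])
  also have "\<dots> = (\<Sum>l<?d * ?e. tensor_coefficient Ds l gs * act (tensor_rep R ?S) h $$ (l, k))"
    using k by (intro sum.cong) (auto simp: act_tensor_entry[OF RC C] D(1) gs(1))
  finally show ?case by (simp add: D(1))
qed

text \<open>For a fixed first argument the partial sums over the first index are annihilated by all coefficients of
the remaining factors, hence zero; this holds for each first argument.\<close>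

lemma tensor_coefficients_separate:
  assumes "tensor_model n ab Ds"
    and "\<And>gs. gs \<in> GL_tuples n (length ab) \<Longrightarrow>
      (\<Sum>k<deg (tensor_reps (map fst Ds)). tensor_coefficient Ds k gs * x k) = 0"
    and "k < deg (tensor_reps (map fst Ds))"
  shows "x k = 0"
  using assms
proof (induction ab arbitrary: Ds x k)
  case Nil
  then show ?case by simp
next
  case (Cons a ds)
  then obtain R \<xi> Ds' where D: "Ds = (R, \<xi>) # Ds'" "coefficient_model n (fst a) (snd a) R \<xi>"
    "tensor_model n ds Ds'" by (auto simp: tensor_model_Cons)
  let ?S = "tensor_reps (map fst Ds')"
  let ?d = "deg R" and ?e = "deg ?S"
  have k: "k < ?d * ?e" using Cons.prems(3) by (simp add: D(1))
  then have k': "k div ?e < ?d" "k mod ?e < ?e"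
    by (auto simp: less_mult_imp_div_less intro!: mod_less_divisor) (metis gr0I mult_0_right not_less0)
  have eq: "(\<Sum>i<?d. \<Sum>j<?e. \<xi> i g * tensor_coefficient Ds' j gs * x (i * ?e + j)) = 0"
    if "g \<in> carrier (GL n)" "gs \<in> GL_tuples n (length ds)" for g gs
  proof -
    have "(\<Sum>i<?d. \<Sum>j<?e. \<xi> i g * tensor_coefficient Ds' j gs * x (i * ?e + j)) =
        (\<Sum>l<?d * ?e. \<xi> (l div ?e) g * tensor_coefficient Ds' (l mod ?e) gs * x (l div ?e * ?e + l mod ?e))"
      by (rule sum_div_mod[symmetric, where f = "\<lambda>i j. \<xi> i g * tensor_coefficient Ds' j gs * x (i * ?e + j)"])
    also have "\<dots> = (\<Sum>l<?d * ?e. tensor_coefficient Ds l (g # gs) * x l)"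
      by (simp add: D(1))
    also have "\<dots> = 0" using Cons.prems(2)[of "g # gs"] that by (simp add: D(1))
    finally show ?thesis .
  qed
  have "(\<Sum>i<?d. \<xi> i g * x (i * ?e + k mod ?e)) = 0" if g: "g \<in> carrier (GL n)" for g
  proof (rule Cons.IH[OF D(3) _ k'(2), of "\<lambda>j. \<Sum>i<?d. \<xi> i g * x (i * ?e + j)"])
    fix gs assume gs: "gs \<in> GL_tuples n (length ds)"
    have "(\<Sum>j<?e. tensor_coefficient Ds' j gs * (\<Sum>i<?d. \<xi> i g * x (i * ?e + j))) =
        (\<Sum>j<?e. \<Sum>i<?d. \<xi> i g * tensor_coefficient Ds' j gs * x (i * ?e + j))"
      by (simp add: sum_distrib_left mult_ac)
    also have "\<dots> = (\<Sum>i<?d. \<Sum>j<?e. \<xi> i g * tensor_coefficient Ds' j gs * x (i * ?e + j))"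
      by (rule sum.swap)
    also have "\<dots> = 0" by (rule eq[OF g gs])
    finally show "(\<Sum>j<?e. tensor_coefficient Ds' j gs * (\<Sum>i<?d. \<xi> i g * x (i * ?e + j))) = 0" .
  qed
  then have "\<forall>g\<in>carrier (GL n). (\<Sum>i<?d. \<xi> i g * x (i * ?e + k mod ?e)) = 0" by (intro ballI)
  moreover have sep: "\<forall>y. (\<forall>g\<in>carrier (GL n). (\<Sum>i<?d. \<xi> i g * y i) = 0) \<longrightarrow> (\<forall>i<?d. y i = 0)"
    using D(2) by (simp add: coefficient_model_def)
  ultimately have "\<forall>i<?d. x (i * ?e + k mod ?e) = 0"
    using spec[OF sep, of "\<lambda>i. x (i * ?e + k mod ?e)"] by blast
  with k'(1) have "x (k div ?e * ?e + k mod ?e) = 0" by blast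
  then show ?case by simp
qed

lemma tensor_coefficients_in_span:
  assumes "tensor_model n ab Ds" "k < deg (tensor_reps (map fst Ds))"
  shows "tensor_coefficient Ds k \<in> fspan (GL_tuples n (length ab)) (monomial_products n ab)"
  using assms
proof (induction ab arbitrary: Ds k)
  case Nil
  have "monomial_product n [] \<in> monomial_products n []" by (simp add: monomial_products_def)
  then show ?case by (rule fspan_cong[OF fspan_base]) (use Nil in simp)
next
  case (Cons a ds)
  then obtain R \<xi> Ds' where D: "Ds = (R, \<xi>) # Ds'" "coefficient_model n (fst a) (snd a) R \<xi>"
    "tensor_model n ds Ds'" by (auto simp: tensor_model_Cons)
  let ?S = "tensor_reps (map fst Ds')"
  let ?d = "deg R" and ?e = "deg ?S"
  let ?X = "GL_tuples n (length (a # ds))" and ?M = "monomial_products n (a # ds)"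
  have k: "k < ?d * ?e" using Cons.prems(2) by (simp add: D(1))
  then have k': "k div ?e < ?d" "k mod ?e < ?e"
    by (auto simp: less_mult_imp_div_less intro!: mod_less_divisor) (metis gr0I mult_0_right not_less0)
  have hd_tl: "hd gs \<in> carrier (GL n)" "tl gs \<in> GL_tuples n (length ds)" if "gs \<in> ?X" for gs
    using that by (cases gs; simp add: GL_tuples_def)+
  have left: "(\<lambda>gs. p (hd gs) * monomial_product n ABs (tl gs)) \<in> fspan ?X ?M"
    if p: "p \<in> fspan (carrier (GL n)) (monomials n (fst a) (snd a))" and ABs: "ABs \<in> multidegree n ds" for p ABs
    using p
  proof induction
    case (zero p)
    then show ?case by (intro fspan.zero) (auto simp: hd_tl)
  next
    case (step q m p c)
    obtain A B where m: "m = monomial n A B" "A \<in> indices n (fst a)" "B \<in> indices n (snd a)"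
      using step.hyps(2) by (auto simp: monomials_def)
    have "monomial_product n ((A, B) # ABs) \<in> ?M"
      unfolding monomial_products_def using m ABs by (intro imageI) simp
    from fspan_add_scaled[OF step.IH fspan_base[OF this], of c] show ?case
      by (rule fspan_cong) (use step.hyps(3) hd_tl m in \<open>auto simp: algebra_simps\<close>)
  qed
  have right: "(\<lambda>gs. p (hd gs) * q (tl gs)) \<in> fspan ?X ?M"
    if p: "p \<in> fspan (carrier (GL n)) (monomials n (fst a) (snd a))"
      and q: "q \<in> fspan (GL_tuples n (length ds)) (monomial_products n ds)" for p q
    using q
  proof induction
    case (zero q)
    then show ?case by (intro fspan.zero) (auto simp: hd_tl)
  next
    case (step q' m q c)
    obtain ABs where m: "m = monomial_product n ABs" "ABs \<in> multidegree n ds"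
      using step.hyps(2) by (auto simp: monomial_products_def)
    from fspan_add_scaled[OF step.IH left[OF p m(2)], of c] show ?case
      by (rule fspan_cong) (use step.hyps(3) hd_tl m in \<open>auto simp: algebra_simps\<close>)
  qed
  have "\<xi> (k div ?e) \<in> fspan (carrier (GL n)) (monomials n (fst a) (snd a))"
    using D(2) k'(1) by (simp add: coefficient_model_def)
  from right[OF this Cons.IH[OF D(3) k'(2)]] show ?case
    by (rule fspan_cong) (simp add: D(1))
qed

lemma monomial_product_is_tensor_coefficient:
  assumes "tensor_model n ab Ds" "ABs \<in> multidegree n ab"
  shows "\<exists>x. \<forall>gs\<in>GL_tuples n (length ab).
    monomial_product n ABs gs = (\<Sum>k<deg (tensor_reps (map fst Ds)). tensor_coefficient Ds k gs * x k)"
  using assms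
proof (induction ab arbitrary: Ds ABs)
  case Nil
  then show ?case by (intro exI[of _ "\<lambda>_. 1"]) auto
next
  case (Cons a ds)
  then obtain R \<xi> Ds' where D: "Ds = (R, \<xi>) # Ds'" "coefficient_model n (fst a) (snd a) R \<xi>"
    "tensor_model n ds Ds'" by (auto simp: tensor_model_Cons)
  obtain AB ABs' where AB: "ABs = AB # ABs'" "fst AB \<in> indices n (fst a)" "snd AB \<in> indices n (snd a)"
    "ABs' \<in> multidegree n ds"
    using multidegree_Cons_cases[OF Cons.prems(2)] .
  let ?S = "tensor_reps (map fst Ds')"
  let ?d = "deg R" and ?e = "deg ?S"
  obtain x where x: "\<forall>g\<in>carrier (GL n). monomial n (fst AB) (snd AB) g = (\<Sum>k<?d. \<xi> k g * x k)"
    using D(2) AB(2,3) unfolding coefficient_model_def by blast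
  obtain y where y: "\<forall>gs\<in>GL_tuples n (length ds).
      monomial_product n ABs' gs = (\<Sum>k<?e. tensor_coefficient Ds' k gs * y k)"
    using Cons.IH[OF D(3) AB(4)] by blast
  have "monomial_product n ABs gs = (\<Sum>k<?d * ?e. tensor_coefficient Ds k gs * (x (k div ?e) * y (k mod ?e)))"
    if gs: "gs \<in> GL_tuples n (length (a # ds))" for gs
  proof -
    obtain g gs' where gs: "gs = g # gs'" "g \<in> carrier (GL n)" "gs' \<in> GL_tuples n (length ds)"
      using gs GL_tuples_Suc_cases by (metis length_Cons)
    have "monomial_product n ABs gs = (\<Sum>i<?d. \<Sum>j<?e. (\<xi> i g * x i) * (tensor_coefficient Ds' j gs' * y j))"
      using x y gs by (simp add: AB(1) sum_product)
    also have "\<dots> = (\<Sum>k<?d * ?e. (\<xi> (k div ?e) g * x (k div ?e)) * (tensor_coefficient Ds' (k mod ?e) gs' * y (k mod ?e)))"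
      by (rule sum_div_mod[symmetric, where f = "\<lambda>i j. (\<xi> i g * x i) * (tensor_coefficient Ds' j gs' * y j)"])
    finally show ?thesis by (simp add: D(1) gs(1) mult_ac)
  qed
  then show ?case by (intro exI[of _ "\<lambda>k. x (k div ?e) * y (k mod ?e)"]) (simp add: D(1))
qed

section \<open>Products of monomials indexed by position\<close>

text \<open>The functions of \<open>monomial_products\<close> with positions in place of recursion: a pairing
involves two positions at once.\<close>

definition indexed_products ::
  "nat \<Rightarrow> nat \<Rightarrow> (nat \<Rightarrow> nat) \<Rightarrow> (nat \<Rightarrow> nat) \<Rightarrow> (complex mat list \<Rightarrow> complex) set" where
  "indexed_products n r \<alpha> \<beta> = {(\<lambda>gs. \<Prod>i<r. monomial n (A i) (B i) (gs ! i)) | A B.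
     \<forall>i<r. A i \<in> indices n (\<alpha> i) \<and> B i \<in> indices n (\<beta> i)}"

lemma indexed_productsI:
  "(\<And>i. i < r \<Longrightarrow> A i \<in> indices n (\<alpha> i)) \<Longrightarrow> (\<And>i. i < r \<Longrightarrow> B i \<in> indices n (\<beta> i)) \<Longrightarrow>
    (\<lambda>gs. \<Prod>i<r. monomial n (A i) (B i) (gs ! i)) \<in> indexed_products n r \<alpha> \<beta>"
  unfolding indexed_products_def by blast

lemma monomial_product_nth:
  "length gs = length ABs \<Longrightarrow>
    monomial_product n ABs gs = (\<Prod>i<length ABs. monomial n (fst (ABs ! i)) (snd (ABs ! i)) (gs ! i))"
proof (induction ABs arbitrary: gs)
  case (Cons AB ABs)
  then obtain g gs' where "gs = g # gs'" "length gs' = length ABs" by (cases gs) auto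
  then show ?case using Cons.IH[of gs'] by (simp add: prod.lessThan_Suc_shift del: prod.lessThan_Suc)
qed simp

lemma fspan_mono:
  assumes "f \<in> fspan X B" "\<And>m. m \<in> B \<Longrightarrow> m \<in> fspan X B'"
  shows "f \<in> fspan X B'"
  using fspan_mult[OF assms(1), of "\<lambda>_. 1" B'] assms(2) by simp

lemma fspan_monomial_products:
  assumes "length ab = r"
  shows "fspan (GL_tuples n r) (monomial_products n ab) =
    fspan (GL_tuples n r) (indexed_products n r (\<lambda>i. fst (ab ! i)) (\<lambda>i. snd (ab ! i)))"
    (is "fspan ?X ?M = fspan ?X ?N")
proof (intro subset_antisym subsetI)
  fix f assume "f \<in> fspan ?X ?M"
  then show "f \<in> fspan ?X ?N"
  proof (rule fspan_mono)
    fix m assume "m \<in> ?M"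
    then obtain ABs where m: "m = monomial_product n ABs" "ABs \<in> multidegree n ab"
      by (auto simp: monomial_products_def)
    have len: "length ABs = r" using m(2) assms by (auto simp: multidegree_def dest: list_all2_lengthD)
    have "(\<lambda>gs. \<Prod>i<r. monomial n (fst (ABs ! i)) (snd (ABs ! i)) (gs ! i)) \<in> ?N"
      using m(2) len by (intro indexed_productsI) (auto simp: multidegree_def list_all2_conv_all_nth)
    then show "m \<in> fspan ?X ?N"
      by (rule fspan_cong[OF fspan_base]) (simp add: m(1) monomial_product_nth len GL_tuples_def)
  qed
next
  fix f assume "f \<in> fspan ?X ?N"
  then show "f \<in> fspan ?X ?M"
  proof (rule fspan_mono)
    fix m assume "m \<in> ?N"
    then obtain A B where m: "m = (\<lambda>gs. \<Prod>i<r. monomial n (A i) (B i) (gs ! i))"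
      "\<forall>i<r. A i \<in> indices n (fst (ab ! i)) \<and> B i \<in> indices n (snd (ab ! i))"
      by (auto simp: indexed_products_def)
    define ABs where "ABs = map (\<lambda>i. (A i, B i)) [0..<r]"
    have "monomial_product n ABs \<in> ?M"
      unfolding monomial_products_def using m(2) assms
      by (intro imageI) (auto simp: multidegree_def list_all2_conv_all_nth ABs_def)
    then show "m \<in> fspan ?X ?M"
      by (rule fspan_cong[OF fspan_base]) (auto simp: m(1) monomial_product_nth ABs_def GL_tuples_def)
  qed
qed

section \<open>Invariant functions from contingency tables\<close>

text \<open>The basic invariants \<open>z\<^sub>i\<^sub>j = p(g\<^sub>i) \<bullet> q(g\<^sub>j)\<close>.\<close>

definition pairing :: "nat \<Rightarrow> complex mat list \<Rightarrow> nat \<Rightarrow> nat \<Rightarrow> complex" where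
  "pairing n gs i j = (\<Sum>k<n. (gs ! i) $$ (0, k) * gl_inv (gs ! j) $$ (k, n - 1))"

definition pairing_product :: "nat \<Rightarrow> nat \<Rightarrow> nat mat \<Rightarrow> complex mat list \<Rightarrow> complex" where
  "pairing_product n r M gs = (\<Prod>p\<in>{..<r} \<times> {..<r}. pairing n gs (fst p) (snd p) ^ (M $$ p))"

definition row_sum :: "nat \<Rightarrow> nat mat \<Rightarrow> nat \<Rightarrow> nat" where
  "row_sum r M i = (\<Sum>j<r. M $$ (i, j))"

definition col_sum :: "nat \<Rightarrow> nat mat \<Rightarrow> nat \<Rightarrow> nat" where
  "col_sum r M j = (\<Sum>i<r. M $$ (i, j))"

lemma pairing_eq:
  assumes "gs \<in> GL_tuples n r" "i < r" "j < r" "n \<ge> 1"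
  shows "pairing n gs i j = (gs ! i * gl_inv (gs ! j)) $$ (0, n - 1)"
proof -
  have "gs ! i \<in> carrier (GL n)" "gs ! j \<in> carrier (GL n)" using assms by (auto simp: GL_tuples_def)
  then show ?thesis
    unfolding pairing_def using assms(4) GL_carrier[of "gs ! i"] GL_carrier[OF gl_inv_GL[of "gs ! j"]]
    by (subst mat_mult_entry[of _ n n _ n]) auto
qed

lemma map_translate_GL_tuples:
  "gs \<in> GL_tuples n r \<Longrightarrow> h \<in> carrier (GL n) \<Longrightarrow> map (\<lambda>g. g * h) gs \<in> GL_tuples n r"
  by (auto simp: GL_tuples_def)

lemma pairing_translate:
  assumes gs: "gs \<in> GL_tuples n r" and h: "h \<in> carrier (GL n)" and ij: "i < r" "j < r" and n: "n \<ge> 1"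
  shows "pairing n (map (\<lambda>g. g * h) gs) i j = pairing n gs i j"
proof -
  have G: "gs ! i \<in> carrier (GL n)" "gs ! j \<in> carrier (GL n)" and len: "length gs = r"
    using gs ij by (auto simp: GL_tuples_def)
  note C = GL_carrier[OF G(1)] GL_carrier[OF gl_inv_GL[OF G(2)]] GL_carrier[OF h] GL_carrier[OF gl_inv_GL[OF h]]
  have "gs ! i * h * (gl_inv h * gl_inv (gs ! j)) = gs ! i * (h * gl_inv h) * gl_inv (gs ! j)"
    using C by (simp add: assoc_mult_mat[of _ n n _ n _ n] mult_carrier_mat[of _ n n _ n])
  also have "\<dots> = gs ! i * gl_inv (gs ! j)"
    using C by (simp add: gl_inv_right[OF h])
  finally show ?thesis
    using ij len
    by (simp add: pairing_eq[OF gs ij n] pairing_eq[OF map_translate_GL_tuples[OF gs h] ij n] gl_inv_mult[OF G(2) h])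
qed

lemma pairing_product_translate:
  assumes "gs \<in> GL_tuples n r" "h \<in> carrier (GL n)" "n \<ge> 1"
  shows "pairing_product n r M (map (\<lambda>g. g * h) gs) = pairing_product n r M gs"
  unfolding pairing_product_def using assms by (intro prod.cong) (auto simp: pairing_translate)

lemma indexed_products_mult_row:
  assumes "m \<in> indexed_products n r \<alpha> \<beta>" "i < r" "k < n"
  shows "(\<lambda>gs. (gs ! i) $$ (0, k) * m gs) \<in> indexed_products n r (\<alpha>(i := Suc (\<alpha> i))) \<beta>"
proof -
  obtain A B where m: "m = (\<lambda>gs. \<Prod>i<r. monomial n (A i) (B i) (gs ! i))"
    "\<forall>i<r. A i \<in> indices n (\<alpha> i) \<and> B i \<in> indices n (\<beta> i)"
    using assms(1) by (auto simp: indexed_products_def)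
  define A' where "A' = A(i := add_mset k (A i))"
  have "(\<lambda>gs. (gs ! i) $$ (0, k) * m gs) = (\<lambda>gs. \<Prod>i<r. monomial n (A' i) (B i) (gs ! i))"
  proof
    fix gs
    have "(\<Prod>l<r. monomial n (A' l) (B l) (gs ! l)) =
        monomial n (A' i) (B i) (gs ! i) * (\<Prod>l\<in>{..<r} - {i}. monomial n (A' l) (B l) (gs ! l))"
      using assms(2) by (intro prod.remove) auto
    also have "(\<Prod>l\<in>{..<r} - {i}. monomial n (A' l) (B l) (gs ! l)) =
        (\<Prod>l\<in>{..<r} - {i}. monomial n (A l) (B l) (gs ! l))"
      by (intro prod.cong) (auto simp: A'_def)
    also have "monomial n (A' i) (B i) (gs ! i) = (gs ! i) $$ (0, k) * monomial n (A i) (B i) (gs ! i)"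
      by (simp add: A'_def monomial_def)
    finally show "(gs ! i) $$ (0, k) * m gs = (\<Prod>i<r. monomial n (A' i) (B i) (gs ! i))"
      using assms(2) by (simp add: m(1) prod.remove[of "{..<r}" i] mult.assoc)
  qed
  then show ?thesis
    using m(2) assms by (auto simp: A'_def indices_add intro!: indexed_productsI)
qed

lemma indexed_products_mult_col:
  assumes "m \<in> indexed_products n r \<alpha> \<beta>" "i < r" "k < n"
  shows "(\<lambda>gs. gl_inv (gs ! i) $$ (k, n - 1) * m gs) \<in> indexed_products n r \<alpha> (\<beta>(i := Suc (\<beta> i)))"
proof -
  obtain A B where m: "m = (\<lambda>gs. \<Prod>i<r. monomial n (A i) (B i) (gs ! i))"
    "\<forall>i<r. A i \<in> indices n (\<alpha> i) \<and> B i \<in> indices n (\<beta> i)"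
    using assms(1) by (auto simp: indexed_products_def)
  define B' where "B' = B(i := add_mset k (B i))"
  have "(\<lambda>gs. gl_inv (gs ! i) $$ (k, n - 1) * m gs) = (\<lambda>gs. \<Prod>i<r. monomial n (A i) (B' i) (gs ! i))"
  proof
    fix gs
    have "(\<Prod>l<r. monomial n (A l) (B' l) (gs ! l)) =
        monomial n (A i) (B' i) (gs ! i) * (\<Prod>l\<in>{..<r} - {i}. monomial n (A l) (B' l) (gs ! l))"
      using assms(2) by (intro prod.remove) auto
    also have "(\<Prod>l\<in>{..<r} - {i}. monomial n (A l) (B' l) (gs ! l)) =
        (\<Prod>l\<in>{..<r} - {i}. monomial n (A l) (B l) (gs ! l))"
      by (intro prod.cong) (auto simp: B'_def)
    also have "monomial n (A i) (B' i) (gs ! i) = gl_inv (gs ! i) $$ (k, n - 1) * monomial n (A i) (B i) (gs ! i)"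
      by (simp add: B'_def monomial_def)
    finally show "gl_inv (gs ! i) $$ (k, n - 1) * m gs = (\<Prod>i<r. monomial n (A i) (B' i) (gs ! i))"
      using assms(2) by (simp add: m(1) prod.remove[of "{..<r}" i] mult.assoc)
  qed
  then show ?thesis
    using m(2) assms by (auto simp: B'_def indices_add intro!: indexed_productsI)
qed

text \<open>Each factor \<open>z\<^sub>i\<^sub>j\<close> is a sum of products of a coordinate of \<open>p\<^sub>i\<close> and a coordinate of \<open>q\<^sub>j\<close>, so it raises the degree in
\<open>p\<^sub>i\<close> and the degree in \<open>q\<^sub>j\<close> by one. Hence the degrees of the product are the margins of the table.\<close>

lemma pairing_product_in_span:
  "pairing_product n r M \<in> fspan X (indexed_products n r (row_sum r M) (col_sum r M))"
proof (induction "\<Sum>p\<in>{..<r} \<times> {..<r}. M $$ p" arbitrary: M)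
  case 0
  then have zero: "M $$ (i, j) = 0" if "i < r" "j < r" for i j
    using that by (auto simp: sum_eq_0_iff)
  then have one: "pairing_product n r M gs = 1" for gs
    unfolding pairing_product_def by (intro prod.neutral) auto
  have "(\<lambda>gs. \<Prod>i<r. monomial n {#} {#} (gs ! i)) \<in> indexed_products n r (row_sum r M) (col_sum r M)"
    by (rule indexed_productsI) (auto simp: indices_def row_sum_def col_sum_def zero)
  then show ?case
    by (rule fspan_cong[OF fspan_base]) (simp add: one monomial_def)
next
  case (Suc t)
  then obtain i j where ij: "i < r" "j < r" "M $$ (i, j) \<noteq> 0"
    by (metis (no_types, lifting) SigmaE lessThan_iff nat.distinct(1) sum.neutral)
  define M' where "M' = mat r r (\<lambda>p. if p = (i, j) then M $$ p - 1 else M $$ p)"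
  have M'_entry: "M' $$ p = (if p = (i, j) then M $$ p - 1 else M $$ p)" if "p \<in> {..<r} \<times> {..<r}" for p
    using that by (cases p) (simp add: M'_def)
  have mem: "(i, j) \<in> {..<r} \<times> {..<r}" using ij by simp
  have "(\<Sum>p\<in>{..<r} \<times> {..<r}. M $$ p) = Suc (\<Sum>p\<in>{..<r} \<times> {..<r}. M' $$ p)"
    using ij(3) by (simp add: sum.remove[OF _ mem] M'_entry[OF mem] M'_entry)
  then have IH: "pairing_product n r M' \<in> fspan X (indexed_products n r (row_sum r M') (col_sum r M'))"
    using Suc.hyps by simp
  have row: "((row_sum r M')(i := Suc (row_sum r M' i))) k = row_sum r M k" if "k < r" for k
  proof (cases "k = i")
    case True
    have "row_sum r M i = M $$ (i, j) + (\<Sum>l\<in>{..<r} - {j}. M $$ (i, l))"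
      "row_sum r M' i = M' $$ (i, j) + (\<Sum>l\<in>{..<r} - {j}. M' $$ (i, l))"
      unfolding row_sum_def using ij by (auto intro: sum.remove)
    moreover have "(\<Sum>l\<in>{..<r} - {j}. M' $$ (i, l)) = (\<Sum>l\<in>{..<r} - {j}. M $$ (i, l))"
      using ij by (intro sum.cong) (auto simp: M'_entry)
    ultimately show ?thesis using True ij M'_entry[OF mem] by simp
  next
    case False
    then show ?thesis using that by (simp add: row_sum_def M'_entry)
  qed
  have col: "((col_sum r M')(j := Suc (col_sum r M' j))) k = col_sum r M k" if "k < r" for k
  proof (cases "k = j")
    case True
    have "col_sum r M j = M $$ (i, j) + (\<Sum>l\<in>{..<r} - {i}. M $$ (l, j))"
      "col_sum r M' j = M' $$ (i, j) + (\<Sum>l\<in>{..<r} - {i}. M' $$ (l, j))"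
      unfolding col_sum_def using ij by (auto intro: sum.remove)
    moreover have "(\<Sum>l\<in>{..<r} - {i}. M' $$ (l, j)) = (\<Sum>l\<in>{..<r} - {i}. M $$ (l, j))"
      using ij by (intro sum.cong) (auto simp: M'_entry)
    ultimately show ?thesis using True ij M'_entry[OF mem] by simp
  next
    case False
    then show ?thesis using that by (simp add: col_sum_def M'_entry)
  qed
  have idx: "indexed_products n r ((row_sum r M')(i := Suc (row_sum r M' i))) ((col_sum r M')(j := Suc (col_sum r M' j)))
      = indexed_products n r (row_sum r M) (col_sum r M)"
    unfolding indexed_products_def using row col by simp
  have "(\<lambda>gs. ((gs ! i) $$ (0, k) * gl_inv (gs ! j) $$ (k, n - 1)) * pairing_product n r M' gs)
      \<in> fspan X (indexed_products n r (row_sum r M) (col_sum r M))" if k: "k < n" for k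
  proof (rule fspan_mult[OF IH])
    fix m assume "m \<in> indexed_products n r (row_sum r M') (col_sum r M')"
    from indexed_products_mult_row[OF indexed_products_mult_col[OF this ij(2) k] ij(1) k]
    show "(\<lambda>gs. ((gs ! i) $$ (0, k) * gl_inv (gs ! j) $$ (k, n - 1)) * m gs)
      \<in> fspan X (indexed_products n r (row_sum r M) (col_sum r M))"
      unfolding idx by (rule fspan_cong[OF fspan_base]) (simp add: mult.assoc)
  qed
  then have "(\<lambda>gs. \<Sum>k<n. ((gs ! i) $$ (0, k) * gl_inv (gs ! j) $$ (k, n - 1)) * pairing_product n r M' gs)
      \<in> fspan X (indexed_products n r (row_sum r M) (col_sum r M))"
    by (intro fspan_sum) auto
  then show ?case
  proof (rule fspan_cong)
    fix gs
    have rest: "(\<Prod>p\<in>{..<r} \<times> {..<r} - {(i, j)}. pairing n gs (fst p) (snd p) ^ (M $$ p)) =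
        (\<Prod>p\<in>{..<r} \<times> {..<r} - {(i, j)}. pairing n gs (fst p) (snd p) ^ (M' $$ p))"
      by (intro prod.cong) (auto simp: M'_entry)
    have "pairing n gs i j ^ (M $$ (i, j)) = pairing n gs i j * pairing n gs i j ^ (M' $$ (i, j))"
      using ij(3) by (simp add: M'_entry[OF mem] flip: power_Suc)
    then have "pairing_product n r M gs = pairing n gs i j * pairing_product n r M' gs"
      unfolding pairing_product_def using rest by (simp add: prod.remove[OF _ mem] mult.assoc)
    then show "pairing_product n r M gs =
        (\<Sum>k<n. ((gs ! i) $$ (0, k) * gl_inv (gs ! j) $$ (k, n - 1)) * pairing_product n r M' gs)"
      by (simp add: pairing_def sum_distrib_right)
  qed
qed

section \<open>Linear independence\<close>

lemma permutation_matrix: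
  assumes \<sigma>: "\<sigma> permutes {..<n}"
  defines "P \<equiv> \<lambda>\<sigma>. mat n n (\<lambda>(k, l). if l = \<sigma> k then 1 else (0::complex))"
  shows "P \<sigma> * P (inv_into UNIV \<sigma>) = 1\<^sub>m n"
proof (rule eq_matI)
  fix k l assume "k < dim_row (1\<^sub>m n)" "l < dim_col (1\<^sub>m n)"
  then have kl: "k < n" "l < n" by auto
  have P: "P s \<in> carrier_mat n n" for s by (simp add: P_def)
  have \<sigma>k: "\<sigma> k < n" using permutes_in_image[OF \<sigma>, of k] kl by simp
  have "(P \<sigma> * P (inv_into UNIV \<sigma>)) $$ (k, l) = (\<Sum>t<n. if t = \<sigma> k then (if l = inv_into UNIV \<sigma> t then 1 else 0) else 0)"
    unfolding mat_mult_entry[OF P P kl] using kl by (intro sum.cong) (auto simp: P_def)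
  also have "\<dots> = (if l = k then 1 else 0)"
    using \<sigma>k by (simp add: permutes_inverses(2)[OF \<sigma>])
  finally show "(P \<sigma> * P (inv_into UNIV \<sigma>)) $$ (k, l) = 1\<^sub>m n $$ (k, l)" using kl by simp
qed (auto simp: P_def)

text \<open>A permutation matrix moves the first unit vector to the \<open>i\<close>-th and the last to the \<open>l\<close>-th. It is followed by a
matrix \<open>h\<close> that sends \<open>q\<close> to the \<open>l\<close>-th unit vector and whose \<open>i\<close>-th row is a unit vector.\<close>

lemma exists_frame:
  assumes n: "n \<ge> 2" and il: "i < n" "l < n" "i \<noteq> l" and q: "q i = (0::complex)" "q l = 1"
  shows "\<exists>g\<in>carrier (GL n). (\<forall>k<n. g $$ (0, k) = (if k = i then 1 else 0)) \<and>
    (\<forall>k<n. gl_inv g $$ (k, n - 1) = q k)"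
proof -
  define \<tau> where "\<tau> = Transposition.transpose 0 i"
  define \<sigma> where "\<sigma> = Transposition.transpose (\<tau> (n - 1)) l \<circ> \<tau>"
  have \<tau>n: "\<tau> (n - 1) < n" "\<tau> (n - 1) \<noteq> i" using n il by (auto simp: \<tau>_def Transposition.transpose_def)
  have \<sigma>: "\<sigma> permutes {..<n}"
    unfolding \<sigma>_def \<tau>_def using n il \<tau>n unfolding \<tau>_def
    by (intro permutes_compose permutes_swap_id) auto
  have \<sigma>0: "\<sigma> 0 = i" and \<sigma>n: "\<sigma> (n - 1) = l"
    using il \<tau>n by (auto simp: \<sigma>_def \<tau>_def Transposition.transpose_def)
  define P where "P = (\<lambda>\<sigma>. mat n n (\<lambda>(k, l). if l = \<sigma> k then 1 else (0::complex)))"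
  define h where "h = mat n n (\<lambda>(k, c). if c = l then (if k = l then 1 else - q k) else if k = c then 1 else 0)"
  define K where "K = mat n n (\<lambda>(k, c). if c = l then q k else if k = c then 1 else 0)"
  have C: "P \<sigma> \<in> carrier_mat n n" "P (inv_into UNIV \<sigma>) \<in> carrier_mat n n" "h \<in> carrier_mat n n" "K \<in> carrier_mat n n"
    by (auto simp: P_def h_def K_def)
  have hK: "h * K = 1\<^sub>m n"
  proof (rule eq_matI)
    fix a c assume "a < dim_row (1\<^sub>m n)" "c < dim_col (1\<^sub>m n)"
    then have ac: "a < n" "c < n" by auto
    have "(h * K) $$ (a, c) = (\<Sum>t<n. (if t = a then (if t = l then 0 else K $$ (t, c)) else 0) +
        (if t = l then h $$ (a, l) * K $$ (l, c) else 0))"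
      unfolding mat_mult_entry[OF C(3,4) ac] using ac il
      by (intro sum.cong) (auto simp: h_def)
    also have "\<dots> = (if a = l then 0 else K $$ (a, c)) + h $$ (a, l) * K $$ (l, c)"
      using ac il by (simp add: sum.distrib)
    also have "\<dots> = 1\<^sub>m n $$ (a, c)"
      using ac il q by (auto simp: h_def K_def)
    finally show "(h * K) $$ (a, c) = 1\<^sub>m n $$ (a, c)" .
  qed (auto simp: h_def K_def)
  have inv: "(P \<sigma> * h) * (K * P (inv_into UNIV \<sigma>)) = 1\<^sub>m n"
  proof -
    have "(P \<sigma> * h) * (K * P (inv_into UNIV \<sigma>)) = P \<sigma> * ((h * K) * P (inv_into UNIV \<sigma>))"
      using C by (simp add: assoc_mult_mat[of _ n n _ n _ n] mult_carrier_mat[of _ n n _ n])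
    also have "\<dots> = 1\<^sub>m n"
      using C permutation_matrix[OF \<sigma>] unfolding hK by (simp add: P_def)
    finally show ?thesis .
  qed
  note G = GL_of_inverse[OF mult_carrier_mat[OF C(1,3)] mult_carrier_mat[OF C(4,2)] inv]
  have "(P \<sigma> * h) $$ (0, k) = (if k = i then 1 else 0)" if k: "k < n" for k
  proof -
    have "(P \<sigma> * h) $$ (0, k) = (\<Sum>t<n. if t = i then h $$ (t, k) else 0)"
      using n k by (intro trans[OF mat_mult_entry[OF C(1,3)] sum.cong]) (auto simp: P_def \<sigma>0)
    then show ?thesis using k il q by (auto simp: h_def)
  qed
  moreover have "(K * P (inv_into UNIV \<sigma>)) $$ (k, n - 1) = q k" if k: "k < n" for k
  proof -
    have inv\<sigma>: "n - 1 = inv_into UNIV \<sigma> t \<longleftrightarrow> t = l" for t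
      using \<sigma>n permutes_inverses[OF \<sigma>] by metis
    have "(K * P (inv_into UNIV \<sigma>)) $$ (k, n - 1) = (\<Sum>t<n. if t = l then K $$ (k, t) else 0)"
      using n k inv\<sigma> by (intro trans[OF mat_mult_entry[OF C(4,2)] sum.cong]) (auto simp: P_def)
    then show ?thesis using k il by (simp add: K_def)
  qed
  ultimately show ?thesis using G by (intro bexI[of _ "P \<sigma> * h"]) auto
qed

text \<open>Take the \<open>i\<close>-th unit vector for \<open>p\<^sub>i\<close> and the column of prescribed values for \<open>q\<^sub>j\<close>. The
additional entry \<open>1\<close> in position \<open>r + j\<close> keeps \<open>q\<^sub>j\<close> nonzero without changing any pairing; this is where
\<open>n \<ge> 2 * r\<close> provides room.\<close>

lemma exists_prescribed_pairings:
  fixes y :: "nat \<Rightarrow> nat \<Rightarrow> complex"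
  assumes n: "n \<ge> 2" "n \<ge> 2 * r"
  shows "\<exists>gs\<in>GL_tuples n r. \<forall>i<r. \<forall>j<r. i \<noteq> j \<longrightarrow> pairing n gs i j = y i j"
proof -
  define q where "q = (\<lambda>j k. if k = r + j then 1 else if k < r \<and> k \<noteq> j then y k j else 0)"
  have "\<forall>j<r. \<exists>g\<in>carrier (GL n). (\<forall>k<n. g $$ (0, k) = (if k = j then 1 else 0)) \<and>
      (\<forall>k<n. gl_inv g $$ (k, n - 1) = q j k)"
    using n by (intro allI impI exists_frame[where l = "r + j" for j]) (auto simp: q_def)
  then obtain G where G: "\<And>j. j < r \<Longrightarrow> G j \<in> carrier (GL n)"
    "\<And>j k. j < r \<Longrightarrow> k < n \<Longrightarrow> G j $$ (0, k) = (if k = j then 1 else 0)"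
    "\<And>j k. j < r \<Longrightarrow> k < n \<Longrightarrow> gl_inv (G j) $$ (k, n - 1) = q j k"
    by metis
  have "pairing n (map G [0..<r]) i j = y i j" if ij: "i < r" "j < r" "i \<noteq> j" for i j
  proof -
    have "pairing n (map G [0..<r]) i j = (\<Sum>k<n. if k = i then q j k else 0)"
      unfolding pairing_def using ij G by (intro sum.cong) auto
    then show ?thesis using ij n by (simp add: q_def)
  qed
  then show ?thesis using G(1) by (intro bexI[of _ "map G [0..<r]"]) (auto simp: GL_tuples_def)
qed

definition hollow_matrices :: "nat \<Rightarrow> nat mat set" where
  "hollow_matrices r = {M \<in> carrier_mat r r. hollow M}"

text \<open>Distinct monomials are distinct multiplicative characters, and such characters are linearly independent
by Dedekind's argument: subtracting a translate of a relation from a multiple of it eliminates one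
character.\<close>

lemma monomials_independent:
  fixes c :: "nat mat \<Rightarrow> complex"
  assumes "finite S" "S \<subseteq> hollow_matrices r"
    and "\<And>y :: nat \<times> nat \<Rightarrow> complex. (\<Sum>M\<in>S. c M * (\<Prod>p\<in>{..<r} \<times> {..<r}. y p ^ (M $$ p))) = 0"
    and "M \<in> S"
  shows "c M = 0"
  using assms
proof (induction S arbitrary: c M rule: finite_induct)
  case empty
  then show ?case by simp
next
  case (insert M0 S)
  let ?\<chi> = "\<lambda>M (y :: nat \<times> nat \<Rightarrow> complex). \<Prod>p\<in>{..<r} \<times> {..<r}. y p ^ (M $$ p)"
  have S0: "c M1 = 0" if M1: "M1 \<in> S" for M1
  proof -
    have car: "M1 \<in> carrier_mat r r" "M0 \<in> carrier_mat r r" "M1 \<noteq> M0"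
      using insert.prems(1) insert.hyps(2) M1 by (auto simp: hollow_matrices_def)
    then obtain i j where ij: "i < r" "j < r" "M1 $$ (i, j) \<noteq> M0 $$ (i, j)"
      by (metis carrier_matD eq_matI)
    \<comment> \<open>a point at which the characters of \<open>M1\<close> and \<open>M0\<close> differ\<close>
    define w where "w = (\<lambda>p. if p = (i, j) then 2 else (1::complex))"
    have \<chi>w: "?\<chi> M w = 2 ^ (M $$ (i, j))" for M
    proof -
      have "?\<chi> M w = (\<Prod>p\<in>{..<r} \<times> {..<r}. if p = (i, j) then 2 ^ (M $$ p) else 1)"
        by (intro prod.cong) (auto simp: w_def)
      then show ?thesis using ij by simp
    qed
    have mult: "?\<chi> M (\<lambda>p. w p * y p) = ?\<chi> M w * ?\<chi> M y" for M y
      by (simp add: power_mult_distrib prod.distrib)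
    have "(c M1 * (?\<chi> M1 w - ?\<chi> M0 w)) = 0"
    proof (rule insert.IH[of "\<lambda>M. c M * (?\<chi> M w - ?\<chi> M0 w)" M1])
      fix y :: "nat \<times> nat \<Rightarrow> complex"
      have "(\<Sum>M\<in>insert M0 S. c M * ?\<chi> M (\<lambda>p. w p * y p)) - ?\<chi> M0 w * (\<Sum>M\<in>insert M0 S. c M * ?\<chi> M y) = 0"
        unfolding insert.prems(2) by simp
      also have "(\<Sum>M\<in>insert M0 S. c M * ?\<chi> M (\<lambda>p. w p * y p)) - ?\<chi> M0 w * (\<Sum>M\<in>insert M0 S. c M * ?\<chi> M y)
          = (\<Sum>M\<in>insert M0 S. c M * (?\<chi> M w - ?\<chi> M0 w) * ?\<chi> M y)"
        unfolding mult sum_distrib_left sum_subtractf[symmetric] by (simp add: algebra_simps)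
      also have "\<dots> = (\<Sum>M\<in>S. c M * (?\<chi> M w - ?\<chi> M0 w) * ?\<chi> M y)"
        using insert.hyps by simp
      finally show "(\<Sum>M\<in>S. c M * (?\<chi> M w - ?\<chi> M0 w) * ?\<chi> M y) = 0" .
    qed (use insert.prems M1 in auto)
    moreover have "?\<chi> M1 w - ?\<chi> M0 w \<noteq> 0"
    proof
      assume "?\<chi> M1 w - ?\<chi> M0 w = 0"
      then have "of_nat (2 ^ (M1 $$ (i, j))) = (of_nat (2 ^ (M0 $$ (i, j))) :: complex)" by (simp add: \<chi>w)
      then have "(2::nat) ^ (M1 $$ (i, j)) = 2 ^ (M0 $$ (i, j))" by (simp only: of_nat_eq_iff)
      then show False using ij(3) by simp
    qed
    ultimately show ?thesis by simp
  qed
  have "c M0 = 0"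
    using insert.prems(2)[of "\<lambda>_. 1"] insert.hyps S0 by simp
  then show ?case using S0 insert.prems(3) by auto
qed

lemma pairing_products_independent:
  assumes n: "n \<ge> 2" "n \<ge> 2 * r" and S: "finite S" "S \<subseteq> hollow_matrices r"
    and zero: "\<And>gs. gs \<in> GL_tuples n r \<Longrightarrow> (\<Sum>M\<in>S. c M * pairing_product n r M gs) = 0"
    and M: "M \<in> S"
  shows "c M = 0"
proof (rule monomials_independent[where c = c, OF S _ M])
  fix y :: "nat \<times> nat \<Rightarrow> complex"
  obtain gs where gs: "gs \<in> GL_tuples n r" "\<And>i j. i < r \<Longrightarrow> j < r \<Longrightarrow> i \<noteq> j \<Longrightarrow> pairing n gs i j = y (i, j)"
    using exists_prescribed_pairings[OF n, of "\<lambda>i j. y (i, j)"] by blast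
  have "pairing_product n r M gs = (\<Prod>p\<in>{..<r} \<times> {..<r}. y p ^ (M $$ p))" if "M \<in> S" for M
    unfolding pairing_product_def
  proof (rule prod.cong[OF refl])
    fix p assume "p \<in> {..<r} \<times> {..<r}"
    then obtain i j where ij: "p = (i, j)" "i < r" "j < r" by auto
    have "M $$ (i, i) = 0" using S(2) that ij by (auto simp: hollow_matrices_def hollow_def)
    then show "pairing n gs (fst p) (snd p) ^ (M $$ p) = y p ^ (M $$ p)"
      using gs(2)[of i j] ij by (cases "i = j") auto
  qed
  then show "(\<Sum>M\<in>S. c M * (\<Prod>p\<in>{..<r} \<times> {..<r}. y p ^ (M $$ p))) = 0"
    using zero[OF gs(1)] by simp
qed

section \<open>Homogeneity\<close>

lemma torus_exists:
  assumes "n \<ge> 2" "s \<noteq> 0" "t \<noteq> 0"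
  shows "\<exists>u. torus n u \<and> u $$ (0, 0) = s \<and> u $$ (n - 1, n - 1) = inverse t"
proof -
  let ?d = "\<lambda>k. if k = 0 then s else if k = n - 1 then inverse t else 1"
  have "torus n (mat n n (\<lambda>(k, l). if k = l then ?d k else 0))"
    using assms by (intro diagonal_torus) auto
  then show ?thesis using assms by (intro exI conjI) auto
qed

lemma monomial_torus:
  assumes n: "n \<ge> 1" and u: "torus n u" and g: "g \<in> carrier (GL n)"
    and AB: "A \<in> indices n a" "B \<in> indices n b"
  shows "monomial n A B (u * g) = torus_weight n a b u * monomial n A B g"
proof -
  have uG: "u \<in> carrier (GL n)" using u by (simp add: torus_def)
  have A: "(\<Prod>k\<in>#A. (u * g) $$ (0, k)) = (u $$ (0, 0)) ^ a * (\<Prod>k\<in>#A. g $$ (0, k))"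
  proof -
    have "image_mset (\<lambda>k. (u * g) $$ (0, k)) A = image_mset (\<lambda>k. u $$ (0, 0) * g $$ (0, k)) A"
      using AB(1) n by (intro image_mset_cong torus_mult[OF GL_carrier[OF g] u]) (auto simp: indices_def)
    then show ?thesis using AB(1) by (simp add: prod_mset.distrib indices_def)
  qed
  have B: "(\<Prod>k\<in>#B. gl_inv (u * g) $$ (k, n - 1)) =
      inverse (u $$ (n - 1, n - 1)) ^ b * (\<Prod>k\<in>#B. gl_inv g $$ (k, n - 1))"
  proof -
    have "image_mset (\<lambda>k. gl_inv (u * g) $$ (k, n - 1)) B =
        image_mset (\<lambda>k. inverse (u $$ (n - 1, n - 1)) * gl_inv g $$ (k, n - 1)) B"
      using AB(2) n mult_torus[OF GL_carrier[OF gl_inv_GL[OF g]] torus_gl_inv[OF u]]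
      by (intro image_mset_cong) (auto simp: indices_def gl_inv_mult[OF uG g] torus_diag_nonzero(2)[OF u])
    then show ?thesis using AB(2) by (simp add: prod_mset.distrib indices_def)
  qed
  show ?thesis unfolding monomial_def A B by (simp add: torus_weight_def)
qed

text \<open>Left multiplication of \<open>g\<^sub>i\<close> by a torus element scales \<open>p\<^sub>i\<close> and \<open>q\<^sub>i\<close> and leaves the other
arguments alone. Two such scalings read off the degrees.\<close>

lemma span_homogeneous:
  assumes n: "n \<ge> 1" and u: "torus n u" and gs: "gs \<in> GL_tuples n r" and i: "i < r"
    and f: "f \<in> fspan (GL_tuples n r) (indexed_products n r \<alpha> \<beta>)"
  shows "f (gs[i := u * gs ! i]) = torus_weight n (\<alpha> i) (\<beta> i) u * f gs"
proof -
  have len: "length gs = r" and G: "\<And>j. j < r \<Longrightarrow> gs ! j \<in> carrier (GL n)"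
    using gs by (auto simp: GL_tuples_def)
  have uG: "u \<in> carrier (GL n)" using u by (simp add: torus_def)
  have mem: "gs[i := u * gs ! i] \<in> GL_tuples n r"
    using gs GL_mult[OF uG G[OF i]] set_update_subset_insert[of gs i] by (auto simp: GL_tuples_def)
  show ?thesis
    using f
  proof induction
    case (zero f)
    then show ?case using mem gs by simp
  next
    case (step h m f c)
    obtain A B where m: "m = (\<lambda>gs. \<Prod>i<r. monomial n (A i) (B i) (gs ! i))"
      "\<forall>i<r. A i \<in> indices n (\<alpha> i) \<and> B i \<in> indices n (\<beta> i)"
      using step.hyps(2) by (auto simp: indexed_products_def)
    have "m (gs[i := u * gs ! i]) = monomial n (A i) (B i) (u * gs ! i) *
        (\<Prod>l\<in>{..<r} - {i}. monomial n (A l) (B l) (gs ! l))"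
    proof -
      have "(\<Prod>l\<in>{..<r} - {i}. monomial n (A l) (B l) (gs[i := u * gs ! i] ! l)) =
          (\<Prod>l\<in>{..<r} - {i}. monomial n (A l) (B l) (gs ! l))"
        by (intro prod.cong) auto
      then show ?thesis using i len by (simp add: m(1) prod.remove[of "{..<r}" i])
    qed
    also have "\<dots> = torus_weight n (\<alpha> i) (\<beta> i) u * m gs"
      using i m(2) by (simp add: m(1) prod.remove[of "{..<r}" i] monomial_torus[OF n u G])
    finally show ?case using step mem gs by (simp add: algebra_simps)
  qed
qed

section \<open>All invariants are spanned by products of pairings\<close>

text \<open>Right translation by the inverse of this matrix turns \<open>p\<^sub>i\<close> into the \<open>i\<close>-th unit vector, and turns \<open>q\<^sub>j\<close> into the
vector whose first \<open>r\<close> coordinates are the pairings \<open>z\<^sub>k\<^sub>j\<close> while the others carry a factor \<open>e\<close>.\<close>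

definition frame :: "nat \<Rightarrow> nat \<Rightarrow> complex mat list \<Rightarrow> complex \<Rightarrow> complex mat" where
  "frame n r gs e = mat n n (\<lambda>(k, l). if k < r then (gs ! k) $$ (0, l) else if k = l then e else 0)"

lemma frame_GL:
  assumes "det (frame n r gs 1) \<noteq> 0" "e \<noteq> 0"
  shows "frame n r gs e \<in> carrier (GL n)"
proof -
  let ?D = "mat n n (\<lambda>(k, l). if k = l then if k < r then 1 else e else 0)"
  have D: "torus n ?D" using assms(2) by (intro diagonal_torus) auto
  have F: "frame n r gs 1 \<in> carrier_mat n n" by (simp add: frame_def)
  have "?D * frame n r gs 1 = frame n r gs e"
  proof (rule eq_matI)
    fix k l assume "k < dim_row (frame n r gs e)" "l < dim_col (frame n r gs e)"
    then have kl: "k < n" "l < n" by (auto simp: frame_def)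
    show "(?D * frame n r gs 1) $$ (k, l) = frame n r gs e $$ (k, l)"
      unfolding torus_mult[OF F D kl] using kl by (simp add: frame_def)
  qed (auto simp: frame_def)
  moreover have "?D * frame n r gs 1 \<in> carrier (GL n)"
    using D F assms(1) by (intro GL_mult) (auto simp: torus_def GL_iff)
  ultimately show ?thesis by simp
qed

lemma frame_row:
  assumes G: "frame n r gs e \<in> carrier (GL n)" and gs: "gs \<in> GL_tuples n r"
    and i: "i < r" "r \<le> n" and k: "k < n"
  shows "(gs ! i * gl_inv (frame n r gs e)) $$ (0, k) = (if k = i then 1 else 0)"
proof -
  have "gs ! i \<in> carrier (GL n)" using gs i by (auto simp: GL_tuples_def)
  then have g: "gs ! i \<in> carrier_mat n n" by (rule GL_carrier)
  note T = GL_carrier[OF gl_inv_GL[OF G]]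
  have "(gs ! i * gl_inv (frame n r gs e)) $$ (0, k) = (frame n r gs e * gl_inv (frame n r gs e)) $$ (i, k)"
  proof -
    have "(frame n r gs e * gl_inv (frame n r gs e)) $$ (i, k) =
        (\<Sum>l<n. frame n r gs e $$ (i, l) * gl_inv (frame n r gs e) $$ (l, k))"
      using i k by (intro mat_mult_entry[OF GL_carrier[OF G] T]) auto
    also have "\<dots> = (\<Sum>l<n. (gs ! i) $$ (0, l) * gl_inv (frame n r gs e) $$ (l, k))"
      using i by (intro sum.cong) (auto simp: frame_def)
    also have "\<dots> = (gs ! i * gl_inv (frame n r gs e)) $$ (0, k)"
      using k by (intro mat_mult_entry[OF g T, symmetric]) auto
    finally show ?thesis by simp
  qed
  then show ?thesis using i k by (auto simp: gl_inv_right[OF G])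
qed

lemma frame_col:
  assumes G: "frame n r gs e \<in> carrier (GL n)" and gs: "gs \<in> GL_tuples n r"
    and j: "j < r" "r \<le> n" and k: "k < n"
  shows "gl_inv (gs ! j * gl_inv (frame n r gs e)) $$ (k, n - 1) =
    (if k < r then pairing n gs k j else e * gl_inv (gs ! j) $$ (k, n - 1))"
proof -
  have g: "gs ! j \<in> carrier (GL n)" using gs j by (auto simp: GL_tuples_def)
  have "gl_inv (gs ! j * gl_inv (frame n r gs e)) = frame n r gs e * gl_inv (gs ! j)"
    by (simp add: gl_inv_mult[OF g gl_inv_GL[OF G]] gl_inv_gl_inv[OF G])
  moreover have "(frame n r gs e * gl_inv (gs ! j)) $$ (k, n - 1) =
      (\<Sum>l<n. frame n r gs e $$ (k, l) * gl_inv (gs ! j) $$ (l, n - 1))"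
    using k by (intro mat_mult_entry[OF GL_carrier[OF G] GL_carrier[OF gl_inv_GL[OF g]]]) auto
  moreover have "(\<Sum>l<n. frame n r gs e $$ (k, l) * gl_inv (gs ! j) $$ (l, n - 1)) =
      (if k < r then pairing n gs k j else e * gl_inv (gs ! j) $$ (k, n - 1))"
  proof (cases "k < r")
    case True
    then show ?thesis using k by (auto simp: frame_def pairing_def)
  next
    case False
    then have "(\<Sum>l<n. frame n r gs e $$ (k, l) * gl_inv (gs ! j) $$ (l, n - 1)) =
        (\<Sum>l<n. if l = k then e * gl_inv (gs ! j) $$ (l, n - 1) else 0)"
      using k by (intro sum.cong) (auto simp: frame_def)
    then show ?thesis using False k by simp
  qed
  ultimately show ?thesis by simp
qed

lemma pairing_diagonal:
  assumes "gs \<in> GL_tuples n r" "i < r" "n \<ge> 2"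
  shows "pairing n gs i i = 0"
proof -
  have "gs ! i \<in> carrier (GL n)" using assms by (auto simp: GL_tuples_def)
  then show ?thesis using assms by (simp add: pairing_eq[OF assms(1,2,2)] gl_inv_right[of _ n])
qed

lemma tendsto_prod_mset:
  fixes f :: "'a \<Rightarrow> 'b \<Rightarrow> complex"
  assumes "\<And>k. k \<in># A \<Longrightarrow> ((\<lambda>x. f x k) \<longlongrightarrow> l k) fl"
  shows "((\<lambda>x. \<Prod>k\<in>#A. f x k) \<longlongrightarrow> (\<Prod>k\<in>#A. l k)) fl"
  using assms by (induction A) (auto intro: tendsto_mult)

lemma prod_pairings_eq_pairing_product:
  assumes "\<And>i. i < r \<Longrightarrow> set_mset (B i) \<subseteq> {..<r}"
  shows "(\<Prod>i<r. \<Prod>k\<in>#B i. pairing n gs k i) =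
    pairing_product n r (mat r r (\<lambda>(k, i). count (B i) k)) gs"
proof -
  have "(\<Prod>k\<in>#B i. pairing n gs k i) = (\<Prod>k<r. pairing n gs k i ^ count (B i) k)" if "i < r" for i
    unfolding image_prod_mset_multiplicity
    using assms[OF that] by (intro prod.mono_neutral_left) (auto simp: not_in_iff)
  then have "(\<Prod>i<r. \<Prod>k\<in>#B i. pairing n gs k i) = (\<Prod>i<r. \<Prod>k<r. pairing n gs k i ^ count (B i) k)"
    by simp
  also have "\<dots> = (\<Prod>k<r. \<Prod>i<r. pairing n gs k i ^ count (B i) k)" by (rule prod.swap)
  also have "\<dots> = (\<Prod>(k, i)\<in>{..<r} \<times> {..<r}. pairing n gs k i ^ count (B i) k)"
    by (rule prod.cartesian_product)
  also have "\<dots> = pairing_product n r (mat r r (\<lambda>(k, i). count (B i) k)) gs"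
    unfolding pairing_product_def by (intro prod.cong) auto
  finally show ?thesis .
qed

text \<open>After the translation a monomial is a constant times a product of pairings and of coordinates that tend to
\<open>0\<close>. The limit is zero if one of the latter or a diagonal pairing occurs.\<close>

lemma degeneration_limit_base:
  assumes n: "n \<ge> 2" "r \<le> n" and m: "m \<in> indexed_products n r \<alpha> \<beta>"
  shows "\<exists>h\<in>fspan (GL_tuples n r) (pairing_product n r ` hollow_matrices r).
    \<forall>gs\<in>GL_tuples n r. det (frame n r gs 1) \<noteq> 0 \<longrightarrow>
      ((\<lambda>e. m (map (\<lambda>g. g * gl_inv (frame n r gs e)) gs)) \<longlongrightarrow> h gs) (at 0)"
proof -
  obtain A B where AB: "m = (\<lambda>gs. \<Prod>i<r. monomial n (A i) (B i) (gs ! i))"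
    "\<And>i. i < r \<Longrightarrow> A i \<in> indices n (\<alpha> i)" "\<And>i. i < r \<Longrightarrow> B i \<in> indices n (\<beta> i)"
    using m by (auto simp: indexed_products_def)
  \<comment> \<open>the value of the \<open>p\<close>-part once every \<open>p\<^sub>i\<close> is the \<open>i\<close>-th unit vector\<close>
  define a where "a = (\<Prod>i<r. \<Prod>k\<in>#A i. if k = i then 1 else (0::complex))"
  define h where "h = (\<lambda>gs. a * (\<Prod>i<r. \<Prod>k\<in>#B i. if k < r then pairing n gs k i else 0))"
  have lim: "((\<lambda>e. m (map (\<lambda>g. g * gl_inv (frame n r gs e)) gs)) \<longlongrightarrow> h gs) (at 0)"
    if gs: "gs \<in> GL_tuples n r" and det: "det (frame n r gs 1) \<noteq> 0" for gs
  proof -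
    have len: "length gs = r" using gs by (simp add: GL_tuples_def)
    define p where "p = (\<lambda>e. a * (\<Prod>i<r. \<Prod>k\<in>#B i. if k < r then pairing n gs k i else e * gl_inv (gs ! i) $$ (k, n - 1)))"
    have "(p \<longlongrightarrow> h gs) (at 0)"
      unfolding p_def h_def
    proof (intro tendsto_mult tendsto_const tendsto_prod tendsto_prod_mset)
      show "((\<lambda>e. if k < r then pairing n gs k i else e * gl_inv (gs ! i) $$ (k, n - 1)) \<longlongrightarrow>
         (if k < r then pairing n gs k i else 0)) (at 0)" for i k
        by (cases "k < r") (auto intro!: tendsto_eq_intros)
    qed
    moreover have "\<forall>\<^sub>F e in at (0::complex). e \<noteq> 0" by (simp add: eventually_at_filter)
    then have "\<forall>\<^sub>F e in at 0. p e = m (map (\<lambda>g. g * gl_inv (frame n r gs e)) gs)"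
    proof eventually_elim
      case (elim e)
      note G = frame_GL[OF det elim]
      have "monomial n (A i) (B i) (gs ! i * gl_inv (frame n r gs e)) =
          (\<Prod>k\<in>#A i. if k = i then 1 else 0) *
          (\<Prod>k\<in>#B i. if k < r then pairing n gs k i else e * gl_inv (gs ! i) $$ (k, n - 1))" if i: "i < r" for i
      proof -
        have "image_mset (\<lambda>k. (gs ! i * gl_inv (frame n r gs e)) $$ (0, k)) (A i) =
            image_mset (\<lambda>k. if k = i then 1 else 0) (A i)"
          using AB(2)[OF i] by (intro image_mset_cong frame_row[OF G gs i n(2)]) (auto simp: indices_def)
        moreover have "image_mset (\<lambda>k. gl_inv (gs ! i * gl_inv (frame n r gs e)) $$ (k, n - 1)) (B i) =
            image_mset (\<lambda>k. if k < r then pairing n gs k i else e * gl_inv (gs ! i) $$ (k, n - 1)) (B i)"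
          using AB(3)[OF i] by (intro image_mset_cong frame_col[OF G gs i n(2)]) (auto simp: indices_def)
        ultimately show ?thesis unfolding monomial_def by simp
      qed
      then show ?case using len by (simp add: AB(1) p_def a_def prod.distrib)
    qed
    ultimately show ?thesis by (rule Lim_transform_eventually)
  qed
  have "h \<in> fspan (GL_tuples n r) (pairing_product n r ` hollow_matrices r)"
  proof (cases "\<forall>i<r. \<forall>k\<in>#B i. k < r \<and> k \<noteq> i")
    case True
    define M where "M = mat r r (\<lambda>(k, i). count (B i) k)"
    have "M \<in> hollow_matrices r"
      using True by (auto simp: hollow_matrices_def hollow_def M_def not_in_iff[symmetric])
    then have "(\<lambda>gs. a * pairing_product n r M gs) \<in> fspan (GL_tuples n r) (pairing_product n r ` hollow_matrices r)"
      by (intro fspan_scaled fspan_base imageI)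
    then show ?thesis
    proof (rule fspan_cong)
      fix gs
      have "image_mset (\<lambda>k. if k < r then pairing n gs k i else 0) (B i) = image_mset (\<lambda>k. pairing n gs k i) (B i)"
        if "i < r" for i
        using True that by (intro image_mset_cong) auto
      then have "h gs = a * (\<Prod>i<r. \<Prod>k\<in>#B i. pairing n gs k i)" by (simp add: h_def)
      also have "(\<Prod>i<r. \<Prod>k\<in>#B i. pairing n gs k i) = pairing_product n r M gs"
        unfolding M_def using True by (intro prod_pairings_eq_pairing_product) auto
      finally show "h gs = a * pairing_product n r M gs" .
    qed
  next
    case False
    then obtain i k where ik: "i < r" "k \<in># B i" "\<not> k < r \<or> k = i" by blast
    have "h gs = 0" if gs: "gs \<in> GL_tuples n r" for gs
    proof -
      define p where "p = (\<lambda>k. if k < r then pairing n gs k i else 0)"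
      have "0 = p k"
        using ik pairing_diagonal[OF gs ik(1) n(1)] by (auto simp: p_def)
      from image_eqI[where f = p, OF this ik(2)] have "0 \<in># image_mset p (B i)" by (simp only: set_image_mset)
      then have "(\<Prod>k\<in>#B i. p k) = 0" by (simp only: prod_mset_zero_iff)
      then have "(\<Prod>i<r. \<Prod>k\<in>#B i. if k < r then pairing n gs k i else 0) = 0"
        using ik(1) by (intro prod_zero) (auto simp: p_def)
      then show ?thesis unfolding h_def by simp
    qed
    then show ?thesis by (intro fspan.zero) auto
  qed
  then show ?thesis using lim by blast
qed

lemma degeneration_limit:
  assumes n: "n \<ge> 2" "r \<le> n" and f: "f \<in> fspan (GL_tuples n r) (indexed_products n r \<alpha> \<beta>)"
  shows "\<exists>h\<in>fspan (GL_tuples n r) (pairing_product n r ` hollow_matrices r).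
    \<forall>gs\<in>GL_tuples n r. det (frame n r gs 1) \<noteq> 0 \<longrightarrow>
      ((\<lambda>e. f (map (\<lambda>g. g * gl_inv (frame n r gs e)) gs)) \<longlongrightarrow> h gs) (at 0)"
proof -
  have mem: "\<forall>\<^sub>F e in at 0. map (\<lambda>g. g * gl_inv (frame n r gs e)) gs \<in> GL_tuples n r"
    if gs: "gs \<in> GL_tuples n r" and det: "det (frame n r gs 1) \<noteq> 0" for gs
  proof -
    have "\<forall>\<^sub>F e in at (0::complex). e \<noteq> 0" by (simp add: eventually_at_filter)
    then show ?thesis
      by eventually_elim (rule map_translate_GL_tuples[OF gs gl_inv_GL[OF frame_GL[OF det]]])
  qed
  show ?thesis
    using f
  proof induction
    case (zero f)
    show ?case
    proof (intro bexI[of _ "\<lambda>_. 0"] ballI impI)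
      fix gs assume gs: "gs \<in> GL_tuples n r" "det (frame n r gs 1) \<noteq> 0"
      have "\<forall>\<^sub>F e in at 0. 0 = f (map (\<lambda>g. g * gl_inv (frame n r gs e)) gs)"
        using mem[OF gs] by eventually_elim (use zero in simp)
      then show "((\<lambda>e. f (map (\<lambda>g. g * gl_inv (frame n r gs e)) gs)) \<longlongrightarrow> 0) (at 0)"
        by (rule Lim_transform_eventually[OF tendsto_const])
    qed simp
  next
    case (step p m f c)
    obtain h where h: "h \<in> fspan (GL_tuples n r) (pairing_product n r ` hollow_matrices r)"
      "\<And>gs. gs \<in> GL_tuples n r \<Longrightarrow> det (frame n r gs 1) \<noteq> 0 \<Longrightarrow>
        ((\<lambda>e. p (map (\<lambda>g. g * gl_inv (frame n r gs e)) gs)) \<longlongrightarrow> h gs) (at 0)"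
      using step.IH by blast
    obtain h' where h': "h' \<in> fspan (GL_tuples n r) (pairing_product n r ` hollow_matrices r)"
      "\<And>gs. gs \<in> GL_tuples n r \<Longrightarrow> det (frame n r gs 1) \<noteq> 0 \<Longrightarrow>
        ((\<lambda>e. m (map (\<lambda>g. g * gl_inv (frame n r gs e)) gs)) \<longlongrightarrow> h' gs) (at 0)"
      using degeneration_limit_base[OF n step.hyps(2)] by blast
    show ?case
    proof (intro bexI[OF _ fspan_add_scaled[OF h(1) h'(1), of c]] ballI impI)
      fix gs assume gs: "gs \<in> GL_tuples n r" "det (frame n r gs 1) \<noteq> 0"
      have "\<forall>\<^sub>F e in at 0. p (map (\<lambda>g. g * gl_inv (frame n r gs e)) gs) +
          c * m (map (\<lambda>g. g * gl_inv (frame n r gs e)) gs) = f (map (\<lambda>g. g * gl_inv (frame n r gs e)) gs)"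
        using mem[OF gs] by eventually_elim (use step.hyps(3) in simp)
      then show "((\<lambda>e. f (map (\<lambda>g. g * gl_inv (frame n r gs e)) gs)) \<longlongrightarrow> h gs + c * h' gs) (at 0)"
        by (rule Lim_transform_eventually[rotated]) (intro tendsto_intros h(2) h'(2) gs)
    qed
  qed
qed

lemma fspan_tendsto:
  assumes f: "f \<in> fspan X B" and x: "x \<in> X" and ev: "\<forall>\<^sub>F z in fl. \<gamma> z \<in> X"
    and lim: "\<And>m. m \<in> B \<Longrightarrow> ((\<lambda>z. m (\<gamma> z)) \<longlongrightarrow> m x) fl"
  shows "((\<lambda>z. f (\<gamma> z)) \<longlongrightarrow> f x) fl"
  using f
proof induction
  case (zero f)
  have "\<forall>\<^sub>F z in fl. 0 = f (\<gamma> z)" using ev by eventually_elim (use zero in simp)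
  then have "((\<lambda>z. f (\<gamma> z)) \<longlongrightarrow> 0) fl" by (rule Lim_transform_eventually[OF tendsto_const])
  then show ?case using zero x by simp
next
  case (step h m f c)
  have "\<forall>\<^sub>F z in fl. h (\<gamma> z) + c * m (\<gamma> z) = f (\<gamma> z)"
    using ev by eventually_elim (use step.hyps(3) in simp)
  then have "((\<lambda>z. f (\<gamma> z)) \<longlongrightarrow> h x + c * m x) fl"
    by (rule Lim_transform_eventually[rotated]) (intro tendsto_intros step.IH lim step.hyps(2))
  then show ?case using step.hyps(3) x by simp
qed

lemma regular_monomial:
  assumes "n \<ge> 1" "set_mset A \<subseteq> {..<n}" "set_mset B \<subseteq> {..<n}"
  shows "regular_on_GL n (monomial n A B)"
proof -
  have "regular_on_GL n (\<lambda>g. \<Prod>k\<in>#A. g $$ (0, k))"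
    using assms(1,2) by (induction A) (auto intro!: regular_intros)
  moreover have "regular_on_GL n (\<lambda>g. \<Prod>k\<in>#B. gl_inv g $$ (k, n - 1))"
    using assms(1,3) by (induction B) (auto intro!: regular_intros)
  ultimately show ?thesis unfolding monomial_def by (intro regular_intros)
qed

text \<open>The line from a tuple whose first rows are distinct unit vectors to the given tuple. The
determinants involved are polynomials in the parameter and not identically zero, so they vanish at no point near the
end, except possibly at the end itself.\<close>

lemma exists_generic_path:
  assumes n: "n \<ge> 2" "n \<ge> 2 * r" and gs: "gs \<in> GL_tuples n r"
  shows "\<exists>\<gamma>. (\<forall>\<^sub>F z in at (1::complex). \<gamma> z \<in> GL_tuples n r \<and> det (frame n r (\<gamma> z) 1) \<noteq> 0) \<and>
    (\<forall>i<r. \<forall>k<n. \<forall>l<n. ((\<lambda>z. (\<gamma> z ! i) $$ (k, l)) \<longlongrightarrow> (gs ! i) $$ (k, l)) (at 1))"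
proof -
  have "\<forall>i<r. \<exists>g\<in>carrier (GL n). \<forall>k<n. g $$ (0, k) = (if k = i then 1 else 0)"
  proof (intro allI impI)
    fix i assume i: "i < r"
    have "\<exists>g\<in>carrier (GL n). (\<forall>k<n. g $$ (0, k) = (if k = i then 1 else 0)) \<and>
        (\<forall>k<n. gl_inv g $$ (k, n - 1) = (if k = r + i then 1 else 0))"
      using n i by (intro exists_frame[where l = "r + i"]) auto
    then show "\<exists>g\<in>carrier (GL n). \<forall>k<n. g $$ (0, k) = (if k = i then 1 else 0)" by blast
  qed
  then obtain w where w: "\<And>i. i < r \<Longrightarrow> w i \<in> carrier (GL n)"
    "\<And>i k. i < r \<Longrightarrow> k < n \<Longrightarrow> w i $$ (0, k) = (if k = i then 1 else 0)"
    by metis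
  have G: "gs ! i \<in> carrier (GL n)" if "i < r" for i using gs that by (auto simp: GL_tuples_def)
  define P where "P = (\<lambda>i. mat n n (\<lambda>(k, l). [:w i $$ (k, l), (gs ! i) $$ (k, l) - w i $$ (k, l):]))"
  define Q where "Q = mat n n (\<lambda>(k, l). if k < r then P k $$ (0, l) else if k = l then 1 else 0)"
  define \<gamma> where "\<gamma> = (\<lambda>z. map (\<lambda>i. map_mat (\<lambda>p. poly p z) (P i)) [0..<r])"
  have entry: "(\<gamma> z ! i) $$ (k, l) = w i $$ (k, l) + z * ((gs ! i) $$ (k, l) - w i $$ (k, l))"
    if "i < r" "k < n" "l < n" for z i k l
    using that by (simp add: \<gamma>_def P_def)
  have frame: "frame n r (\<gamma> z) 1 = map_mat (\<lambda>p. poly p z) Q" for z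
    using n by (intro eq_matI) (auto simp: frame_def Q_def \<gamma>_def P_def)
  have "det (P i) \<noteq> 0" if i: "i < r" for i
  proof -
    have "map_mat (\<lambda>p. poly p 1) (P i) = gs ! i"
      using GL_carrier[OF G[OF i]] by (intro eq_matI) (auto simp: P_def)
    then have "poly (det (P i)) 1 = det (gs ! i)" by (simp flip: det_eval_poly)
    then show ?thesis using G[OF i] by (auto simp: GL_iff)
  qed
  then have "\<forall>\<^sub>F z in at 1. poly (det (P i)) z \<noteq> 0" if "i < r" for i
    using that by (intro eventually_poly_nonzero) auto
  then have ev1: "\<forall>\<^sub>F z in at 1. \<forall>i\<in>{..<r}. poly (det (P i)) z \<noteq> 0"
    by (intro eventually_ball_finite) auto
  have "map_mat (\<lambda>p. poly p 0) Q = 1\<^sub>m n"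
    using n w(2) by (intro eq_matI) (auto simp: Q_def P_def)
  then have "poly (det Q) 0 = 1" by (simp flip: det_eval_poly)
  then have "det Q \<noteq> 0" by auto
  then have ev2: "\<forall>\<^sub>F z in at 1. poly (det Q) z \<noteq> 0" by (rule eventually_poly_nonzero)
  have "\<forall>\<^sub>F z in at 1. \<gamma> z \<in> GL_tuples n r \<and> det (frame n r (\<gamma> z) 1) \<noteq> 0"
    using ev1 ev2
  proof eventually_elim
    case (elim z)
    have "map_mat (\<lambda>p. poly p z) (P i) \<in> carrier (GL n)" if "i < r" for i
      using elim(1) that by (auto simp: GL_iff det_eval_poly P_def)
    then have "\<gamma> z \<in> GL_tuples n r" by (auto simp: GL_tuples_def \<gamma>_def)
    then show ?case using elim(2) by (simp add: frame det_eval_poly)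
  qed
  moreover have "((\<lambda>z. (\<gamma> z ! i) $$ (k, l)) \<longlongrightarrow> (gs ! i) $$ (k, l)) (at 1)"
    if "i < r" "k < n" "l < n" for i k l
    unfolding entry[OF that] by (auto intro!: tendsto_eq_intros)
  ultimately show ?thesis by blast
qed

text \<open>An invariant function is constant along the translations by \<open>frame\<close>, so it equals their limit, wherever
the frame is invertible. The equality extends to all tuples by continuity along a generic path.\<close>

lemma invariant_in_pairing_span:
  assumes n: "n \<ge> 2" "n \<ge> 2 * r" and f: "f \<in> fspan (GL_tuples n r) (indexed_products n r \<alpha> \<beta>)"
    and inv: "\<And>gs h. gs \<in> GL_tuples n r \<Longrightarrow> h \<in> carrier (GL n) \<Longrightarrow> f (map (\<lambda>g. g * h) gs) = f gs"
  shows "f \<in> fspan (GL_tuples n r) (pairing_product n r ` hollow_matrices r)"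
proof -
  have "r \<le> n" using n by simp
  from degeneration_limit[OF n(1) this f] obtain h
    where h: "h \<in> fspan (GL_tuples n r) (pairing_product n r ` hollow_matrices r)"
      "\<And>gs. gs \<in> GL_tuples n r \<Longrightarrow> det (frame n r gs 1) \<noteq> 0 \<Longrightarrow>
      ((\<lambda>e. f (map (\<lambda>g. g * gl_inv (frame n r gs e)) gs)) \<longlongrightarrow> h gs) (at 0)"
    by blast
  have generic: "f gs = h gs" if gs: "gs \<in> GL_tuples n r" and det: "det (frame n r gs 1) \<noteq> 0" for gs
  proof -
    have "\<forall>\<^sub>F e in at (0::complex). e \<noteq> 0" by (simp add: eventually_at_filter)
    then have "\<forall>\<^sub>F e in at 0. f (map (\<lambda>g. g * gl_inv (frame n r gs e)) gs) = f gs"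
      by eventually_elim (rule inv[OF gs gl_inv_GL[OF frame_GL[OF det]]])
    from Lim_transform_eventually[OF h(2)[OF gs det] this]
    show ?thesis by (intro tendsto_unique[OF _ tendsto_const]) auto
  qed
  have "f gs = h gs" if gs: "gs \<in> GL_tuples n r" for gs
  proof -
    obtain \<gamma> where ev: "\<forall>\<^sub>F z in at (1::complex). \<gamma> z \<in> GL_tuples n r \<and> det (frame n r (\<gamma> z) 1) \<noteq> 0"
      and lim: "\<And>i k l. i < r \<Longrightarrow> k < n \<Longrightarrow> l < n \<Longrightarrow>
        ((\<lambda>z. (\<gamma> z ! i) $$ (k, l)) \<longlongrightarrow> (gs ! i) $$ (k, l)) (at 1)"
      using exists_generic_path[OF n gs] by blast
    have ev': "\<forall>\<^sub>F z in at 1. \<gamma> z \<in> GL_tuples n r" using ev by eventually_elim simp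
    have reg_lim: "((\<lambda>z. p (\<gamma> z ! i)) \<longlongrightarrow> p (gs ! i)) (at 1)" if "regular_on_GL n p" "i < r" for p i
    proof (rule regular_tendsto[OF that(1)])
      show "gs ! i \<in> carrier (GL n)" using gs that by (auto simp: GL_tuples_def)
      show "\<forall>\<^sub>F z in at 1. \<gamma> z ! i \<in> carrier (GL n)"
        using ev' by eventually_elim (use that in \<open>auto simp: GL_tuples_def\<close>)
    qed (rule lim[OF that(2)])
    have row_lim: "((\<lambda>z. (\<gamma> z ! i) $$ (0, k)) \<longlongrightarrow> (gs ! i) $$ (0, k)) (at 1)"
      if "i < r" "k < n" for i k
      using that by (intro lim) auto
    have col_lim: "((\<lambda>z. gl_inv (\<gamma> z ! i) $$ (k, n - 1)) \<longlongrightarrow> gl_inv (gs ! i) $$ (k, n - 1)) (at 1)"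
      if "i < r" "k < n" for i k
      using that n by (intro reg_lim regular_intros) auto
    have "((\<lambda>z. f (\<gamma> z)) \<longlongrightarrow> f gs) (at 1)"
    proof (rule fspan_tendsto[OF f gs ev'])
      fix m assume "m \<in> indexed_products n r \<alpha> \<beta>"
      then obtain A B where "m = (\<lambda>gs. \<Prod>i<r. monomial n (A i) (B i) (gs ! i))"
        "\<forall>i<r. A i \<in> indices n (\<alpha> i) \<and> B i \<in> indices n (\<beta> i)"
        by (auto simp: indexed_products_def)
      then show "((\<lambda>z. m (\<gamma> z)) \<longlongrightarrow> m gs) (at 1)"
        using n by (auto intro!: tendsto_prod reg_lim regular_monomial simp: indices_def)
    qed
    moreover have "\<forall>\<^sub>F z in at 1. f (\<gamma> z) = h (\<gamma> z)"
      using ev by eventually_elim (use generic in blast)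
    ultimately have "((\<lambda>z. h (\<gamma> z)) \<longlongrightarrow> f gs) (at 1)" by (rule Lim_transform_eventually)
    moreover have "((\<lambda>z. h (\<gamma> z)) \<longlongrightarrow> h gs) (at 1)"
    proof (rule fspan_tendsto[OF h(1) gs ev'])
      fix m assume "m \<in> pairing_product n r ` hollow_matrices r"
      then obtain M where m: "m = pairing_product n r M" by blast
      show "((\<lambda>z. m (\<gamma> z)) \<longlongrightarrow> m gs) (at 1)"
        unfolding m pairing_product_def pairing_def
        by (intro tendsto_prod tendsto_power tendsto_sum tendsto_mult row_lim col_lim) auto
    qed
    ultimately show ?thesis by (intro tendsto_unique) auto
  qed
  then show ?thesis by (intro fspan_cong[OF h(1)]) auto
qed

text \<open>Scaling one argument by the torus multiplies the invariant function and each pairing product by a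
character. By linear independence a pairing product can occur only if the two characters agree.\<close>

lemma invariant_expansion:
  assumes n: "n \<ge> 2" "n \<ge> 2 * r" and f: "f \<in> fspan (GL_tuples n r) (indexed_products n r \<alpha> \<beta>)"
    and inv: "\<And>gs h. gs \<in> GL_tuples n r \<Longrightarrow> h \<in> carrier (GL n) \<Longrightarrow> f (map (\<lambda>g. g * h) gs) = f gs"
  shows "\<exists>S c. finite S \<and> S \<subseteq> {M \<in> hollow_matrices r. \<forall>i<r. row_sum r M i = \<alpha> i \<and> col_sum r M i = \<beta> i} \<and>
    (\<forall>gs\<in>GL_tuples n r. f gs = (\<Sum>M\<in>S. c M * pairing_product n r M gs))"
proof -
  obtain S c where S: "finite S" "S \<subseteq> hollow_matrices r"
    and f_eq: "\<And>gs. gs \<in> GL_tuples n r \<Longrightarrow> f gs = (\<Sum>M\<in>S. c M * pairing_product n r M gs)"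
    using fspan_explicit[OF invariant_in_pairing_span[OF n f inv]] by blast
  have n1: "n \<ge> 1" using n by simp
  have vanish: "c M * (torus_weight n (row_sum r M i) (col_sum r M i) u - torus_weight n (\<alpha> i) (\<beta> i) u) = 0"
    if M: "M \<in> S" and i: "i < r" and u: "torus n u" for M i u
  proof (rule pairing_products_independent[OF n S _ M,
        where c = "\<lambda>M. c M * (torus_weight n (row_sum r M i) (col_sum r M i) u - torus_weight n (\<alpha> i) (\<beta> i) u)"])
    fix gs assume gs: "gs \<in> GL_tuples n r"
    let ?gs = "gs[i := u * gs ! i]"
    have "u \<in> carrier (GL n)" "gs ! i \<in> carrier (GL n)" using u gs i by (auto simp: torus_def GL_tuples_def)
    then have mem: "?gs \<in> GL_tuples n r"
      using gs set_update_subset_insert[of gs i] by (auto simp: GL_tuples_def)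
    have "(\<Sum>M\<in>S. c M * (torus_weight n (row_sum r M i) (col_sum r M i) u * pairing_product n r M gs)) = f ?gs"
      unfolding f_eq[OF mem] span_homogeneous[OF n1 u gs i pairing_product_in_span] ..
    also have "\<dots> = torus_weight n (\<alpha> i) (\<beta> i) u * (\<Sum>M\<in>S. c M * pairing_product n r M gs)"
      unfolding span_homogeneous[OF n1 u gs i f] f_eq[OF gs] ..
    finally show "(\<Sum>M\<in>S. c M * (torus_weight n (row_sum r M i) (col_sum r M i) u - torus_weight n (\<alpha> i) (\<beta> i) u) *
        pairing_product n r M gs) = 0"
      by (simp add: algebra_simps sum_subtractf sum_distrib_left)
  qed
  define S' where "S' = {M \<in> S. \<forall>i<r. row_sum r M i = \<alpha> i \<and> col_sum r M i = \<beta> i}"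
  have "c M = 0" if M: "M \<in> S - S'" for M
  proof -
    obtain i where i: "i < r" "row_sum r M i \<noteq> \<alpha> i \<or> col_sum r M i \<noteq> \<beta> i"
      using M by (auto simp: S'_def)
    have pow2: "(2::complex) ^ x \<noteq> 2 ^ y" if "x \<noteq> y" for x y :: nat
    proof
      assume "(2::complex) ^ x = 2 ^ y"
      then have "of_nat (2 ^ x) = (of_nat (2 ^ y) :: complex)" by simp
      then have "(2::nat) ^ x = 2 ^ y" by (simp only: of_nat_eq_iff)
      then show False using that by simp
    qed
    obtain u where u: "torus n u" "u $$ (0, 0) = 2" "u $$ (n - 1, n - 1) = inverse 1"
      using torus_exists[OF n(1), of 2 1] by auto
    have weight: "torus_weight n x y u = 2 ^ x" for x y
      unfolding torus_weight_def u(2,3) by simp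
    obtain u' where u': "torus n u'" "u' $$ (0, 0) = 1" "u' $$ (n - 1, n - 1) = inverse 2"
      using torus_exists[OF n(1) one_neq_zero, of 2] by (metis zero_neq_numeral)
    have weight': "torus_weight n x y u' = 2 ^ y" for x y
      unfolding torus_weight_def u'(2,3) by simp
    from i(2) show ?thesis
    proof
      assume "row_sum r M i \<noteq> \<alpha> i"
      then show ?thesis using vanish[of M i u] M i(1) u(1) pow2 by (simp add: weight)
    next
      assume "col_sum r M i \<noteq> \<beta> i"
      then show ?thesis using vanish[of M i u'] M i(1) u'(1) pow2 by (simp add: weight')
    qed
  qed
  then have "f gs = (\<Sum>M\<in>S'. c M * pairing_product n r M gs)" if "gs \<in> GL_tuples n r" for gs
    unfolding f_eq[OF that] using S(1) by (intro sum.mono_neutral_right) (auto simp: S'_def)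
  then show ?thesis using S by (intro exI[of _ S'] exI[of _ c]) (auto simp: S'_def)
qed

section \<open>A basis of the invariants\<close>

text \<open>For weight \<open>0\<close> the coordinate functions are constants. Linear independence leaves room for only one of them.\<close>

lemma coefficient_model_trivial:
  assumes model: "coefficient_model n 0 0 R \<xi>" and deg: "deg R > 0"
  shows "deg R = 1" and "g \<in> carrier (GL n) \<Longrightarrow> act R g = 1\<^sub>m 1"
proof -
  have sep: "x k = 0" if "\<forall>g\<in>carrier (GL n). (\<Sum>k<deg R. \<xi> k g * x k) = 0" "k < deg R" for x :: "nat \<Rightarrow> complex" and k
    using model that unfolding coefficient_model_def by blast
  have span: "\<xi> k \<in> fspan (carrier (GL n)) (monomials n 0 0)" if "k < deg R" for k
    using model that unfolding coefficient_model_def by blast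
  define c where "c = (\<lambda>k. \<xi> k (1\<^sub>m n))"
  have const: "\<xi> k g = c k" if k: "k < deg R" and g: "g \<in> carrier (GL n)" for k g
  proof -
    have "f g = f (1\<^sub>m n)" if "f \<in> fspan (carrier (GL n)) (monomials n 0 0)" for f
      using that
    proof induction
      case (zero f)
      then show ?case using g by simp
    next
      case (step h m f e)
      have "m g = m (1\<^sub>m n)"
        using step.hyps(2) by (auto simp: monomials_def indices_def monomial_def)
      then show ?case using step.hyps(3) step.IH g by simp
    qed
    then show ?thesis using span[OF k] by (simp add: c_def)
  qed
  have c_nz: "c k \<noteq> 0" if k: "k < deg R" for k
  proof
    assume "c k = 0"
    have "(\<Sum>j<deg R. \<xi> j g * (if j = k then 1 else 0)) = 0" if g: "g \<in> carrier (GL n)" for g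
    proof (rule sum.neutral, rule ballI)
      fix j assume "j \<in> {..<deg R}"
      then show "\<xi> j g * (if j = k then 1 else 0) = 0"
        using const[OF _ g, of j] \<open>c k = 0\<close> by simp
    qed
    then have "(if k = k then 1 else 0) = (0::complex)"
      using k by (intro sep[of "\<lambda>j. if j = k then 1 else 0"]) auto
    then show False by simp
  qed
  show d1: "deg R = 1"
  proof (rule ccontr)
    assume "deg R \<noteq> 1"
    with deg have d: "0 < deg R" "1 < deg R" by auto
    define x where "x = (\<lambda>k::nat. if k = 0 then c 1 else if k = 1 then - c 0 else (0::complex))"
    have "(\<Sum>k<deg R. \<xi> k g * x k) = 0" if g: "g \<in> carrier (GL n)" for g
    proof -
      have "(\<Sum>k<deg R. \<xi> k g * x k) = (\<Sum>k\<in>{0, 1}. \<xi> k g * x k)"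
        using d by (intro sum.mono_neutral_right) (auto simp: x_def)
      then show ?thesis using d const[OF _ g] by (simp add: x_def)
    qed
    then have "x 0 = 0" using d by (intro sep) auto
    then show False using c_nz[OF d(2)] by (simp add: x_def)
  qed
  show "act R g = 1\<^sub>m 1" if g: "g \<in> carrier (GL n)"
  proof -
    have car: "act R g \<in> carrier_mat 1 1" using model g d1 unfolding coefficient_model_def by metis
    have "\<xi> 0 (1\<^sub>m n * g) = (\<Sum>l<deg R. \<xi> l (1\<^sub>m n) * act R g $$ (l, 0))"
      using model g deg GL_one unfolding coefficient_model_def by blast
    then have "c 0 = c 0 * act R g $$ (0, 0)"
      using const[of 0 "1\<^sub>m n * g"] g d1 GL_carrier[OF g] by (simp add: c_def)
    then have "act R g $$ (0, 0) = 1" using c_nz[of 0] d1 by simp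
    then show ?thesis using car by (intro eq_matI) auto
  qed
qed

text \<open>Converts independence and spanning, read off from the entries, into the dimension of the subspace.\<close>

lemma dim_eq_card:
  assumes I: "subspace class_ring I (module_mat TYPE(complex) N 1)"
    and fin: "finite \<H>" and inj: "inj_on T \<H>" and T: "T ` \<H> \<subseteq> I"
    and indep: "\<And>c M. (\<And>k. k < N \<Longrightarrow> (\<Sum>M\<in>\<H>. c M * T M $$ (k, 0)) = 0) \<Longrightarrow> M \<in> \<H> \<Longrightarrow> c M = 0"
    and span: "\<And>X. X \<in> I \<Longrightarrow> \<exists>c. \<forall>k<N. X $$ (k, 0) = (\<Sum>M\<in>\<H>. c M * T M $$ (k, 0))"
  shows "vectorspace.dim class_ring (module_mat TYPE(complex) N 1 \<lparr>carrier := I\<rparr>) = card \<H>"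
proof -
  let ?V = "module_mat TYPE(complex) N 1"
  let ?W = "?V\<lparr>carrier := I\<rparr>"
  have V: "vectorspace class_ring ?V" by (rule matrix_vs)
  interpret W: vectorspace class_ring ?W
    by (rule vectorspace.subspace_is_vs[OF V I])
  have I_car: "I \<subseteq> carrier_mat N 1"
    using I unfolding subspace_def LinearCombinations.submodule_def by (simp add: module_mat_simps)
  have lincomb: "W.lincomb a A \<in> carrier_mat N 1 \<and>
      (\<forall>k<N. W.lincomb a A $$ (k, 0) = (\<Sum>X\<in>A. a X * X $$ (k, 0)))"
    if A: "finite A" "A \<subseteq> I" for a A
    using A
  proof (induction A rule: finite_induct)
    case empty
    have "W.lincomb a {} = 0\<^sub>m N 1" unfolding W.lincomb_def W.finsum_empty by (simp add: module_mat_simps)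
    then show ?case by simp
  next
    case (insert X A)
    have "W.lincomb a (insert X A) = a X \<cdot>\<^sub>m X + W.lincomb a A"
      unfolding W.lincomb_def
      using insert.prems insert.hyps
      by (subst W.finsum_insert) (auto simp: module_mat_simps class_ring_simps intro!: W.smult_closed[simplified module_mat_simps, simplified])
    then show ?case using insert I_car by auto
  qed
  define A where "A = T ` \<H>"
  have A: "finite A" "A \<subseteq> I" using fin T by (auto simp: A_def)
  have sum_A: "(\<Sum>X\<in>A. a X * X $$ (k, 0)) = (\<Sum>M\<in>\<H>. a (T M) * T M $$ (k, 0))" for a :: "complex mat \<Rightarrow> complex" and k
    unfolding A_def using inj by (simp add: sum.reindex)
  have "W.lin_indpt A"
  proof (rule W.finite_lin_indpt2)
    fix a assume zero: "W.lincomb a A = \<zero>\<^bsub>?W\<^esub>"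
    have "a (T M) = 0" if "M \<in> \<H>" for M
    proof (rule indep[OF _ that])
      fix k assume k: "k < N"
      have "W.lincomb a A $$ (k, 0) = 0" using zero k by (simp add: module_mat_simps)
      then show "(\<Sum>M\<in>\<H>. a (T M) * T M $$ (k, 0)) = 0"
        using lincomb[OF A, of a] k by (simp add: sum_A)
    qed
    then show "\<forall>v\<in>A. a v = \<zero>\<^bsub>class_ring\<^esub>" by (auto simp: A_def class_ring_simps)
  qed (use A in auto)
  moreover have "W.span A = carrier ?W"
  proof (intro subset_antisym subsetI)
    fix X assume "X \<in> W.span A"
    then show "X \<in> carrier ?W" using W.span_is_subset2[of A] A by auto
  next
    fix X assume "X \<in> carrier ?W"
    then have X: "X \<in> I" by simp
    then obtain c where c: "\<forall>k<N. X $$ (k, 0) = (\<Sum>M\<in>\<H>. c M * T M $$ (k, 0))" using span by blast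
    define a where "a = (\<lambda>Y. c (the_inv_into \<H> T Y))"
    have "a (T M) = c M" if "M \<in> \<H>" for M
      using the_inv_into_f_f[OF inj that] by (simp add: a_def)
    then have "X = W.lincomb a A"
      using lincomb[OF A, of a] I_car X c by (intro eq_matI) (auto simp: sum_A)
    then show "X \<in> W.span A"
      using W.finite_in_span[of A X] A unfolding W.span_def by (auto simp: class_ring_simps)
  qed
  ultimately have "W.basis A" unfolding W.basis_def using A(2) by simp
  then have "W.dim = card A" by (rule W.dim_basis[OF A(1)])
  then show ?thesis by (simp add: A_def card_image[OF inj])
qed

definition hollow_tables :: "nat list \<Rightarrow> nat list \<Rightarrow> nat mat set" where
  "hollow_tables a b = {M \<in> contingency_tables a b. hollow M}"

lemma hollow_tables_eq:
  assumes "length a = r" "length b = r"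
  shows "hollow_tables a b =
    {M \<in> hollow_matrices r. \<forall>i<r. row_sum r M i = a ! i \<and> col_sum r M i = b ! i}"
  using assms by (auto simp: hollow_tables_def contingency_tables_def hollow_matrices_def row_sum_def col_sum_def)

lemma finite_hollow_tables:
  assumes "length a = r" "length b = r"
  shows "finite (hollow_tables a b)"
proof -
  define K where "K = sum_list a"
  have "hollow_tables a b \<subseteq> mat r r ` (({..<r} \<times> {..<r}) \<rightarrow>\<^sub>E {..K})"
  proof
    fix M assume "M \<in> hollow_tables a b"
    then have M: "M \<in> carrier_mat r r" "\<And>i. i < r \<Longrightarrow> (\<Sum>j<r. M $$ (i, j)) = a ! i"
      using assms by (auto simp: hollow_tables_def contingency_tables_def)
    have "M $$ (i, j) \<le> K" if ij: "i < r" "j < r" for i j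
    proof -
      have "M $$ (i, j) \<le> (\<Sum>j<r. M $$ (i, j))" using ij by (intro member_le_sum) auto
      also have "\<dots> \<le> K" using M(2)[OF ij(1)] ij(1) assms by (auto simp: K_def intro: elem_le_sum_list)
      finally show ?thesis .
    qed
    then have "restrict (\<lambda>p. M $$ p) ({..<r} \<times> {..<r}) \<in> ({..<r} \<times> {..<r}) \<rightarrow>\<^sub>E {..K}"
      by (intro restrict_PiE_iff[THEN iffD2]) auto
    moreover have "M = mat r r (restrict (\<lambda>p. M $$ p) ({..<r} \<times> {..<r}))"
      using M(1) by (intro eq_matI) auto
    ultimately show "M \<in> mat r r ` (({..<r} \<times> {..<r}) \<rightarrow>\<^sub>E {..K})" by blast
  qed
  then show ?thesis by (rule finite_subset) (intro finite_imageI finite_PiE; simp)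
qed

lemma invariants_subspace:
  assumes S: "\<And>g. g \<in> carrier (GL n) \<Longrightarrow> act S g \<in> carrier_mat (deg S) (deg S)"
    and I: "I = {T \<in> carrier_mat (deg S) 1. \<forall>g\<in>carrier (GL n). act S g * T = T}"
  shows "subspace class_ring I (module_mat TYPE(complex) (deg S) 1)"
proof -
  have V: "vectorspace class_ring (module_mat TYPE(complex) (deg S) 1)" by (rule matrix_vs)
  then have "module class_ring (module_mat TYPE(complex) (deg S) 1)" by (rule vectorspace.axioms(1))
  with V show ?thesis
    unfolding subspace_def LinearCombinations.submodule_def
    using S right_mult_zero_mat[OF S, of _ 1] by (auto simp: I module_mat_simps class_ring_simps mult_add_distrib_mat[of _ "deg S" "deg S"]
        mult_smult_distrib[of _ "deg S" "deg S"])
qed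

lemma span_is_tensor_coefficient:
  assumes model: "tensor_model n ab Ds"
    and f: "f \<in> fspan (GL_tuples n (length ab)) (monomial_products n ab)"
  shows "\<exists>x. \<forall>gs\<in>GL_tuples n (length ab).
    f gs = (\<Sum>k<deg (tensor_reps (map fst Ds)). tensor_coefficient Ds k gs * x k)"
  using f
proof induction
  case (zero f)
  then show ?case by (intro exI[of _ "\<lambda>_. 0"]) simp
next
  case (step h m f c)
  obtain x where x: "\<forall>gs\<in>GL_tuples n (length ab).
      h gs = (\<Sum>k<deg (tensor_reps (map fst Ds)). tensor_coefficient Ds k gs * x k)"
    using step.IH by blast
  obtain y where y: "\<forall>gs\<in>GL_tuples n (length ab).
      m gs = (\<Sum>k<deg (tensor_reps (map fst Ds)). tensor_coefficient Ds k gs * y k)"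
    using step.hyps(2) monomial_product_is_tensor_coefficient[OF model] by (auto simp: monomial_products_def)
  show ?case
    using x y step.hyps(3)
    by (intro exI[of _ "\<lambda>k. x k + c * y k"]) (simp add: algebra_simps sum.distrib sum_distrib_left)
qed

text \<open>Under the embedding into functions of \<open>r\<close> group elements, the pairing products of hollow
tables with the given margins correspond to invariant vectors, and these form a basis.\<close>

lemma dim_invariants:
  assumes n: "n \<ge> 2" "n \<ge> 2 * r" and len: "length a = r" "length b = r"
    and model: "tensor_model n (zip a b) Ds"
  defines "S \<equiv> tensor_reps (map fst Ds)"
  shows "vectorspace.dim class_ring (module_mat TYPE(complex) (deg S) 1
    \<lparr>carrier := {T \<in> carrier_mat (deg S) 1. \<forall>g\<in>carrier (GL n). act S g * T = T}\<rparr>) = card (hollow_tables a b)"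
proof -
  let ?I = "{T \<in> carrier_mat (deg S) 1. \<forall>g\<in>carrier (GL n). act S g * T = T}"
  let ?N = "deg S" and ?X = "GL_tuples n r" and ?\<tau> = "tensor_coefficient Ds"
  have lz: "length (zip a b) = r" using len by simp
  have S_car: "act S g \<in> carrier_mat ?N ?N" if "g \<in> carrier (GL n)" for g
    unfolding S_def by (rule act_tensor_carrier[OF model that])
  have sep: "x k = 0" if "\<And>gs. gs \<in> ?X \<Longrightarrow> (\<Sum>k<?N. ?\<tau> k gs * x k) = 0" "k < ?N" for x k
    using tensor_coefficients_separate[OF model, of x k] that unfolding S_def lz by blast
  have translate: "(\<Sum>k<?N. ?\<tau> k (map (\<lambda>g. g * h) gs) * T $$ (k, 0)) = (\<Sum>l<?N. ?\<tau> l gs * (act S h * T) $$ (l, 0))"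
    if T: "T \<in> carrier_mat ?N 1" and gs: "gs \<in> ?X" and h: "h \<in> carrier (GL n)" for T gs h
  proof -
    have "(\<Sum>k<?N. ?\<tau> k (map (\<lambda>g. g * h) gs) * T $$ (k, 0)) =
        (\<Sum>k<?N. \<Sum>l<?N. ?\<tau> l gs * act S h $$ (l, k) * T $$ (k, 0))"
      using tensor_coefficient_translate[OF model _ h, unfolded lz, OF gs] by (simp add: S_def sum_distrib_right)
    also have "\<dots> = (\<Sum>l<?N. \<Sum>k<?N. ?\<tau> l gs * act S h $$ (l, k) * T $$ (k, 0))"
      by (rule sum.swap)
    also have "\<dots> = (\<Sum>l<?N. ?\<tau> l gs * (act S h * T) $$ (l, 0))"
      by (intro sum.cong) (simp_all add: mat_mult_entry[OF S_car[OF h] T] sum_distrib_left mult.assoc del: index_mult_mat)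
    finally show ?thesis .
  qed
  have "\<forall>M\<in>hollow_tables a b. \<exists>x. \<forall>gs\<in>?X. pairing_product n r M gs = (\<Sum>k<?N. ?\<tau> k gs * x k)"
  proof
    fix M assume M: "M \<in> hollow_tables a b"
    have "indexed_products n r (row_sum r M) (col_sum r M) =
        indexed_products n r (\<lambda>i. fst (zip a b ! i)) (\<lambda>i. snd (zip a b ! i))"
      using M len by (auto simp: hollow_tables_eq indexed_products_def)
    then have "pairing_product n r M \<in> fspan ?X (monomial_products n (zip a b))"
      using pairing_product_in_span[of n r M ?X] by (simp add: fspan_monomial_products[OF lz])
    then show "\<exists>x. \<forall>gs\<in>?X. pairing_product n r M gs = (\<Sum>k<?N. ?\<tau> k gs * x k)"
      using span_is_tensor_coefficient[OF model, unfolded lz] unfolding S_def by blast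
  qed
  then obtain x where x: "\<And>M gs. M \<in> hollow_tables a b \<Longrightarrow> gs \<in> ?X \<Longrightarrow>
      pairing_product n r M gs = (\<Sum>k<?N. ?\<tau> k gs * x M k)"
    by metis
  define T where "T = (\<lambda>M. mat ?N 1 (\<lambda>(k, _). x M k))"
  have T_car: "T M \<in> carrier_mat ?N 1" for M by (simp add: T_def)
  have T_value: "pairing_product n r M gs = (\<Sum>k<?N. ?\<tau> k gs * T M $$ (k, 0))"
    if "M \<in> hollow_tables a b" "gs \<in> ?X" for M gs
    using x[OF that] by (simp add: T_def)
  have T_I: "T M \<in> ?I" if M: "M \<in> hollow_tables a b" for M
  proof -
    have "act S h * T M = T M" if h: "h \<in> carrier (GL n)" for h
    proof (rule eq_matI)
      fix k l assume "k < dim_row (T M)" "l < dim_col (T M)"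
      then have kl: "k < ?N" "l = 0" by (auto simp: T_def)
      have "(act S h * T M) $$ (k, 0) - T M $$ (k, 0) = 0"
      proof (rule sep[of "\<lambda>k. (act S h * T M) $$ (k, 0) - T M $$ (k, 0)", OF _ kl(1)])
        fix gs assume gs: "gs \<in> ?X"
        have "(\<Sum>l<?N. ?\<tau> l gs * (act S h * T M) $$ (l, 0)) = pairing_product n r M (map (\<lambda>g. g * h) gs)"
          unfolding T_value[OF M map_translate_GL_tuples[OF gs h]] translate[OF T_car gs h] ..
        also have "\<dots> = pairing_product n r M gs"
          using n by (intro pairing_product_translate[OF gs h]) simp
        finally show "(\<Sum>k<?N. ?\<tau> k gs * ((act S h * T M) $$ (k, 0) - T M $$ (k, 0))) = 0"
          by (simp add: T_value[OF M gs] right_diff_distrib sum_subtractf)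
      qed
      then show "(act S h * T M) $$ (k, l) = T M $$ (k, l)" using kl by simp
    qed (use S_car[OF h] T_car[of M] in auto)
    then show ?thesis using T_car by simp
  qed
  have fin: "finite (hollow_tables a b)" by (rule finite_hollow_tables[OF len])
  have sub: "hollow_tables a b \<subseteq> hollow_matrices r" by (auto simp: hollow_tables_eq[OF len])
  have indep: "c M = 0"
    if c: "\<And>k. k < ?N \<Longrightarrow> (\<Sum>M\<in>hollow_tables a b. c M * T M $$ (k, 0)) = 0" and M: "M \<in> hollow_tables a b" for c M
  proof (rule pairing_products_independent[OF n fin sub _ M, where c = c])
    fix gs assume gs: "gs \<in> ?X"
    have "(\<Sum>M\<in>hollow_tables a b. c M * pairing_product n r M gs) =
        (\<Sum>M\<in>hollow_tables a b. \<Sum>k<?N. ?\<tau> k gs * (c M * T M $$ (k, 0)))"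
      using T_value[OF _ gs] by (intro sum.cong) (simp_all add: sum_distrib_left mult_ac)
    also have "\<dots> = (\<Sum>k<?N. \<Sum>M\<in>hollow_tables a b. ?\<tau> k gs * (c M * T M $$ (k, 0)))" by (rule sum.swap)
    also have "\<dots> = 0" using c by (simp flip: sum_distrib_left)
    finally show "(\<Sum>M\<in>hollow_tables a b. c M * pairing_product n r M gs) = 0" .
  qed
  show ?thesis
  proof (rule dim_eq_card[where T = T])
    show "subspace class_ring ?I (module_mat TYPE(complex) ?N 1)"
      by (rule invariants_subspace[OF S_car]) auto
    show "finite (hollow_tables a b)" by (rule fin)
    show "T ` hollow_tables a b \<subseteq> ?I" using T_I by blast
    show "inj_on T (hollow_tables a b)"
    proof (rule inj_onI, rule ccontr)
      fix M M' assume M: "M \<in> hollow_tables a b" "M' \<in> hollow_tables a b" "T M = T M'" "M \<noteq> M'"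
      define c where "c = (\<lambda>L. if L = M then 1 else if L = M' then - 1 else (0::complex))"
      have "c M = 0"
      proof (rule indep[OF _ M(1)])
        fix k assume "k < ?N"
        have "(\<Sum>L\<in>hollow_tables a b. c L * T L $$ (k, 0)) = (\<Sum>L\<in>{M, M'}. c L * T L $$ (k, 0))"
          using M fin by (intro sum.mono_neutral_right) (auto simp: c_def)
        also have "\<dots> = c M * T M $$ (k, 0) + c M' * T M' $$ (k, 0)"
          using M(4) by simp
        also have "c M = 1" by (simp add: c_def)
        also have "c M' = - 1" using M(4)[symmetric] by (simp add: c_def)
        finally show "(\<Sum>L\<in>hollow_tables a b. c L * T L $$ (k, 0)) = 0"
          unfolding M(3) by simp
      qed
      then show False by (simp add: c_def)
    qed
    show "c M = 0"
      if "\<And>k. k < ?N \<Longrightarrow> (\<Sum>M\<in>hollow_tables a b. c M * T M $$ (k, 0)) = 0" "M \<in> hollow_tables a b" for c M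
      by (rule indep[OF that])
    show "\<exists>c. \<forall>k<?N. Y $$ (k, 0) = (\<Sum>M\<in>hollow_tables a b. c M * T M $$ (k, 0))" if Y: "Y \<in> ?I" for Y
    proof -
      have Yc: "Y \<in> carrier_mat ?N 1" "\<And>h. h \<in> carrier (GL n) \<Longrightarrow> act S h * Y = Y" using Y by auto
      define f where "f = (\<lambda>gs. \<Sum>k<?N. ?\<tau> k gs * Y $$ (k, 0))"
      have "(\<lambda>gs. \<Sum>k<?N. Y $$ (k, 0) * ?\<tau> k gs) \<in> fspan ?X (monomial_products n (zip a b))"
        using tensor_coefficients_in_span[OF model, unfolded lz] unfolding S_def
        by (intro fspan_sum fspan_scaled) auto
      then have f: "f \<in> fspan ?X (indexed_products n r (\<lambda>i. fst (zip a b ! i)) (\<lambda>i. snd (zip a b ! i)))"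
        unfolding fspan_monomial_products[OF lz] by (rule fspan_cong) (simp add: f_def mult.commute)
      have inv: "f (map (\<lambda>g. g * h) gs) = f gs" if "gs \<in> ?X" "h \<in> carrier (GL n)" for gs h
        unfolding f_def translate[OF Yc(1) that] using Yc(2)[OF that(2)] by simp
      obtain L c where L: "finite L"
        "L \<subseteq> {M \<in> hollow_matrices r. \<forall>i<r. row_sum r M i = fst (zip a b ! i) \<and> col_sum r M i = snd (zip a b ! i)}"
        "\<And>gs. gs \<in> ?X \<Longrightarrow> f gs = (\<Sum>M\<in>L. c M * pairing_product n r M gs)"
        using invariant_expansion[OF n f inv] by blast
      have LH: "L \<subseteq> hollow_tables a b" using L(2) len by (auto simp: hollow_tables_eq)
      define c' where "c' = (\<lambda>M. if M \<in> L then c M else 0)"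
      have "Y $$ (k, 0) - (\<Sum>M\<in>hollow_tables a b. c' M * T M $$ (k, 0)) = 0" if k: "k < ?N" for k
      proof (rule sep[of "\<lambda>k. Y $$ (k, 0) - (\<Sum>M\<in>hollow_tables a b. c' M * T M $$ (k, 0))", OF _ k])
        fix gs assume gs: "gs \<in> ?X"
        have "(\<Sum>k<?N. ?\<tau> k gs * (\<Sum>M\<in>hollow_tables a b. c' M * T M $$ (k, 0))) =
            (\<Sum>k<?N. \<Sum>M\<in>hollow_tables a b. c' M * (?\<tau> k gs * T M $$ (k, 0)))"
          by (simp add: sum_distrib_left mult_ac)
        also have "\<dots> = (\<Sum>M\<in>hollow_tables a b. \<Sum>k<?N. c' M * (?\<tau> k gs * T M $$ (k, 0)))"
          by (rule sum.swap)
        also have "\<dots> = (\<Sum>M\<in>hollow_tables a b. c' M * pairing_product n r M gs)"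
          using T_value[OF _ gs] by (intro sum.cong) (simp_all add: sum_distrib_left)
        also have "\<dots> = (\<Sum>M\<in>L. c M * pairing_product n r M gs)"
          using LH fin by (intro sum.mono_neutral_cong_right) (auto simp: c'_def)
        also have "\<dots> = f gs" using L(3)[OF gs] by simp
        finally show "(\<Sum>k<?N. ?\<tau> k gs * (Y $$ (k, 0) - (\<Sum>M\<in>hollow_tables a b. c' M * T M $$ (k, 0)))) = 0"
          by (simp add: f_def right_diff_distrib sum_subtractf)
      qed
      then show ?thesis by (intro exI[of _ c']) simp
    qed
  qed
qed

theorem corollary4:
  fixes n r :: nat and a b :: "nat list" and \<mu> :: "int list list"
  assumes "n \<ge> 1" and "r \<ge> 1"
    and "length a = r" and "length b = r" and "length \<mu> = r"
    and "\<forall>i<r. \<mu> ! i = int (a ! i) # replicate (n - 2) 0 @ [- int (b ! i)]"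
    and "n \<ge> 2 * r"
  shows "LRC n (replicate n 0) \<mu> = card {M \<in> contingency_tables a b. hollow M}"
proof -
  have n: "n \<ge> 2" using assms(2,7) by simp
  have "\<exists>\<xi>. coefficient_model n x y (F n (hook_weight n x y)) \<xi>" for x y
    by (rule irrep_has_coefficient_model[OF n F_irrep[OF n]])
  then obtain \<xi> where \<xi>: "\<And>x y. coefficient_model n x y (F n (hook_weight n x y)) (\<xi> x y)"
    by metis
  define Ds where "Ds = map (\<lambda>(x, y). (F n (hook_weight n x y), \<xi> x y)) (zip a b)"
  have model: "tensor_model n (zip a b) Ds"
    unfolding tensor_model_def Ds_def by (auto simp: list_all2_conv_all_nth \<xi> split: prod.split)
  have Fs: "map (F n) \<mu> = map fst Ds"
    using assms(3-6) by (intro nth_equalityI) (auto simp: Ds_def hook_weight_def)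
  have "hook_weight n 0 0 = replicate n 0"
    using n by (intro nth_equalityI) (auto simp: hook_weight_def nth_Cons' nth_append)
  moreover have "deg (F n (hook_weight n 0 0)) > 0"
    using F_irrep[OF n, of 0 0] by (simp add: is_irrep_with_highest_weight_def irreducible_rep_def)
  ultimately have F0: "deg (F n (replicate n 0)) = 1"
    "\<And>g. g \<in> carrier (GL n) \<Longrightarrow> act (F n (replicate n 0)) g = 1\<^sub>m 1"
    using coefficient_model_trivial[OF \<xi>[of 0 0]] by simp_all
  let ?S = "tensor_reps (map fst Ds)"
  have "intertwiners n (F n (replicate n 0)) ?S =
      {T \<in> carrier_mat (deg ?S) 1. \<forall>g\<in>carrier (GL n). act ?S g * T = T}"
    unfolding intertwiners_def F0(1) by (auto simp: F0(2))
  then have "LRC n (replicate n 0) \<mu> = card (hollow_tables a b)"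
    using dim_invariants[OF n assms(7,3,4) model] by (simp add: LRC_def dim_Hom_def F0(1) Fs)
  then show ?thesis by (simp add: hollow_tables_def)
qed

end
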